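(* Let $n\geq 1$, $\sigma>0$, $\mu,\nu>0$, $p,q>1$, let $u_0,v_0\in L^{\infty}(\mathbb{R}^n)\cap L^1(\mathbb{R}^n)$, and assume $$\min\{p,q\}>1+\frac{2\sigma}{n}.$$ Then there exists $\varepsilon_0>0$ such that for any $\varepsilon\in(0,\varepsilon_0]$ the Cauchy problem $$\begin{cases}u_t+(-\Delta)^{\sigma}u+\mu u-\nu v=u^p,&x\in\mathbb{R}^n,\ t>0,\\ v_t+(-\Delta)^{\sigma}v-\mu u+\nu v=v^q,&x\in\mathbb{R}^n,\ t>0,\\ u(0,x)=\varepsilon u_0(x),\ v(0,x)=\varepsilon v_0(x),&x\in\mathbb{R}^n,\end{cases}$$ has uniquely determined global in-time solutions $$(u,v)\in\mathcal{C}([0,+\infty),L^{m_1}(\mathbb{R}^n))\times\mathcal{C}([0,+\infty),L^{m_2}(\mathbb{R}^n))$$ for any $1\leq m_1,m_2\leq+\infty$. Furthermore, for $w\in\{u,v\}$ they satisfy the equivalent integral equations $$w(t,x)=\varepsilon K_0^w(t,|D|)u_0(x)+\varepsilon K_1^w(t,|D|)v_0(x)+\int_0^t\big(K_0^w(t-\tau,|D|)[u(\tau,x)]^p+K_1^w(t-\tau,|D|)[v(\tau,x)]^q\big)\,\mathrm{d}\tau,$$ and the decay estimates, for all $t\geq 0$, $$\|w(t,\cdot)\|_{L^{m}}\lesssim\varepsilon(1+t)^{-\frac{n}{2\sigma}(1-\frac1m)}\|(u_0,v_0)\|_{(L^{\infty}\cap L^1)^2},$$ where $m=m_1$ if $w=u$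 and $m=m_2$ if $w=v$.
   Context: Fourier convention: $\widehat f(\xi)=\int_{\mathbb{R}^n}\mathrm{e}^{-\mathrm{i}x\cdot\xi}f(x)\,\mathrm{d}x$, with inverse $\mathcal{F}^{-1}$. The fractional Laplacian is $(-\Delta)^{\sigma}f=\mathcal{F}^{-1}(|\xi|^{2\sigma}\widehat f)$. The fractional heat kernel is $G(t,x)=\mathcal{F}^{-1}_{\xi\to x}(\mathrm{e}^{-|\xi|^{2\sigma}t})$, and $\mathcal{G}(t,|D|)$ is the Fourier multiplier operator with symbol $\mathrm{e}^{-|\xi|^{2\sigma}t}$, i.e. $\mathcal{G}(t,|D|)f=G(t,\cdot)*f$ for $t>0$ and $\mathcal{G}(0,|D|)=\mathrm{Id}$. The solution operators are $$K_0^u(t,|D|)=\frac{\nu+\mu\mathrm{e}^{-(\mu+\nu)t}}{\mu+\nu}\mathcal{G}(t,|D|),\quad K_1^u(t,|D|)=\frac{\nu-\nu\mathrm{e}^{-(\mu+\nu)t}}{\mu+\nu}\mathcal{G}(t,|D|),$$ $$K_0^v(t,|D|)=\frac{\mu-\mu\mathrm{e}^{-(\mu+\nu)t}}{\mu+\nu}\mathcal{G}(t,|D|),\quad K_1^v(t,|D|)=\frac{\mu+\nu\mathrm{e}^{-(\mu+\nu)t}}{\mu+\nu}\mathcal{G}(t,|D|).$$ Solutions are understood in the mild sense, i.e. as solutions of the displayed integral equations. Data and solutions are real-valued and are not assumed non-negative; at negative values, the power $s^p$ (respectively $s^q$) is read as either $|s|^p$ or $|s|^{p-1}s$ (respectively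 $|s|^q$ or $|s|^{q-1}s$), and the statement is meant for each of these readings. The norm is $\|(f,g)\|_{(L^\infty\cap L^1)^2}=\|f\|_{L^\infty}+\|f\|_{L^1}+\|g\|_{L^\infty}+\|g\|_{L^1}$. $A\lesssim B$ means $A\leq CB$ with a constant $C>0$ independent of $t$, $\varepsilon$ and the data.
   Formalization: For m=∞, norm continuity at t=0 fails for data such as the indicator of a ball; there, continuity at t=0 is weak-* with local boundedness (norm continuity for t>0), and it is norm continuity on [0,∞) for a component whose datum has a uniformly continuous version. *)

theory Defs
  imports "HOL-Analysis.Analysis" "HOL-Probability.Essential_Supremum"
begin

section \<open>Lebesgue spaces and curves in them\<close>

text \<open>
  Elements of $L^m$ are represented by Borel functions, which are to be identified when they
  agree almost everywhere.  Exponents range over \<^typ>\<open>ennreal\<close> so that \<open>m = \<infinity>\<close> is included.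
  \<open>Lp_norm\<close> is real-valued and only meaningful on \<open>Lp_space\<close>.
\<close>

definition Lp_space :: "ennreal \<Rightarrow> ('a::euclidean_space \<Rightarrow> real) set" where
  "Lp_space m = {f \<in> borel_measurable lborel.
     if m = \<infinity> then esssup lborel (\<lambda>x. ennreal \<bar>f x\<bar>) < \<infinity>
     else integrable lborel (\<lambda>x. \<bar>f x\<bar> powr enn2real m)}"

definition Lp_norm :: "ennreal \<Rightarrow> ('a::euclidean_space \<Rightarrow> real) \<Rightarrow> real" where
  "Lp_norm m f =
     (if m = \<infinity> then enn2real (esssup lborel (\<lambda>x. ennreal \<bar>f x\<bar>))
      else (LINT x|lborel. \<bar>f x\<bar> powr enn2real m) powr (1 / enn2real m))"

definition Lp_continuous_on ::
  "ennreal \<Rightarrow> real set \<Rightarrow> (real \<Rightarrow> 'a::euclidean_space \<Rightarrow> real) \<Rightarrow> bool" where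
  "Lp_continuous_on m I w \<longleftrightarrow>
     (\<forall>t\<in>I. w t \<in> Lp_space m) \<and>
     (\<forall>t\<in>I. ((\<lambda>s. Lp_norm m (\<lambda>x. w s x - w t x)) \<longlongrightarrow> 0) (at t within I))"

text \<open>
  The space $C([0,\infty),L^m)$.  For \<open>m < \<infinity>\<close> this is norm continuity on $[0,\infty)$.
  For \<open>m = \<infinity>\<close> the fractional heat semigroup is not strongly continuous at $t = 0$: for
  $t > 0$ its values are continuous functions, so that norm convergence as $t \to 0$ would force
  the datum to be continuous.  We therefore use the customary convention for bounded data: norm
  continuity on $(0,\infty)$ and weak-* continuity at $t = 0$.  (The boundedness near $0$ that is
  included is a consequence of weak-* continuity, by the uniform boundedness principle.)
\<close>

definition Lp_curve :: "ennreal \<Rightarrow> (real \<Rightarrow> 'a::euclidean_space \<Rightarrow> real) \<Rightarrow> bool" where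
  "Lp_curve m w \<longleftrightarrow>
     (if m = \<infinity> then
        Lp_continuous_on \<infinity> {0<..} w \<and>
        w 0 \<in> Lp_space \<infinity> \<and>
        (\<exists>B. \<forall>t\<in>{0..1}. Lp_norm \<infinity> (w t) \<le> B) \<and>
        (\<forall>\<phi>\<in>Lp_space 1.
           ((\<lambda>t. LINT x|lborel. w t x * \<phi> x) \<longlongrightarrow> (LINT x|lborel. w 0 x * \<phi> x)) (at_right 0))
      else Lp_continuous_on m {0..} w)"

definition has_ucont_version :: "('a::euclidean_space \<Rightarrow> real) \<Rightarrow> bool" where
  "has_ucont_version f \<longleftrightarrow>
     (\<exists>g. uniformly_continuous_on UNIV g \<and> (AE x in lborel. f x = g x))"

definition data_norm ::
  "('a::euclidean_space \<Rightarrow> real) \<Rightarrow> ('a \<Rightarrow> real) \<Rightarrow> real" where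
  "data_norm f g = Lp_norm \<infinity> f + Lp_norm 1 f + Lp_norm \<infinity> g + Lp_norm 1 g"

section \<open>The fractional heat kernel and the solution operators\<close>

definition inverse_fourier :: "(real^'n \<Rightarrow> complex) \<Rightarrow> real^'n \<Rightarrow> complex" where
  "inverse_fourier g x =
     complex_of_real (1 / (2 * pi) ^ CARD('n)) * (LINT \<xi>|lborel. cis (x \<bullet> \<xi>) * g \<xi>)"

text \<open>The inverse transform is real because the symbol is real and even, so \<^const>\<open>Re\<close> loses nothing.\<close>

definition frac_heat_kernel :: "real \<Rightarrow> real \<Rightarrow> real^'n \<Rightarrow> real" where
  "frac_heat_kernel \<sigma> t x =
     Re (inverse_fourier (\<lambda>\<xi>. complex_of_real (exp (- (norm \<xi> powr (2 * \<sigma>)) * t))) x)"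

definition frac_heat_op ::
  "real \<Rightarrow> real \<Rightarrow> (real^'n \<Rightarrow> real) \<Rightarrow> real^'n \<Rightarrow> real" where
  "frac_heat_op \<sigma> t f =
     (if t = 0 then f else (\<lambda>x. LINT y|lborel. frac_heat_kernel \<sigma> t (x - y) * f y))"

definition K0u :: "real \<Rightarrow> real \<Rightarrow> real \<Rightarrow> real \<Rightarrow> (real^'n \<Rightarrow> real) \<Rightarrow> real^'n \<Rightarrow> real" where
  "K0u \<sigma> \<mu> \<nu> t f x = (\<nu> + \<mu> * exp (- (\<mu> + \<nu>) * t)) / (\<mu> + \<nu>) * frac_heat_op \<sigma> t f x"

definition K1u :: "real \<Rightarrow> real \<Rightarrow> real \<Rightarrow> real \<Rightarrow> (real^'n \<Rightarrow> real) \<Rightarrow> real^'n \<Rightarrow> real" where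
  "K1u \<sigma> \<mu> \<nu> t f x = (\<nu> - \<nu> * exp (- (\<mu> + \<nu>) * t)) / (\<mu> + \<nu>) * frac_heat_op \<sigma> t f x"

definition K0v :: "real \<Rightarrow> real \<Rightarrow> real \<Rightarrow> real \<Rightarrow> (real^'n \<Rightarrow> real) \<Rightarrow> real^'n \<Rightarrow> real" where
  "K0v \<sigma> \<mu> \<nu> t f x = (\<mu> - \<mu> * exp (- (\<mu> + \<nu>) * t)) / (\<mu> + \<nu>) * frac_heat_op \<sigma> t f x"

definition K1v :: "real \<Rightarrow> real \<Rightarrow> real \<Rightarrow> real \<Rightarrow> (real^'n \<Rightarrow> real) \<Rightarrow> real^'n \<Rightarrow> real" where
  "K1v \<sigma> \<mu> \<nu> t f x = (\<mu> + \<nu> * exp (- (\<mu> + \<nu>) * t)) / (\<mu> + \<nu>) * frac_heat_op \<sigma> t f x"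

section \<open>Mild solutions\<close>

text \<open>The two admitted readings of the real power $s^r$ at negative $s$.\<close>

definition power_readings :: "real \<Rightarrow> (real \<Rightarrow> real) set" where
  "power_readings r = {\<lambda>s. \<bar>s\<bar> powr r, \<lambda>s. \<bar>s\<bar> powr (r - 1) * s}"

text \<open>
  The equation for one component \<open>w\<close> of the integral system: \<open>K0\<close>, \<open>K1\<close> are the solution operators
  belonging to \<open>w\<close>, and \<open>F\<close>, \<open>G\<close> are the nonlinearities in \<open>u\<close> and \<open>v\<close>.  The Duhamel term is evaluated pointwise in \<open>x\<close>; its integrability is required
  explicitly because the integral of a non-integrable function is \<open>0\<close> by convention.
\<close>

definition duhamel_eq ::
  "(real \<Rightarrow> ('a::euclidean_space \<Rightarrow> real) \<Rightarrow> 'a \<Rightarrow> real) \<Rightarrow>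
   (real \<Rightarrow> ('a \<Rightarrow> real) \<Rightarrow> 'a \<Rightarrow> real) \<Rightarrow> (real \<Rightarrow> real) \<Rightarrow> (real \<Rightarrow> real) \<Rightarrow> real \<Rightarrow>
   ('a \<Rightarrow> real) \<Rightarrow> ('a \<Rightarrow> real) \<Rightarrow> (real \<Rightarrow> 'a \<Rightarrow> real) \<Rightarrow> (real \<Rightarrow> 'a \<Rightarrow> real) \<Rightarrow>
   (real \<Rightarrow> 'a \<Rightarrow> real) \<Rightarrow> bool" where
  "duhamel_eq K0 K1 F G \<epsilon> u0 v0 u v w \<longleftrightarrow>
     (\<forall>t\<ge>0. AE x in lborel.
        set_integrable lborel {0..t}
          (\<lambda>\<tau>. K0 (t - \<tau>) (\<lambda>y. F (u \<tau> y)) x + K1 (t - \<tau>) (\<lambda>y. G (v \<tau> y)) x) \<and>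
        w t x = \<epsilon> * K0 t u0 x + \<epsilon> * K1 t v0 x +
          (LINT \<tau>:{0..t}|lborel.
             K0 (t - \<tau>) (\<lambda>y. F (u \<tau> y)) x + K1 (t - \<tau>) (\<lambda>y. G (v \<tau> y)) x))"

definition mild_solution ::
  "real \<Rightarrow> real \<Rightarrow> real \<Rightarrow> (real \<Rightarrow> real) \<Rightarrow> (real \<Rightarrow> real) \<Rightarrow> real \<Rightarrow>
   (real^'n \<Rightarrow> real) \<Rightarrow> (real^'n \<Rightarrow> real) \<Rightarrow>
   (real \<Rightarrow> real^'n \<Rightarrow> real) \<Rightarrow> (real \<Rightarrow> real^'n \<Rightarrow> real) \<Rightarrow> bool" where
  "mild_solution \<sigma> \<mu> \<nu> F G \<epsilon> u0 v0 u v \<longleftrightarrow>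
     duhamel_eq (K0u \<sigma> \<mu> \<nu>) (K1u \<sigma> \<mu> \<nu>) F G \<epsilon> u0 v0 u v u \<and>
     duhamel_eq (K0v \<sigma> \<mu> \<nu>) (K1v \<sigma> \<mu> \<nu>) F G \<epsilon> u0 v0 u v v"

end

theory Submission
  imports Defs "HOL-Probability.Probability" "HOL-Complex_Analysis.Complex_Analysis"
    "HOL-Real_Asymp.Real_Asymp"
begin

text \<open>
  The system is solved by Picard iteration in the class of functions that decay like the linear
  flow, that is, with \<open>\<bar>w(t, x)\<bar> \<le> M (1 + t)\<^sup>-\<^sup>\<gamma>\<close> and \<open>\<parallel>w(t)\<parallel>\<^sub>1 \<le> M\<close>, where
  \<open>\<gamma> = n / (2 \<sigma>)\<close>.  A power of exponent at least \<open>r = min p q\<close> turns these bounds into bounds that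
  carry the additional factor \<open>M\<^sup>r\<^sup>-\<^sup>1 (1 + \<tau>)\<^sup>-\<^sup>\<gamma>\<^sup>(\<^sup>r\<^sup>-\<^sup>1\<^sup>)\<close>.  The hypothesis on \<open>p\<close> and \<open>q\<close> says
  exactly that \<open>\<gamma> (r - 1) > 1\<close>: the factor is integrable in time, so that the Duhamel integral
  again decays like the linear flow, and for small \<open>M\<close> it is a contraction.  Norms in
  \<open>L\<^sup>m\<close> follow by interpolating between \<open>L\<^sup>1\<close> and \<open>L\<^sup>\<infinity>\<close>.

  The only facts about the kernel that enter are that it arises by scaling from a single
  continuous profile of mass \<open>1\<close> with an integrable majorant (locale \<open>selfsimilar_kernel\<close>).  For
  \<open>\<sigma> > 1\<close> the profile changes sign, and for non-integer \<open>\<sigma>\<close> the symbol is not smooth at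
  the origin, so the majorant needs an argument (\<open>frac_profile_decay\<close>).  If \<open>\<bar>z \<bullet> b\<bar> = \<pi>\<close>, a shift of
  the frequency by the unit vector \<open>b\<close> flips the sign of \<open>cos (z \<bullet> \<xi>)\<close>; hence the transform at
  \<open>z\<close> is bounded by the \<open>L\<^sup>1\<close> norm of the \<open>N\<close>-th difference of the symbol.  That norm is at most
  \<open>C t\<close>: far from the origin by Cauchy's estimates for a holomorphic extension of the symbol, and
  near the origin because \<open>1 - exp (- t \<bar>\<xi>\<bar>\<^sup>2\<^sup>\<sigma>)\<close> is at most \<open>t \<bar>\<xi>\<bar>\<^sup>2\<^sup>\<sigma>\<close>.  By scaling, the bound \<open>C t\<close> at
  such points is the decay \<open>\<bar>x\<bar>\<^sup>-\<^sup>n\<^sup>-\<^sup>2\<^sup>\<sigma>\<close> of the profile.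

  After a change of variables the heat flow becomes an average of translates,
  \<open>S t f x = \<integral> P(z) f(x - t\<^sup>1\<^sup>/\<^sup>2\<^sup>\<sigma> z) dz\<close>, which reduces continuity at \<open>t = 0\<close> to the
  continuity of translations in \<open>L\<^sup>1\<close>.

  For uniqueness (\<open>mild_unique\<close>), the \<open>L\<^sup>1\<close> distance of two mild solutions is bounded by its own time
  integral, because the powers are Lipschitz on bounded sets and solutions are locally bounded in
  \<open>L\<^sup>\<infinity>\<close>; Gronwall's lemma finishes the argument.  Since a mild solution is merely a curve in
  \<open>L\<^sup>1\<close>, the exchange of the time and space integrals that this requires rests on
  \<open>G_measurable_L1_curve\<close>.
\<close>

section \<open>Affine substitutions and translations in Lebesgue integrals\<close>

lemma nn_integral_lborel_affine:
  fixes f :: "'a::euclidean_space \<Rightarrow> ennreal"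
  assumes [measurable]: "f \<in> borel_measurable borel" and c: "c \<noteq> 0"
  shows "(\<integral>\<^sup>+x. f x \<partial>lborel) = ennreal (\<bar>c\<bar> ^ DIM('a)) * (\<integral>\<^sup>+x. f (t + c *\<^sub>R x) \<partial>lborel)"
  by (subst lborel_affine[OF c, of t])
     (simp add: nn_integral_density nn_integral_distr nn_integral_cmult)

lemma integrable_lborel_affine:
  fixes f :: "'a::euclidean_space \<Rightarrow> 'b::{banach, second_countable_topology}"
  assumes f: "integrable lborel f" and c: "c \<noteq> 0"
  shows "integrable lborel (\<lambda>x. f (t + c *\<^sub>R x))"
proof -
  have [measurable]: "f \<in> borel_measurable borel"
    using f[THEN borel_measurable_integrable] by simp
  have "(\<integral>\<^sup>+x. norm (f x) \<partial>lborel) < \<infinity>"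
    using f by (simp add: integrable_iff_bounded)
  then show ?thesis
    unfolding integrable_iff_bounded
    using c by (subst (asm) nn_integral_lborel_affine[where c=c and t=t])
      (auto simp: ennreal_mult_less_top)
qed

lemma integral_lborel_affine:
  fixes f :: "'a::euclidean_space \<Rightarrow> 'b::{banach, second_countable_topology}"
  assumes f: "f \<in> borel_measurable borel" and c: "c \<noteq> 0"
  shows "(LINT x|lborel. f x) = \<bar>c\<bar> ^ DIM('a) *\<^sub>R (LINT x|lborel. f (t + c *\<^sub>R x))"
  using f by (subst lborel_affine[OF c, of t])
     (simp add: integral_density integral_distr del: integral_scaleR_right, simp)

lemma integrable_lborel_reflect:
  fixes f :: "'a::euclidean_space \<Rightarrow> 'b::{banach, second_countable_topology}"
  assumes "integrable lborel f"
  shows "integrable lborel (\<lambda>x. f (t - x))" "integrable lborel (\<lambda>x. f (x - t))"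
  using integrable_lborel_affine[OF assms, of "-1" t] integrable_lborel_affine[OF assms, of 1 "-t"]
  by (simp_all add: add.commute)

lemma integral_lborel_reflect:
  fixes f :: "'a::euclidean_space \<Rightarrow> 'b::{banach, second_countable_topology}"
  assumes "f \<in> borel_measurable borel"
  shows "(LINT x|lborel. f (t - x)) = (LINT x|lborel. f x)"
    and "(LINT x|lborel. f (x - t)) = (LINT x|lborel. f x)"
  using integral_lborel_affine[OF assms, of "-1" t] integral_lborel_affine[OF assms, of 1 "-t"]
  by (simp_all add: add.commute)

lemma integral_dominated_convergence_within:
  fixes f :: "'x \<Rightarrow> 'b::{banach, second_countable_topology}" and a :: "'c::metric_space"
  assumes "f \<in> borel_measurable M"
    and "\<forall>\<^sub>F h in at a within S. s h \<in> borel_measurable M \<and> (AE x in M. norm (s h x) \<le> w x)"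
    and "integrable M w"
    and "AE x in M. ((\<lambda>h. s h x) \<longlongrightarrow> f x) (at a within S)"
  shows "((\<lambda>h. LINT x|M. s h x) \<longlongrightarrow> (LINT x|M. f x)) (at a within S)"
  unfolding tendsto_at_iff_sequentially
proof (intro allI impI)
  fix X assume X: "\<forall>i. X i \<in> S - {a}" "X \<longlonglongrightarrow> a"
  have lim: "filterlim X (at a within S) sequentially"
    using X by (auto simp: filterlim_at)
  from filterlim_cong assms(2) lim
  have "\<forall>\<^sub>F i in sequentially. s (X i) \<in> borel_measurable M \<and> (AE x in M. norm (s (X i) x) \<le> w x)"
    by (auto simp: filterlim_iff)
  then obtain N where N: "\<And>i. i \<ge> N \<Longrightarrow> s (X i) \<in> borel_measurable M \<and> (AE x in M. norm (s (X i) x) \<le> w x)"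
    by (auto simp: eventually_sequentially)
  have "(\<lambda>i. LINT x|M. s (X (i + N)) x) \<longlonglongrightarrow> (LINT x|M. f x)"
  proof (rule integral_dominated_convergence[where w=w])
    show "AE x in M. (\<lambda>i. s (X (i + N)) x) \<longlonglongrightarrow> f x"
      using assms(4)
    proof eventually_elim
      case (elim x)
      show ?case
        using LIMSEQ_ignore_initial_segment[OF filterlim_compose[OF elim lim], of N] by simp
    qed
  qed (use assms N in auto)
  then show "((\<lambda>h. LINT x|M. s h x) \<circ> X) \<longlonglongrightarrow> (LINT x|M. f x)"
    by (auto simp: comp_def intro: LIMSEQ_offset)
qed

text \<open>
  Translation is continuous in \<open>L\<^sup>1\<close>.  The case that carries the argument is the
  indicator of an open set \<open>U\<close> of finite measure: since \<open>U\<close> and \<open>U + h\<close> have the same measure,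
  their symmetric difference is twice as large as \<open>U - (U + h)\<close>, and the indicator of that set
  is dominated by the one of \<open>U\<close> and vanishes in the limit because \<open>U\<close> is open.  Outer regularity
  and approximation by simple functions do the rest.
\<close>

lemma L1_translation_open:
  fixes U :: "'a::euclidean_space set"
  assumes U: "open U" and fin: "emeasure lborel U < \<infinity>"
  shows "((\<lambda>h. LINT x|lborel. \<bar>indicator U (x - h) - indicat_real U x\<bar>) \<longlongrightarrow> 0) (nhds 0)"
proof -
  have [measurable]: "U \<in> sets borel" using U by simp
  have int: "integrable lborel (indicat_real U)"
    using fin by (simp add: integrable_real_indicator)
  note inth = integrable_lborel_reflect(2)[OF int]
  have eq: "(LINT x|lborel. \<bar>indicator U (x - h) - indicat_real U x\<bar>)
      = 2 * (LINT x|lborel. indicat_real U x * (1 - indicator U (x - h)))" for h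
  proof -
    have i1: "integrable lborel (\<lambda>x. indicat_real U x * (1 - indicator U (x - h)))"
      by (rule Bochner_Integration.integrable_bound[OF int]) (auto simp: indicator_def)
    have "(LINT x|lborel. \<bar>indicator U (x - h) - indicat_real U x\<bar>)
        = (LINT x|lborel. (indicator U (x - h) - indicat_real U x)
             + 2 * (indicat_real U x * (1 - indicator U (x - h))))"
      by (rule Bochner_Integration.integral_cong) (auto simp: indicator_def)
    also have "\<dots> = (LINT x|lborel. indicator U (x - h)) - (LINT x|lborel. indicat_real U x)
             + 2 * (LINT x|lborel. indicat_real U x * (1 - indicator U (x - h)))"
      using int inth[of h] i1 by simp
    also have "(LINT x|lborel. indicator U (x - h)) = (LINT x|lborel. indicat_real U x)"
      by (rule integral_lborel_reflect(2)) simp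
    finally show ?thesis by simp
  qed
  have "((\<lambda>h. LINT x|lborel. indicat_real U x * (1 - indicator U (x - h))) \<longlongrightarrow>
          (LINT x|(lborel :: 'a measure). 0)) (at 0)"
  proof (rule integral_dominated_convergence_within[where w="indicat_real U"])
    show "AE x in lborel. ((\<lambda>h. indicat_real U x * (1 - indicator U (x - h))) \<longlongrightarrow> 0) (at 0)"
    proof (intro AE_I2 tendsto_eventually)
      fix x :: 'a
      show "\<forall>\<^sub>F h in at 0. indicat_real U x * (1 - indicator U (x - h)) = 0"
      proof (cases "x \<in> U")
        case True
        have "((\<lambda>h. x - h) \<longlongrightarrow> x - 0) (at 0)" by (intro tendsto_intros)
        then have "\<forall>\<^sub>F h in at 0. x - h \<in> U"
          using U True by (auto simp: tendsto_def)
        then show ?thesis by eventually_elim (auto simp: indicator_def)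
      qed auto
    qed
  qed (use int in \<open>auto simp: indicator_def\<close>)
  moreover have z: "indicat_real U x * (1 - indicator U x) = 0" for x
    by (auto simp: indicator_def)
  ultimately show ?thesis
    unfolding eq by (subst tendsto_nhds_iff) (auto intro!: tendsto_mult_right_zero simp: z)
qed

lemma L1_translation:
  fixes f :: "'a::euclidean_space \<Rightarrow> real"
  assumes "integrable lborel f"
  shows "((\<lambda>h. LINT x|lborel. \<bar>f (x - h) - f x\<bar>) \<longlongrightarrow> 0) (nhds 0)"
proof -
  let ?osc = "\<lambda>(f :: 'a \<Rightarrow> real) h. LINT x|lborel. \<bar>f (x - h) - f x\<bar>"
  let ?P = "\<lambda>f :: 'a \<Rightarrow> real. \<forall>e>0. \<forall>\<^sub>F h in nhds 0. ?osc f h < e"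
  have approx: "?osc f h \<le> ?osc g h + 2 * (LINT x|lborel. \<bar>f x - g x\<bar>)"
    if f: "integrable lborel f" and g: "integrable lborel g" for f g h
  proof -
    note i = f g integrable_lborel_reflect(2)[OF f, of h] integrable_lborel_reflect(2)[OF g, of h]
    have "?osc f h \<le> (LINT x|lborel. \<bar>g (x - h) - g x\<bar> + \<bar>f (x - h) - g (x - h)\<bar> + \<bar>f x - g x\<bar>)"
      using i by (intro integral_mono) auto
    also have "\<dots> = ?osc g h + (LINT x|lborel. \<bar>f (x - h) - g (x - h)\<bar>) + (LINT x|lborel. \<bar>f x - g x\<bar>)"
      using i by simp
    also have "(LINT x|lborel. \<bar>f (x - h) - g (x - h)\<bar>) = (LINT x|lborel. \<bar>f x - g x\<bar>)"
      using f g by (intro integral_lborel_reflect(2)[of "\<lambda>x. \<bar>f x - g x\<bar>"]) auto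
    finally show ?thesis by simp
  qed
  have "?P f"
    using assms
  proof (induction rule: integrable_induct)
    case (base A c)
    show ?case
    proof (intro allI impI)
      fix e :: real assume "e > 0"
      define d where "d = e / 4 / (\<bar>c\<bar> + 1)"
      have nz: "\<bar>c\<bar> + 1 \<noteq> 0" by linarith
      have "d > 0" using \<open>e > 0\<close> by (simp add: d_def)
      from base(1) have [measurable]: "A \<in> sets borel" by simp
      obtain U where U: "open U" "A \<subseteq> U" "emeasure lborel (U - A) < d"
        using outer_regular_lborel[OF \<open>A \<in> sets borel\<close> \<open>d > 0\<close>] by blast
      then have [measurable]: "U \<in> sets borel" by simp
      have "emeasure lborel U \<le> emeasure lborel A + emeasure lborel (U - A)"
        using U(2) by (subst plus_emeasure) (auto simp: Un_absorb1)
      also have "\<dots> < \<infinity>" using base(2) order.strict_trans[OF U(3) ennreal_less_top] by simp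
      finally have finU: "emeasure lborel U < \<infinity>" .
      have iA: "integrable lborel (\<lambda>x. indicat_real A x *\<^sub>R c)"
        and iU: "integrable lborel (\<lambda>x. indicat_real U x *\<^sub>R c)"
        using base(2) finU by (auto simp: integrable_real_indicator)
      have "(LINT x|lborel. \<bar>indicat_real A x *\<^sub>R c - indicat_real U x *\<^sub>R c\<bar>)
          = (LINT x|lborel. indicat_real (U - A) x * \<bar>c\<bar>)"
        using U(2) by (intro Bochner_Integration.integral_cong) (auto simp: indicator_def)
      also have "\<dots> = measure lborel (U - A) * \<bar>c\<bar>" by simp
      also have "\<dots> \<le> d * \<bar>c\<bar>"
        using U(3) \<open>d > 0\<close> by (intro mult_right_mono) (auto simp: measure_def intro!: enn2real_leI)
      also have "\<dots> \<le> d * (\<bar>c\<bar> + 1)" using \<open>d > 0\<close> by simp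
      also have "\<dots> = e / 4" unfolding d_def using nz by (rule nonzero_eq_divide_eq[THEN iffD1, OF _ refl])
      finally have dist: "(LINT x|lborel. \<bar>indicat_real A x *\<^sub>R c - indicat_real U x *\<^sub>R c\<bar>) \<le> e / 4" .
      have "\<forall>\<^sub>F h in nhds 0. ?osc (indicat_real U) h < d"
        using order_tendstoD(2)[OF L1_translation_open[OF U(1) finU] \<open>d > 0\<close>] .
      then show "\<forall>\<^sub>F h in nhds 0. ?osc (\<lambda>x. indicat_real A x *\<^sub>R c) h < e"
      proof eventually_elim
        case (elim h)
        have "?osc (\<lambda>x. indicat_real U x *\<^sub>R c) h = ?osc (indicat_real U) h * \<bar>c\<bar>"
          by (simp add: left_diff_distrib[symmetric] abs_mult)
        also have "\<dots> \<le> d * \<bar>c\<bar>"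
          using elim by (intro mult_right_mono) auto
        also have "\<dots> \<le> d * (\<bar>c\<bar> + 1)" using \<open>d > 0\<close> by simp
        also have "\<dots> = e / 4" unfolding d_def using nz by (rule nonzero_eq_divide_eq[THEN iffD1, OF _ refl])
        finally show ?case
          using approx[OF iA iU, of h] dist \<open>e > 0\<close> by linarith
      qed
    qed
  next
    case (add f g)
    show ?case
    proof (intro allI impI)
      fix e :: real assume "e > 0"
      then have "\<forall>\<^sub>F h in nhds 0. ?osc f h < e / 2" "\<forall>\<^sub>F h in nhds 0. ?osc g h < e / 2"
        using add.IH[THEN spec, of "e / 2"] by simp_all
      then show "\<forall>\<^sub>F h in nhds 0. ?osc (\<lambda>x. f x + g x) h < e"
      proof eventually_elim
        case (elim h)
        note i = add.hyps integrable_lborel_reflect(2)[OF add.hyps(1), of h]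
          integrable_lborel_reflect(2)[OF add.hyps(2), of h]
        have "?osc (\<lambda>x. f x + g x) h \<le> (LINT x|lborel. \<bar>f (x - h) - f x\<bar> + \<bar>g (x - h) - g x\<bar>)"
          using i by (intro integral_mono) auto
        also have "\<dots> = ?osc f h + ?osc g h" using i by simp
        finally show ?case using elim by linarith
      qed
    qed
  next
    case (lim f s)
    show ?case
    proof (intro allI impI)
      fix e :: real assume "e > 0"
      have "(\<lambda>i. LINT x|lborel. \<bar>f x - s i x\<bar>) \<longlonglongrightarrow> (LINT x|(lborel :: 'a measure). 0)"
      proof (rule integral_dominated_convergence[where w="\<lambda>x. 3 * \<bar>f x\<bar>"])
        show "AE x in lborel. (\<lambda>i. \<bar>f x - s i x\<bar>) \<longlonglongrightarrow> 0"
        proof (rule AE_I2)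
          fix x :: 'a
          have "(\<lambda>i. f x - s i x) \<longlonglongrightarrow> f x - f x"
            using lim.hyps(2)[of x] by (intro tendsto_intros) auto
          then show "(\<lambda>i. \<bar>f x - s i x\<bar>) \<longlonglongrightarrow> 0" using tendsto_rabs_zero by auto
        qed
        show "AE x in lborel. norm \<bar>f x - s i x\<bar> \<le> 3 * \<bar>f x\<bar>" for i
        proof (rule AE_I2)
          fix x :: 'a
          show "norm \<bar>f x - s i x\<bar> \<le> 3 * \<bar>f x\<bar>" using lim.hyps(3)[of x i] by auto
        qed
      qed (use lim.hyps in auto)
      then have "(\<lambda>i. LINT x|lborel. \<bar>f x - s i x\<bar>) \<longlonglongrightarrow> 0" by simp
      moreover have "0 < e / 4" using \<open>e > 0\<close> by simp
      ultimately have "\<forall>\<^sub>F i in sequentially. (LINT x|lborel. \<bar>f x - s i x\<bar>) < e / 4"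
        by (rule order_tendstoD(2))
      then obtain i where i: "(LINT x|lborel. \<bar>f x - s i x\<bar>) < e / 4"
        by (auto simp: eventually_sequentially)
      have "\<forall>\<^sub>F h in nhds 0. ?osc (s i) h < e / 2" using lim.IH[of i, THEN spec, of "e / 2"] \<open>e > 0\<close> by simp
      then show "\<forall>\<^sub>F h in nhds 0. ?osc f h < e"
      proof eventually_elim
        case (elim h)
        then show ?case using approx[OF lim.hyps(4) lim.hyps(1)[of i], of h] i by linarith
      qed
    qed
  qed
  then show ?thesis
    unfolding order_tendsto_iff by (auto intro!: always_eventually elim: less_le_trans)
qed

text \<open>Interpolation: \<open>\<bar>f\<bar>\<^sup>m\<close> is at most \<open>M\<^sup>m\<^sup>-\<^sup>1 \<bar>f\<bar>\<close> pointwise.\<close>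

lemma powr_integral_interpolation:
  fixes f :: "'a::euclidean_space \<Rightarrow> real"
  assumes f: "integrable lborel f" and b: "\<And>x. \<bar>f x\<bar> \<le> M" and m: "m \<ge> 1"
  shows "integrable lborel (\<lambda>x. \<bar>f x\<bar> powr m)"
    and "(LINT x|lborel. \<bar>f x\<bar> powr m) \<le> M powr (m - 1) * (LINT x|lborel. \<bar>f x\<bar>)"
proof -
  have [measurable]: "f \<in> borel_measurable borel" using f by auto
  have le: "\<bar>f x\<bar> powr m \<le> M powr (m - 1) * \<bar>f x\<bar>" for x
  proof (cases "f x = 0")
    case False
    then have "\<bar>f x\<bar> powr m = \<bar>f x\<bar> powr (m - 1) * \<bar>f x\<bar>" by (simp add: powr_diff)
    also have "\<dots> \<le> M powr (m - 1) * \<bar>f x\<bar>"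
      using b[of x] m by (intro mult_right_mono powr_mono2) auto
    finally show ?thesis .
  qed auto
  show i: "integrable lborel (\<lambda>x. \<bar>f x\<bar> powr m)"
    by (rule Bochner_Integration.integrable_bound[of _ "\<lambda>x. M powr (m - 1) * \<bar>f x\<bar>"])
      (use f le in auto)
  have "(LINT x|lborel. \<bar>f x\<bar> powr m) \<le> (LINT x|lborel. M powr (m - 1) * \<bar>f x\<bar>)"
    using i f le by (intro integral_mono) auto
  then show "(LINT x|lborel. \<bar>f x\<bar> powr m) \<le> M powr (m - 1) * (LINT x|lborel. \<bar>f x\<bar>)" by simp
qed

section \<open>Integrability of powers and of the symbol\<close>

lemma nn_integral_one_plus_abs_powr_finite:
  assumes a: "a > 1"
  shows "(\<integral>\<^sup>+x. ennreal ((1 + \<bar>x::real\<bar>) powr (-a)) \<partial>lborel) < \<infinity>"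
proof -
  have "(\<integral>\<^sup>+x\<in>{0..}. ennreal ((1 + \<bar>x::real\<bar>) powr (-a)) \<partial>lborel) < \<infinity>"
  proof -
    have "(\<integral>\<^sup>+x\<in>{0..}. ennreal ((1 + \<bar>x::real\<bar>) powr (-a)) \<partial>lborel) =
          ennreal (0 - (1 + 0) powr (1 - a) / (1 - a))"
    proof (rule nn_integral_FTC_atLeast[where F="\<lambda>x. (1 + x) powr (1 - a) / (1 - a)"])
      fix x :: real assume "0 \<le> x"
      then show "((\<lambda>x. (1 + x) powr (1 - a) / (1 - a)) has_real_derivative (1 + \<bar>x\<bar>) powr - a) (at x)"
        using a by (auto intro!: derivative_eq_intros)
    next
      show "((\<lambda>x. (1 + x) powr (1 - a) / (1 - a)) \<longlongrightarrow> 0) at_top"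
        using a by real_asymp
    qed auto
    then show ?thesis by simp
  qed
  moreover have "(\<integral>\<^sup>+x\<in>{..0}. ennreal ((1 + \<bar>x::real\<bar>) powr (-a)) \<partial>lborel) =
      (\<integral>\<^sup>+x\<in>{0..}. ennreal ((1 + \<bar>x::real\<bar>) powr (-a)) \<partial>lborel)"
    by (subst nn_integral_real_affine[of _ "-1" 0])
      (auto intro!: nn_integral_cong simp: indicator_def)
  ultimately have "(\<integral>\<^sup>+x\<in>{0..}. ennreal ((1 + \<bar>x::real\<bar>) powr (-a)) \<partial>lborel) +
      (\<integral>\<^sup>+x\<in>{..0}. ennreal ((1 + \<bar>x::real\<bar>) powr (-a)) \<partial>lborel) < \<infinity>"
    by (simp add: ennreal_add_less_top)
  also have "(\<integral>\<^sup>+x\<in>{0..}. ennreal ((1 + \<bar>x::real\<bar>) powr (-a)) \<partial>lborel) +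
      (\<integral>\<^sup>+x\<in>{..0}. ennreal ((1 + \<bar>x::real\<bar>) powr (-a)) \<partial>lborel) =
      (\<integral>\<^sup>+x. ennreal ((1 + \<bar>x::real\<bar>) powr (-a)) * (indicator {0..} x + indicator {..0} x) \<partial>lborel)"
    by (subst nn_integral_add[symmetric]) (auto simp: distrib_left)
  finally have *: "(\<integral>\<^sup>+x. ennreal ((1 + \<bar>x::real\<bar>) powr (-a)) * (indicator {0..} x + indicator {..0} x) \<partial>lborel) < \<infinity>" .
  have "(\<integral>\<^sup>+x. ennreal ((1 + \<bar>x::real\<bar>) powr (-a)) \<partial>lborel) \<le>
    (\<integral>\<^sup>+x. ennreal ((1 + \<bar>x::real\<bar>) powr (-a)) * (indicator {0..} x + indicator {..0} x) \<partial>lborel)"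
    by (intro nn_integral_mono) (auto simp: indicator_def intro: mult_left_mono[of 1 _ "ennreal _", simplified])
  from this * show ?thesis by (rule le_less_trans)
qed

text \<open>
  The weight is dominated by the product over the coordinates of \<open>(1 + \<bar>x\<^sub>b\<bar>)\<^sup>-\<^sup>1\<^sup>-\<^sup>d\<^sup>/\<^sup>n\<close>, whose
  integral factorizes.
\<close>

lemma integrable_one_plus_norm_powr:
  assumes d: "d > (0::real)"
  shows "integrable lborel (\<lambda>x::'a::euclidean_space. (1 + norm x) powr (- (real DIM('a) + d)))"
proof -
  define a where "a = 1 + d / DIM('a)"
  have a: "a > 1" using d by (simp add: a_def)
  have "(\<integral>\<^sup>+x. ennreal ((1 + norm (x::'a)) powr (- (real DIM('a) + d))) \<partial>lborel) \<le>
        (\<integral>\<^sup>+x. (\<Prod>b\<in>(Basis::'a set). ennreal ((1 + \<bar>x \<bullet> b\<bar>) powr (-a))) \<partial>lborel)"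
  proof (rule nn_integral_mono)
    fix x :: 'a
    have "(1 + norm x) powr (- (real DIM('a) + d)) = ((1 + norm x) powr (-a)) ^ DIM('a)"
    proof -
      have "- a * real DIM('a) = - (real DIM('a) + d)" by (simp add: a_def field_simps)
      moreover have "1 + norm x > 0" by (simp add: add_pos_nonneg)
      ultimately show ?thesis by (metis powr_powr powr_realpow powr_gt_zero less_irrefl)
    qed
    also have "\<dots> = (\<Prod>b\<in>(Basis :: 'a set). (1 + norm x) powr (-a))" by simp
    also have "\<dots> \<le> (\<Prod>b\<in>Basis. (1 + \<bar>x \<bullet> b\<bar>) powr (-a))"
      using a by (intro prod_mono conjI powr_mono2') (auto simp: Basis_le_norm)
    finally show "ennreal ((1 + norm x) powr (- (real DIM('a) + d))) \<le>
        (\<Prod>b\<in>Basis. ennreal ((1 + \<bar>x \<bullet> b\<bar>) powr (-a)))"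
      by (subst prod_ennreal) (auto intro!: ennreal_leI)
  qed
  also have "\<dots> = (\<Prod>b\<in>(Basis :: 'a set). (\<integral>\<^sup>+x. ennreal ((1 + \<bar>x\<bar>) powr (-a)) \<partial>lborel))"
    by (rule nn_integral_lborel_prod) auto
  also have "\<dots> < \<infinity>"
    using nn_integral_one_plus_abs_powr_finite[OF a] by (simp add: power_less_top_ennreal)
  finally show ?thesis
    by (intro integrableI_bounded) auto
qed

definition symbol :: "real \<Rightarrow> real \<Rightarrow> 'a::euclidean_space \<Rightarrow> real" where
  "symbol \<sigma> t \<xi> = exp (- (norm \<xi> powr (2 * \<sigma>)) * t)"

lemma borel_measurable_symbol [measurable]:
  "(\<lambda>x. symbol \<sigma> t (x::'a::euclidean_space)) \<in> borel_measurable borel"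
  unfolding symbol_def by measurable

lemma continuous_symbol: "\<sigma> > 0 \<Longrightarrow> continuous_on UNIV (symbol \<sigma> t)"
  unfolding symbol_def by (intro continuous_intros continuous_on_powr') auto

lemma symbol_bounds: "0 < symbol \<sigma> t \<xi>" "t \<ge> 0 \<Longrightarrow> symbol \<sigma> t \<xi> \<le> 1"
  by (simp_all add: symbol_def)

lemma symbol_decay:
  assumes "\<sigma> > 0" "t > 0"
  obtains C where "C > 0" "\<And>\<xi>::'a::euclidean_space. symbol \<sigma> t \<xi> \<le> C * (1 + norm \<xi>) powr (-k)"
proof -
  let ?f = "\<lambda>r. (1 + r) powr k * exp (- (r powr (2 * \<sigma>)) * t)"
  have "(?f \<longlongrightarrow> 0) at_top" using assms by real_asymp
  then have "\<forall>\<^sub>F r in at_top. ?f r < 1" by (rule order_tendstoD) simp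
  then obtain R where R: "\<And>r. r \<ge> R \<Longrightarrow> ?f r < 1" by (auto simp: eventually_at_top_linorder)
  have "bounded (?f ` {0..max R 0})"
    using assms by (intro compact_imp_bounded compact_continuous_image)
      (auto intro!: continuous_intros continuous_on_powr')
  then obtain B where B: "\<And>r. r \<in> {0..max R 0} \<Longrightarrow> ?f r \<le> B"
    unfolding bounded_iff by (force simp: image_iff)
  have *: "?f r \<le> max B 1" if "r \<ge> 0" for r
    using R[of r] B[of r] that by (cases "r \<ge> R") auto
  show thesis
  proof (rule that)
    fix \<xi> :: 'a
    show "symbol \<sigma> t \<xi> \<le> max B 1 * (1 + norm \<xi>) powr (-k)"
      using *[of "norm \<xi>"] by (simp add: symbol_def powr_minus divide_simps mult_ac powr_gt_zero add_pos_nonneg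
        add_nonneg_eq_0_iff pos_add_strict)
  qed simp
qed

lemma integrable_symbol:
  assumes "\<sigma> > 0" "t > 0"
  shows "integrable lborel (symbol \<sigma> t :: 'a::euclidean_space \<Rightarrow> real)"
proof -
  obtain C where C: "C > 0" "\<And>\<xi>::'a. symbol \<sigma> t \<xi> \<le> C * (1 + norm \<xi>) powr (- (real DIM('a) + 1))"
    using symbol_decay[OF assms] by blast
  show ?thesis
  proof (rule Bochner_Integration.integrable_bound)
    show "integrable lborel (\<lambda>\<xi>::'a. C * (1 + norm \<xi>) powr (- (real DIM('a) + 1)))"
      by (intro integrable_mult_right integrable_one_plus_norm_powr) simp
    show "AE \<xi> in lborel. norm (symbol \<sigma> t \<xi>) \<le> norm (C * (1 + norm (\<xi>::'a)) powr (- (real DIM('a) + 1)))"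
    proof (rule AE_I2)
      fix \<xi> :: 'a
      show "norm (symbol \<sigma> t \<xi>) \<le> norm (C * (1 + norm \<xi>) powr (- (real DIM('a) + 1)))"
        using C(2)[of \<xi>] symbol_bounds(1)[of \<sigma> t \<xi>] by (simp only: real_norm_def)
    qed
  qed measurable
qed

section \<open>Finite differences of the symbol\<close>

text \<open>
  Differences replace the derivatives in an integration by parts: they make sense across the
  origin as well, where the symbol is not smooth.
\<close>

definition forward_diff :: "'a::ab_group_add \<Rightarrow> ('a \<Rightarrow> 'b::ab_group_add) \<Rightarrow> 'a \<Rightarrow> 'b" where
  "forward_diff b g \<xi> = g (\<xi> + b) - g \<xi>"

lemma forward_diff_iterate_norm_le:
  fixes g :: "'a::real_normed_vector \<Rightarrow> real"
  assumes "\<And>k::nat. k \<le> N \<Longrightarrow> \<bar>g (\<xi> + real k *\<^sub>R b)\<bar> \<le> M"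
  shows "\<bar>(forward_diff b ^^ N) g \<xi>\<bar> \<le> 2 ^ N * M"
  using assms
proof (induction N arbitrary: \<xi>)
  case (Suc N)
  have "\<bar>(forward_diff b ^^ N) g (\<xi> + b)\<bar> \<le> 2 ^ N * M"
  proof (rule Suc.IH)
    fix k assume "k \<le> N"
    then show "\<bar>g (\<xi> + b + real k *\<^sub>R b)\<bar> \<le> M"
      using Suc.prems[of "Suc k"] by (simp add: algebra_simps)
  qed
  moreover have "\<bar>(forward_diff b ^^ N) g \<xi>\<bar> \<le> 2 ^ N * M"
    using Suc.prems by (intro Suc.IH) auto
  ultimately show ?case by (simp add: forward_diff_def[of b "(forward_diff b ^^ N) g"])
qed auto

lemma forward_diff_iterate_add_const:
  fixes g :: "'a::real_normed_vector \<Rightarrow> 'b::real_normed_vector"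
  assumes "N > 0"
  shows "(forward_diff b ^^ N) (\<lambda>x. g x - c) = (forward_diff b ^^ N) g"
proof -
  obtain m where m: "N = Suc m" using assms by (cases N) auto
  have "forward_diff b (\<lambda>x. g x - c) = forward_diff b g"
    by (auto simp: forward_diff_def fun_eq_iff)
  then show ?thesis by (simp add: m funpow_Suc_right del: funpow.simps)
qed

text \<open>
  Each step loses a margin \<open>\<rho>\<close> of the domain to Cauchy's estimate for the derivative, and a
  margin \<open>1\<close> to the shift.
\<close>

lemma forward_diff_holomorphic_bound:
  fixes h :: "complex \<Rightarrow> complex"
  assumes "h holomorphic_on ball 0 R" "\<And>w. w \<in> ball 0 R \<Longrightarrow> norm (h w) \<le> M" and \<rho>: "\<rho> > 0"
  shows "(forward_diff 1 ^^ N) h holomorphic_on ball 0 (R - real N * (\<rho> + 1)) \<and>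
    (\<forall>w\<in>ball 0 (R - real N * (\<rho> + 1)). norm ((forward_diff 1 ^^ N) h w) \<le> M / \<rho> ^ N)"
proof (induction N)
  case 0
  show ?case using assms by simp
next
  case (Suc N)
  define g where "g = (forward_diff 1 ^^ N) h"
  define S where "S = R - real N * (\<rho> + 1)"
  have hol: "g holomorphic_on ball 0 S" and bd: "\<And>w. w \<in> ball 0 S \<Longrightarrow> norm (g w) \<le> M / \<rho> ^ N"
    using Suc unfolding g_def S_def by auto
  have S: "R - real (Suc N) * (\<rho> + 1) = S - \<rho> - 1" by (simp add: S_def algebra_simps)
  have inS: "w \<in> ball 0 S" "w + 1 \<in> ball 0 S" "w \<in> ball 0 (S - \<rho>)" "w + 1 \<in> ball 0 (S - \<rho>)"
    if "w \<in> ball 0 (S - \<rho> - 1)" for w :: complex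
    using that \<rho> norm_triangle_ineq[of w 1] by auto
  have der: "norm (deriv g w) \<le> M / \<rho> ^ N / \<rho>" if w: "w \<in> ball 0 (S - \<rho>)" for w
  proof -
    have sub: "cball w \<rho> \<subseteq> ball 0 S"
    proof
      fix x assume "x \<in> cball w \<rho>"
      then show "x \<in> ball 0 S"
        using w norm_triangle_ineq2[of x w] by (auto simp: dist_norm norm_minus_commute)
    qed
    have "norm ((deriv ^^ 1) g w) \<le> fact 1 * (M / \<rho> ^ N) / \<rho> ^ 1"
    proof (rule Cauchy_inequality)
      show "g holomorphic_on ball w \<rho>"
        using hol sub ball_subset_cball[of w \<rho>] holomorphic_on_subset by blast
      show "continuous_on (cball w \<rho>) g"
        using holomorphic_on_imp_continuous_on[OF hol] sub continuous_on_subset by blast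
      show "norm (g x) \<le> M / \<rho> ^ N" if "norm (w - x) = \<rho>" for x
        using bd sub that by (auto simp: dist_norm)
    qed fact
    then show ?thesis by simp
  qed
  have step: "norm (g (w + 1) - g w) \<le> M / \<rho> ^ N / \<rho> * norm ((w + 1) - w)" if w: "w \<in> ball 0 (S - \<rho> - 1)" for w
  proof (rule field_differentiable_bound[OF convex_ball[of 0 "S - \<rho>"]])
    fix z :: complex assume z: "z \<in> ball 0 (S - \<rho>)"
    then have "z \<in> ball 0 S" using \<rho> by auto
    then show "(g has_field_derivative deriv g z) (at z within ball 0 (S - \<rho>))"
      using hol holomorphic_derivI[OF hol] by auto
  qed (use der inS[OF w] in auto)
  have hol': "forward_diff 1 g holomorphic_on ball 0 (S - \<rho> - 1)"
    unfolding forward_diff_def[abs_def]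
  proof (intro holomorphic_intros)
    have "(g \<circ> (\<lambda>z. z + 1)) holomorphic_on ball 0 (S - \<rho> - 1)"
      by (rule holomorphic_on_compose_gen[OF _ hol]) (use inS in \<open>auto intro!: holomorphic_intros\<close>)
    then show "(\<lambda>z. g (z + 1)) holomorphic_on ball 0 (S - \<rho> - 1)" by (simp add: comp_def)
    show "g holomorphic_on ball 0 (S - \<rho> - 1)"
      by (rule holomorphic_on_subset[OF hol]) (use inS in auto)
  qed
  have eq: "(forward_diff 1 ^^ Suc N) h = forward_diff 1 g" by (simp add: g_def)
  show ?case
    unfolding S eq
  proof (intro conjI ballI hol')
    fix w :: complex assume "w \<in> ball 0 (S - \<rho> - 1)"
    then show "norm (forward_diff 1 g w) \<le> M / \<rho> ^ Suc N"
      using step[of w] by (simp add: forward_diff_def mult.commute)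
  qed
qed

lemma norm_exp_minus_one_le:
  assumes "Re z \<ge> 0"
  shows "norm (exp (- z) - 1) \<le> norm z"
proof -
  have "norm (exp (- z) - exp (- 0)) \<le> 1 * norm (z - 0)"
  proof (rule field_differentiable_bound[of "{z. Re z \<ge> 0}"])
    show "convex {z. Re z \<ge> 0}" by (rule convex_halfspace_Re_ge)
    fix w :: complex assume "w \<in> {z. Re z \<ge> 0}"
    then show "norm (- exp (- w)) \<le> 1" by simp
    show "((\<lambda>z. exp (- z)) has_field_derivative - exp (- w)) (at w within {z. Re z \<ge> 0})"
      by (auto intro!: derivative_eq_intros)
  qed (use assms in auto)
  then show ?thesis by simp
qed

text \<open>
  Along each coordinate line the symbol extends holomorphically to a disc whose radius is
  proportional to the distance from the origin; on that disc the exponent \<open>|\<xi>|\<^sup>2\<^sup>\<sigma>\<close> keeps a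
  positive real part.  This makes the \<open>N\<close>-th difference gain the factor \<open>|\<xi>|\<^sup>-\<^sup>N\<close>.
\<close>

lemma symbol_diff_far:
  assumes \<sigma>: "\<sigma> > 0" and N: "N > 0"
  obtains R C where "R \<ge> 1" "C > 0"
    "\<And>t (\<xi>::'a::euclidean_space) b. t \<ge> 0 \<Longrightarrow> b \<in> Basis \<Longrightarrow> norm \<xi> > R \<Longrightarrow>
       \<bar>(forward_diff b ^^ N) (symbol \<sigma> t) \<xi>\<bar> \<le> C * t * norm \<xi> powr (2 * \<sigma> - real N)"
proof -
  define H where "H = (\<lambda>z. exp (complex_of_real \<sigma> * Ln z))"
  have "isCont H 1" unfolding H_def by (intro continuous_intros) auto
  then obtain \<eta>0 where \<eta>0: "\<eta>0 > 0" "\<And>z. dist z 1 < \<eta>0 \<Longrightarrow> dist (H z) (H 1) < 1 / 2"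
    unfolding continuous_at_eps_delta by (metis half_gt_zero zero_less_one)
  define \<eta> where "\<eta> = min \<eta>0 1"
  define \<delta> where "\<delta> = \<eta> / 3"
  have \<eta>: "0 < \<eta>" "\<eta> \<le> 1" using \<eta>0 by (auto simp: \<eta>_def)
  have \<delta>: "0 < \<delta>" "\<delta> \<le> 1" "3 * \<delta> = \<eta>" using \<eta> by (auto simp: \<delta>_def)
  have H: "norm (H z - 1) < 1 / 2" if "norm (z - 1) < \<eta>" for z
    using \<eta>0(2)[of z] that by (simp add: \<eta>_def dist_norm H_def)
  define C where "C = 2 * (2 * real N / \<delta>) ^ N"
  have C: "C > 0" using N \<delta> by (simp add: C_def)
  define R where "R = 2 * real N / \<delta> + 1"
  have R1: "R \<ge> 1" using N \<delta> by (simp add: R_def)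
  have main: "\<bar>(forward_diff b ^^ N) (symbol \<sigma> t) \<xi>\<bar> \<le> C * t * norm \<xi> powr (2 * \<sigma> - real N)"
    if t: "t \<ge> 0" and b: "b \<in> Basis" and \<xi>: "norm \<xi> > R" for t and \<xi> b :: 'a
  proof -
    define r where "r = norm \<xi>"
    have r: "r > 0" "r > R" "r > 2 * real N / \<delta>" using \<xi> R1 by (auto simp: r_def R_def)
    define \<zeta> where "\<zeta> = (\<lambda>w. 1 + (2 * complex_of_real (\<xi> \<bullet> b) * w + w\<^sup>2) / complex_of_real (r\<^sup>2))"
    define E where "E = (\<lambda>w. complex_of_real (t * r powr (2 * \<sigma>)) * H (\<zeta> w))"
    define h where "h = (\<lambda>w. exp (- E w) - 1)"
    have \<zeta>: "norm (\<zeta> w - 1) < \<eta>" if "w \<in> ball 0 (\<delta> * r)" for w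
    proof -
      have w: "norm w < \<delta> * r" using that by simp
      have "norm (2 * complex_of_real (\<xi> \<bullet> b) * w + w\<^sup>2) \<le> 2 * \<bar>\<xi> \<bullet> b\<bar> * norm w + norm w * norm w"
        by (rule order_trans[OF norm_triangle_ineq]) (simp add: norm_mult power2_eq_square)
      also have "\<dots> \<le> 2 * r * norm w + (\<delta> * r) * norm w"
        using b w by (intro add_mono mult_right_mono) (auto simp: r_def Basis_le_norm)
      also have "\<dots> \<le> 3 * r * norm w"
        using \<delta> r mult_right_mono[of "\<delta> * r" "1 * r" "norm w"] by (auto simp: mult_right_mono)
      also have "\<dots> < 3 * r * (\<delta> * r)" using r w by (intro mult_strict_left_mono) auto
      also have "\<dots> = \<eta> * r\<^sup>2" using \<delta> by (simp add: power2_eq_square)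
      finally show ?thesis
        using r by (simp add: \<zeta>_def norm_divide norm_power field_simps)
    qed
    have \<zeta>0: "\<zeta> w \<notin> \<real>\<^sub>\<le>\<^sub>0" if "w \<in> ball 0 (\<delta> * r)" for w
    proof -
      have "\<bar>Re (\<zeta> w - 1)\<bar> < 1"
        using \<zeta>[OF that] \<eta> abs_Re_le_cmod[of "\<zeta> w - 1"] by linarith
      then show ?thesis by (auto simp: complex_nonpos_Reals_iff)
    qed
    have hol: "h holomorphic_on ball 0 (\<delta> * r)"
      unfolding h_def E_def H_def \<zeta>_def using \<zeta>0 r
      by (intro holomorphic_intros) (auto simp: \<zeta>_def)
    have bd: "norm (h w) \<le> 2 * t * r powr (2 * \<sigma>)" if w: "w \<in> ball 0 (\<delta> * r)" for w
    proof -
      have H1: "norm (H (\<zeta> w) - 1) < 1 / 2" by (rule H[OF \<zeta>[OF w]])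
      then have "\<bar>Re (H (\<zeta> w) - 1)\<bar> < 1 / 2"
        using abs_Re_le_cmod[of "H (\<zeta> w) - 1"] by linarith
      then have "Re (H (\<zeta> w)) \<ge> 0" unfolding minus_complex.sel one_complex.sel by linarith
      then have "Re (E w) \<ge> 0" using t by (simp add: E_def)
      then have "norm (h w) \<le> norm (E w)" unfolding h_def by (rule norm_exp_minus_one_le)
      also have "\<dots> = t * r powr (2 * \<sigma>) * norm (H (\<zeta> w))"
        using t by (simp add: E_def norm_mult)
      also have "norm (H (\<zeta> w)) \<le> 2"
        using H1 norm_triangle_ineq2[of "H (\<zeta> w)" 1] by simp
      finally have "norm (h w) \<le> t * r powr (2 * \<sigma>) * 2"
        using t by (auto simp: mult_left_mono)
      then show ?thesis by (simp add: mult_ac)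
    qed
    have real: "h (of_real s) = of_real (symbol \<sigma> t (\<xi> + s *\<^sub>R b) - 1)" if s: "\<bar>s\<bar> < \<delta> * r" for s
    proof -
      define y where "y = 1 + (2 * (\<xi> \<bullet> b) * s + s\<^sup>2) / r\<^sup>2"
      have zy: "\<zeta> (of_real s) = of_real y" by (simp add: \<zeta>_def y_def)
      have y: "y > 0"
        using \<zeta>0[of "of_real s"] s unfolding zy by (simp add: complex_nonpos_Reals_iff)
      have "(norm (\<xi> + s *\<^sub>R b))\<^sup>2 = r\<^sup>2 + (2 * (\<xi> \<bullet> b) * s + s\<^sup>2)"
        unfolding r_def power2_norm_eq_inner using b
        by (simp add: inner_add_left inner_add_right inner_commute[of b \<xi>] inner_same_Basis
            power2_eq_square algebra_simps)
      also have "\<dots> = r\<^sup>2 * y" using r by (simp add: y_def field_simps)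
      finally have "(norm (\<xi> + s *\<^sub>R b))\<^sup>2 = r\<^sup>2 * y" .
      then have "norm (\<xi> + s *\<^sub>R b) = r * sqrt y"
        using r y by (metis norm_ge_zero real_sqrt_mult real_sqrt_unique less_imp_le)
      then have "norm (\<xi> + s *\<^sub>R b) powr (2 * \<sigma>) = r powr (2 * \<sigma>) * y powr \<sigma>"
        using r y by (simp add: powr_mult powr_half_sqrt[symmetric] powr_powr)
      moreover have "H (of_real y) = of_real (y powr \<sigma>)"
        using y by (simp add: H_def Ln_of_real powr_def exp_of_real[symmetric])
      ultimately show ?thesis
        by (simp add: h_def E_def zy symbol_def exp_of_real[symmetric] mult_ac)
    qed
    have diff: "(forward_diff 1 ^^ m) h (of_real s) =
        of_real ((forward_diff b ^^ m) (\<lambda>x. symbol \<sigma> t x - 1) (\<xi> + s *\<^sub>R b))"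
      if "0 \<le> s" "s + real m < \<delta> * r" for s m
      using that
    proof (induction m arbitrary: s)
      case (Suc m)
      show ?case
        using Suc.IH[of s] Suc.IH[of "s + 1"] Suc.prems
        by (simp add: forward_diff_def[of _ "(forward_diff _ ^^ m) _"] algebra_simps)
    qed (use real in auto)
    define \<rho> where "\<rho> = \<delta> * r / (2 * real N)"
    have \<rho>: "\<rho> > 0" using \<delta> r N by (simp add: \<rho>_def)
    have Nr: "2 * real N < \<delta> * r" using r(3) \<delta> by (simp add: field_simps)
    have "real N * (\<rho> + 1) = \<delta> * r / 2 + real N" using N by (simp add: \<rho>_def field_simps)
    then have "0 < \<delta> * r - real N * (\<rho> + 1)" using Nr by linarith
    then have "norm ((forward_diff 1 ^^ N) h (of_real 0)) \<le> 2 * t * r powr (2 * \<sigma>) / \<rho> ^ N"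
      using forward_diff_holomorphic_bound[OF hol bd \<rho>, of N] by auto
    also have "(forward_diff 1 ^^ N) h (of_real 0) = of_real ((forward_diff b ^^ N) (symbol \<sigma> t) \<xi>)"
      using diff[of 0 N] Nr N by (simp add: forward_diff_iterate_add_const)
    finally have "\<bar>(forward_diff b ^^ N) (symbol \<sigma> t) \<xi>\<bar> \<le> 2 * t * r powr (2 * \<sigma>) / \<rho> ^ N"
      by simp
    also have "\<dots> = C * t * r powr (2 * \<sigma> - real N)"
      using r \<delta> N by (simp add: C_def \<rho>_def powr_diff powr_realpow power_divide power_mult_distrib field_simps)
    finally show ?thesis by (simp add: r_def)
  qed
  show thesis by (rule that[OF R1 C main])
qed

text \<open>
  Near the origin the differences are taken of \<open>symbol \<sigma> t \<xi> - 1\<close>, which is of size \<open>t \<bar>\<xi>\<bar>\<^sup>2\<^sup>\<sigma>\<close>;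
  the constant cancels.  So the bound is linear in \<open>t\<close> in both regimes, and \<open>N\<close> may be taken
  large enough to make the right-hand side integrable.
\<close>

lemma symbol_diff_bound:
  assumes \<sigma>: "\<sigma> > 0" and N: "real N > 2 * \<sigma>"
  obtains C where "C > 0"
    "\<And>t (\<xi>::'a::euclidean_space) b. t \<ge> 0 \<Longrightarrow> b \<in> Basis \<Longrightarrow>
       \<bar>(forward_diff b ^^ N) (symbol \<sigma> t) \<xi>\<bar> \<le> C * t * (1 + norm \<xi>) powr (2 * \<sigma> - real N)"
proof -
  have N0: "N > 0" using N \<sigma> by (cases N) auto
  obtain R C where RC: "R \<ge> 1" "C > 0"
    "\<And>t (\<xi>::'a) b. t \<ge> 0 \<Longrightarrow> b \<in> Basis \<Longrightarrow> norm \<xi> > R \<Longrightarrow>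
       \<bar>(forward_diff b ^^ N) (symbol \<sigma> t) \<xi>\<bar> \<le> C * t * norm \<xi> powr (2 * \<sigma> - real N)"
    using symbol_diff_far[OF \<sigma> N0] by blast
  define C1 where "C1 = C * 2 powr (real N - 2 * \<sigma>)"
  define C2 where "C2 = 2 ^ N * (R + real N) powr (2 * \<sigma>) * (1 + R) powr (real N - 2 * \<sigma>)"
  have pos: "C1 > 0" "C2 > 0" using RC by (auto simp: C1_def C2_def)
  have main: "\<bar>(forward_diff b ^^ N) (symbol \<sigma> t) \<xi>\<bar> \<le> (C1 + C2) * t * (1 + norm \<xi>) powr (2 * \<sigma> - real N)"
    if t: "t \<ge> 0" and b: "b \<in> Basis" for t and \<xi> b :: 'a
  proof (cases "norm \<xi> > R")
    case True
    have "norm \<xi> powr (2 * \<sigma> - real N) \<le> ((1 + norm \<xi>) / 2) powr (2 * \<sigma> - real N)"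
      using True RC N by (intro powr_mono2') auto
    also have "\<dots> = 2 powr (real N - 2 * \<sigma>) * (1 + norm \<xi>) powr (2 * \<sigma> - real N)"
      by (simp add: powr_divide powr_diff divide_simps)
    finally have "C * t * norm \<xi> powr (2 * \<sigma> - real N) \<le> C1 * t * (1 + norm \<xi>) powr (2 * \<sigma> - real N)"
      using RC t by (simp add: C1_def mult_left_mono mult.assoc mult.left_commute)
    also have "\<dots> \<le> (C1 + C2) * t * (1 + norm \<xi>) powr (2 * \<sigma> - real N)"
      using pos t by (intro mult_right_mono) auto
    finally show ?thesis using RC(3)[OF t b True] by linarith
  next
    case False
    have "\<bar>(forward_diff b ^^ N) (\<lambda>x. symbol \<sigma> t x - 1) \<xi>\<bar> \<le> 2 ^ N * (t * (R + real N) powr (2 * \<sigma>))"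
    proof (rule forward_diff_iterate_norm_le)
      fix k assume k: "k \<le> N"
      let ?y = "\<xi> + real k *\<^sub>R b"
      have "norm ?y \<le> R + real N"
        using norm_triangle_ineq[of \<xi> "real k *\<^sub>R b"] False k b by simp
      then have "norm ?y powr (2 * \<sigma>) \<le> (R + real N) powr (2 * \<sigma>)"
        using \<sigma> by (intro powr_mono2) auto
      moreover have "1 - symbol \<sigma> t ?y \<le> norm ?y powr (2 * \<sigma>) * t"
        using exp_ge_add_one_self[of "- (norm ?y powr (2 * \<sigma>)) * t"] by (simp add: symbol_def)
      moreover have "symbol \<sigma> t ?y \<le> 1" using t by (rule symbol_bounds)
      ultimately show "\<bar>symbol \<sigma> t ?y - 1\<bar> \<le> t * (R + real N) powr (2 * \<sigma>)"
        using mult_right_mono[of "norm ?y powr (2 * \<sigma>)" "(R + real N) powr (2 * \<sigma>)" t] t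
        by (simp add: mult.commute)
    qed
    then have "\<bar>(forward_diff b ^^ N) (symbol \<sigma> t) \<xi>\<bar> \<le> 2 ^ N * (t * (R + real N) powr (2 * \<sigma>))"
      using N0 by (simp add: forward_diff_iterate_add_const)
    also have "\<dots> = C2 * t * (1 + R) powr (2 * \<sigma> - real N)"
      using RC by (simp add: C2_def powr_diff)
    also have "\<dots> \<le> C2 * t * (1 + norm \<xi>) powr (2 * \<sigma> - real N)"
      using False N RC pos t by (intro mult_left_mono powr_mono2') (auto simp: add_pos_nonneg)
    also have "\<dots> \<le> (C1 + C2) * t * (1 + norm \<xi>) powr (2 * \<sigma> - real N)"
      using pos t by (intro mult_right_mono) auto
    finally show ?thesis .
  qed
  show thesis using that[OF _ main] pos by simp
qed

section \<open>The profile of the heat kernel\<close>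

lemma integrable_cos_mult:
  assumes "integrable lborel (g :: 'a::euclidean_space \<Rightarrow> real)"
  shows "integrable lborel (\<lambda>\<xi>. cos (z \<bullet> \<xi>) * g \<xi>)"
  by (rule Bochner_Integration.integrable_bound[OF assms])
    (use assms in \<open>auto simp: abs_mult mult_left_le_one_le\<close>)

text \<open>A shift by half a period in the direction \<open>b\<close> changes the sign of the cosine.\<close>

lemma integral_cos_forward_diff:
  fixes g :: "'a::euclidean_space \<Rightarrow> real"
  assumes g: "integrable lborel g" and z: "\<bar>z \<bullet> b\<bar> = pi"
  shows "(LINT \<xi>|lborel. cos (z \<bullet> \<xi>) * forward_diff b g \<xi>) = - 2 * (LINT \<xi>|lborel. cos (z \<bullet> \<xi>) * g \<xi>)"
    and "integrable lborel (forward_diff b g)"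
proof -
  have ib: "integrable lborel (\<lambda>\<xi>. g (\<xi> + b))"
    using integrable_lborel_reflect(2)[OF g, of "-b"] by simp
  then show "integrable lborel (forward_diff b g)"
    using g unfolding forward_diff_def[abs_def] by auto
  have zb: "z \<bullet> b = pi \<or> z \<bullet> b = - pi" using z by (auto simp: abs_if split: if_splits)
  have "(LINT \<xi>|lborel. cos (z \<bullet> \<xi>) * g (\<xi> + b)) = (LINT \<xi>|lborel. - cos (z \<bullet> (\<xi> - - b)) * g (\<xi> - - b))"
    using zb by (intro Bochner_Integration.integral_cong) (auto simp: inner_add_right cos_add)
  also have "\<dots> = (LINT \<xi>|lborel. - cos (z \<bullet> \<xi>) * g \<xi>)"
    using g by (intro integral_lborel_reflect(2)[of "\<lambda>\<xi>. - cos (z \<bullet> \<xi>) * g \<xi>" "- b"]) auto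
  finally show "(LINT \<xi>|lborel. cos (z \<bullet> \<xi>) * forward_diff b g \<xi>) = - 2 * (LINT \<xi>|lborel. cos (z \<bullet> \<xi>) * g \<xi>)"
    unfolding forward_diff_def right_diff_distrib
    using integrable_cos_mult[OF ib, of z] integrable_cos_mult[OF g, of z]
    by (subst Bochner_Integration.integral_diff) simp_all
qed

lemma integral_cos_forward_diff_iterate:
  fixes g :: "'a::euclidean_space \<Rightarrow> real"
  assumes g: "integrable lborel g" and z: "\<bar>z \<bullet> b\<bar> = pi"
  shows "(LINT \<xi>|lborel. cos (z \<bullet> \<xi>) * (forward_diff b ^^ N) g \<xi>) = (- 2) ^ N * (LINT \<xi>|lborel. cos (z \<bullet> \<xi>) * g \<xi>)
    \<and> integrable lborel ((forward_diff b ^^ N) g)"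
  by (induction N) (use g integral_cos_forward_diff[OF _ z] in auto)

text \<open>
  Linear growth in \<open>t\<close>, at the points where the sign flips, is the decay of the profile in another
  form: the scaling below moves an arbitrary point to one of these.
\<close>

lemma cos_transform_symbol_bound:
  assumes \<sigma>: "\<sigma> > 0"
  obtains C where "C > 0"
    "\<And>t (z::'a::euclidean_space) b. t > 0 \<Longrightarrow> b \<in> Basis \<Longrightarrow> \<bar>z \<bullet> b\<bar> = pi \<Longrightarrow>
       \<bar>LINT \<xi>|lborel. cos (z \<bullet> \<xi>) * symbol \<sigma> t \<xi>\<bar> \<le> C * t"
proof -
  obtain N :: nat where N: "real N > 2 * \<sigma> + real DIM('a)" using reals_Archimedean2 by blast
  then have N': "real N > 2 * \<sigma>" by (rule le_less_trans[rotated]) simp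
  obtain C where C: "C > 0" "\<And>t (\<xi>::'a) b. t \<ge> 0 \<Longrightarrow> b \<in> Basis \<Longrightarrow>
       \<bar>(forward_diff b ^^ N) (symbol \<sigma> t) \<xi>\<bar> \<le> C * t * (1 + norm \<xi>) powr (2 * \<sigma> - real N)"
    using symbol_diff_bound[OF \<sigma> N'] by blast
  let ?I = "LINT \<xi>::'a|lborel. (1 + norm \<xi>) powr (2 * \<sigma> - real N)"
  have int: "integrable lborel (\<lambda>\<xi>::'a. (1 + norm \<xi>) powr (2 * \<sigma> - real N))"
    using integrable_one_plus_norm_powr[of "real N - 2 * \<sigma> - real DIM('a)", where 'a='a] N by simp
  have I: "?I \<ge> 0" by (intro integral_nonneg_AE) auto
  have main: "\<bar>LINT \<xi>|lborel. cos (z \<bullet> \<xi>) * symbol \<sigma> t \<xi>\<bar> \<le> (C * ?I + 1) * t"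
    if t: "t > 0" and b: "b \<in> Basis" and z: "\<bar>z \<bullet> b\<bar> = pi" for t and z b :: 'a
  proof -
    let ?J = "LINT \<xi>|lborel. cos (z \<bullet> \<xi>) * symbol \<sigma> t \<xi>"
    note it = integral_cos_forward_diff_iterate[OF integrable_symbol[OF \<sigma> t] z, of N]
    have "1 * \<bar>?J\<bar> \<le> 2 ^ N * \<bar>?J\<bar>" by (intro mult_right_mono) auto
    also have "2 ^ N * \<bar>?J\<bar> = \<bar>LINT \<xi>|lborel. cos (z \<bullet> \<xi>) * (forward_diff b ^^ N) (symbol \<sigma> t) \<xi>\<bar>"
      using it by (simp add: abs_mult power_abs)
    also have "\<dots> \<le> (LINT \<xi>|lborel. \<bar>cos (z \<bullet> \<xi>) * (forward_diff b ^^ N) (symbol \<sigma> t) \<xi>\<bar>)"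
      by (rule integral_abs_bound)
    also have "\<dots> \<le> (LINT \<xi>|lborel. C * t * (1 + norm (\<xi>::'a)) powr (2 * \<sigma> - real N))"
    proof (rule integral_mono)
      fix \<xi> :: 'a
      have "\<bar>cos (z \<bullet> \<xi>) * (forward_diff b ^^ N) (symbol \<sigma> t) \<xi>\<bar> \<le> \<bar>(forward_diff b ^^ N) (symbol \<sigma> t) \<xi>\<bar>"
        by (simp add: abs_mult mult_left_le_one_le)
      also have "\<dots> \<le> C * t * (1 + norm \<xi>) powr (2 * \<sigma> - real N)"
        using C(2)[of t b \<xi>] t b by simp
      finally show "\<bar>cos (z \<bullet> \<xi>) * (forward_diff b ^^ N) (symbol \<sigma> t) \<xi>\<bar> \<le> C * t * (1 + norm \<xi>) powr (2 * \<sigma> - real N)" .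
    qed (use it int in \<open>auto intro!: integrable_abs integrable_cos_mult\<close>)
    also have "\<dots> = C * ?I * t" by simp
    also have "\<dots> \<le> (C * ?I + 1) * t" using t by simp
    finally show ?thesis by simp
  qed
  show thesis by (rule that[OF _ main]) (use C I in \<open>simp add: add_nonneg_pos\<close>)
qed

definition frac_profile :: "real \<Rightarrow> 'a::euclidean_space \<Rightarrow> real" where
  "frac_profile \<sigma> x = (LINT \<xi>|lborel. cos (x \<bullet> \<xi>) * symbol \<sigma> 1 \<xi>) / (2 * pi) ^ DIM('a)"

lemma cos_transform_symbol_scale:
  fixes x :: "'a::euclidean_space"
  assumes "\<sigma> > 0" "t > 0" "a > 0"
  shows "(LINT \<xi>|lborel. cos (x \<bullet> \<xi>) * symbol \<sigma> t \<xi>) =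
    a ^ DIM('a) * (LINT \<xi>|lborel. cos (a *\<^sub>R x \<bullet> \<xi>) * symbol \<sigma> (a powr (2 * \<sigma>) * t) \<xi>)"
  using assms by (subst integral_lborel_affine[of _ a 0])
    (auto simp: symbol_def powr_mult mult_ac)

lemma frac_heat_kernel_eq:
  fixes x :: "real^'n"
  assumes "\<sigma> > 0" "t > 0"
  shows "frac_heat_kernel \<sigma> t x =
    t powr (- (real CARD('n) / (2 * \<sigma>))) * frac_profile \<sigma> (t powr (- 1 / (2 * \<sigma>)) *\<^sub>R x)"
proof -
  let ?g = "\<lambda>\<xi>. cis (x \<bullet> \<xi>) * complex_of_real (symbol \<sigma> t \<xi>)"
  define a where "a = t powr (- 1 / (2 * \<sigma>))"
  have "a powr (2 * \<sigma>) = t powr (-1)" using assms by (simp add: a_def powr_powr del: powr_minus_divide)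
  then have a: "a > 0" "a powr (2 * \<sigma>) * t = 1"
    using assms by (auto simp: a_def powr_minus)
  have an: "a ^ CARD('n) = t powr (- (real CARD('n) / (2 * \<sigma>)))"
    unfolding a_def using assms by (subst powr_power) auto
  have "cis = (\<lambda>y. Complex (cos y) (sin y))" by (auto simp: fun_eq_iff cis.code)
  then have [measurable]: "cis \<in> borel_measurable borel"
    by (intro borel_measurable_continuous_onI) (auto simp: cis_conv_exp intro!: continuous_intros)
  have int: "integrable lborel ?g"
    by (rule Bochner_Integration.integrable_bound[OF integrable_symbol[OF assms]])
      (auto simp: norm_mult)
  have "frac_heat_kernel \<sigma> t x = (1 / (2 * pi) ^ CARD('n)) * Re (LINT \<xi>|lborel. ?g \<xi>)"
    unfolding frac_heat_kernel_def inverse_fourier_def symbol_def by (simp del: of_real_power of_real_divide)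
  also have "Re (LINT \<xi>|lborel. ?g \<xi>) = (LINT \<xi>|lborel. cos (x \<bullet> \<xi>) * symbol \<sigma> t \<xi>)"
    using integral_Re[OF int] by simp
  also have "\<dots> = a ^ CARD('n) * (LINT \<xi>|lborel. cos (a *\<^sub>R x \<bullet> \<xi>) * symbol \<sigma> 1 \<xi>)"
    using cos_transform_symbol_scale[OF assms a(1), of x] by (simp only: a(2)) simp
  finally show ?thesis using an by (simp add: frac_profile_def a_def)
qed

lemma continuous_frac_profile:
  assumes "\<sigma> > 0"
  shows "continuous_on UNIV (frac_profile \<sigma> :: 'a::euclidean_space \<Rightarrow> real)"
  unfolding continuous_on_def frac_profile_def
proof (intro ballI tendsto_divide tendsto_const)
  fix x :: 'a
  have int: "integrable lborel (symbol \<sigma> 1 :: 'a \<Rightarrow> real)" by (rule integrable_symbol) (use assms in auto)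
  show "((\<lambda>x. LINT \<xi>|lborel. cos (x \<bullet> \<xi>) * symbol \<sigma> 1 \<xi>) \<longlongrightarrow> (LINT \<xi>|lborel. cos (x \<bullet> \<xi>) * symbol \<sigma> 1 \<xi>)) (at x within UNIV)"
    by (rule integral_dominated_convergence_within[OF _ _ int])
      (auto intro!: always_eventually tendsto_intros simp: abs_mult mult_left_le_one_le symbol_bounds(1) less_imp_le)
qed simp

lemma frac_profile_bounded:
  assumes "\<sigma> > 0"
  obtains C where "C > 0" "\<And>x :: 'a::euclidean_space. \<bar>frac_profile \<sigma> x\<bar> \<le> C"
proof (rule that)
  have int: "integrable lborel (symbol \<sigma> 1 :: 'a \<Rightarrow> real)" by (rule integrable_symbol) (use assms in auto)
  let ?C = "LINT \<xi>::'a|lborel. symbol \<sigma> 1 \<xi>"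
  have C: "?C \<ge> 0" by (intro integral_nonneg_AE) (auto simp: symbol_bounds(1) less_imp_le)
  then show "?C / (2 * pi) ^ DIM('a) + 1 > 0" by (intro add_nonneg_pos) auto
  fix x :: 'a
  have "\<bar>LINT \<xi>|lborel. cos (x \<bullet> \<xi>) * symbol \<sigma> 1 \<xi>\<bar> \<le> (LINT \<xi>|lborel. \<bar>cos (x \<bullet> \<xi>) * symbol \<sigma> 1 \<xi>\<bar>)"
    by (rule integral_abs_bound)
  also have "\<dots> \<le> ?C"
  proof (rule integral_mono)
    show "integrable lborel (\<lambda>\<xi>. \<bar>cos (x \<bullet> \<xi>) * symbol \<sigma> 1 \<xi>\<bar>)"
      using integrable_cos_mult[OF int] by (rule integrable_abs)
  qed (use int in \<open>auto simp: abs_mult mult_left_le_one_le symbol_bounds(1) less_imp_le\<close>)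
  finally show "\<bar>frac_profile \<sigma> x\<bar> \<le> ?C / (2 * pi) ^ DIM('a) + 1"
    by (simp add: frac_profile_def abs_divide power_abs divide_right_mono add_increasing2)
qed

text \<open>
  The coordinate \<open>b\<close> in which \<open>x\<close> is largest satisfies \<open>\<bar>x \<bullet> b\<bar> \<ge> \<bar>x\<bar> / n\<close>, so rescaling \<open>x\<close> to
  \<open>\<bar>x \<bullet> b\<bar> = \<pi>\<close> costs a factor \<open>a\<close> comparable to \<open>1 / \<bar>x\<bar>\<close>.  The Jacobian contributes \<open>a\<^sup>n\<close>, and
  the time \<open>a\<^sup>2\<^sup>\<sigma>\<close> of the rescaled symbol contributes the rest.
\<close>

lemma frac_profile_decay:
  assumes \<sigma>: "\<sigma> > 0"
  obtains C where "C > 0"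
    "\<And>x :: 'a::euclidean_space. \<bar>frac_profile \<sigma> x\<bar> \<le> C * (1 + norm x) powr (- (real DIM('a) + 2 * \<sigma>))"
proof -
  define k where "k = real DIM('a) + 2 * \<sigma>"
  have k: "k > 0" using \<sigma> by (simp add: k_def add_pos_pos)
  obtain B where B: "B > 0" "\<And>x :: 'a. \<bar>frac_profile \<sigma> x\<bar> \<le> B" using frac_profile_bounded[OF \<sigma>] by blast
  obtain C where C: "C > 0"
    "\<And>t (z::'a) b. t > 0 \<Longrightarrow> b \<in> Basis \<Longrightarrow> \<bar>z \<bullet> b\<bar> = pi \<Longrightarrow>
       \<bar>LINT \<xi>|lborel. cos (z \<bullet> \<xi>) * symbol \<sigma> t \<xi>\<bar> \<le> C * t"
    using cos_transform_symbol_bound[OF \<sigma>] by blast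
  define n where "n = real DIM('a)"
  have n: "n > 0" by (simp add: n_def)
  define C1 where "C1 = C * (2 * n * pi) powr k"
  define C2 where "C2 = B * 2 powr k"
  have pos: "C1 > 0" "C2 > 0" using B C n by (auto simp: C1_def C2_def)
  have main: "\<bar>frac_profile \<sigma> x\<bar> \<le> (C1 + C2) * (1 + norm x) powr (- k)" for x :: 'a
  proof (cases "norm x \<ge> 1")
    case True
    have "\<exists>b\<in>Basis. norm x / n \<le> \<bar>x \<bullet> b\<bar>"
    proof (rule ccontr)
      assume "\<not> ?thesis"
      then have "(\<Sum>b\<in>Basis. \<bar>x \<bullet> b\<bar>) < (\<Sum>b\<in>(Basis::'a set). norm x / n)"
        by (intro sum_strict_mono) auto
      also have "\<dots> = norm x" using n by (simp add: n_def)
      finally show False using norm_le_l1[of x] by simp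
    qed
    then obtain b where b: "b \<in> Basis" "norm x / n \<le> \<bar>x \<bullet> b\<bar>" by blast
    define a where "a = pi / \<bar>x \<bullet> b\<bar>"
    have "0 < norm x / n" using True n by (intro divide_pos_pos) auto
    then have xb: "\<bar>x \<bullet> b\<bar> > 0" using b(2) by linarith
    then have a: "a > 0" by (simp add: a_def)
    have "norm x \<le> n * \<bar>x \<bullet> b\<bar>" using b n by (simp add: field_simps)
    then have "n * pi / (n * \<bar>x \<bullet> b\<bar>) \<le> n * pi / norm x"
      using n xb True by (intro divide_left_mono mult_pos_pos) auto
    then have a2: "a \<le> n * pi / norm x" using n by (simp add: a_def)
    have "\<bar>a *\<^sub>R x \<bullet> b\<bar> = pi" using xb a by (simp add: abs_mult a_def)
    then have "\<bar>LINT \<xi>|lborel. cos (a *\<^sub>R x \<bullet> \<xi>) * symbol \<sigma> (a powr (2 * \<sigma>) * 1) \<xi>\<bar> \<le> C * (a powr (2 * \<sigma>) * 1)"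
      using b a by (intro C(2)[OF _ b(1)]) auto
    then have "\<bar>LINT \<xi>|lborel. cos (x \<bullet> \<xi>) * symbol \<sigma> 1 \<xi>\<bar> \<le> a ^ DIM('a) * (C * (a powr (2 * \<sigma>) * 1))"
      using a by (subst cos_transform_symbol_scale[OF \<sigma> zero_less_one a])
        (simp add: abs_mult power_abs mult_left_mono)
    also have "\<dots> = C * a powr k" using a by (simp add: k_def powr_add powr_realpow mult_ac)
    also have "\<dots> \<le> C * (n * pi / norm x) powr k"
      using a a2 k C by (intro mult_left_mono powr_mono2) auto
    also have "\<dots> \<le> C * (2 * n * pi / (1 + norm x)) powr k"
    proof (intro mult_left_mono powr_mono2)
      have "2 * n * pi / (2 * norm x) \<le> 2 * n * pi / (1 + norm x)"
        using n True by (intro divide_left_mono mult_pos_pos) auto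
      then show "n * pi / norm x \<le> 2 * n * pi / (1 + norm x)" by simp
    qed (use k C n in auto)
    also have "\<dots> = C1 * (1 + norm x) powr (- k)"
      using n by (simp add: C1_def powr_divide powr_minus divide_simps)
    finally have 1: "\<bar>LINT \<xi>|lborel. cos (x \<bullet> \<xi>) * symbol \<sigma> 1 \<xi>\<bar> \<le> C1 * (1 + norm x) powr (- k)" .
    have "(1::real) \<le> (2 * pi) ^ DIM('a)" using pi_gt3 by (intro one_le_power) linarith
    then have "\<bar>frac_profile \<sigma> x\<bar> \<le> \<bar>LINT \<xi>|lborel. cos (x \<bullet> \<xi>) * symbol \<sigma> 1 \<xi>\<bar>"
      by (simp add: frac_profile_def abs_divide power_abs divide_le_eq mult_le_cancel_left1)
    also note 1
    also have "C1 * (1 + norm x) powr (- k) \<le> (C1 + C2) * (1 + norm x) powr (- k)"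
      using pos by (intro mult_right_mono) auto
    finally show ?thesis .
  next
    case False
    have "B = C2 * 2 powr (- k)" by (simp add: C2_def powr_minus)
    also have "\<dots> \<le> C2 * (1 + norm x) powr (- k)"
      using False k pos by (intro mult_left_mono powr_mono2') (auto simp: add_pos_nonneg)
    also have "\<dots> \<le> (C1 + C2) * (1 + norm x) powr (- k)"
      using pos by (intro mult_right_mono) auto
    finally show ?thesis using B(2)[of x] by linarith
  qed
  show thesis using that[of "C1 + C2"] main pos by (simp add: k_def)
qed

text \<open>The one-dimensional transform is the characteristic function of the normal distribution.\<close>

lemma integral_cos_gaussian_real:
  fixes t :: real
  shows "(CLINT y|lborel. iexp (t * y) * complex_of_real (exp (- y\<^sup>2 / 2))) = complex_of_real (sqrt (2 * pi) * exp (- t\<^sup>2 / 2))"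
proof -
  have "complex_of_real (exp (- t\<^sup>2 / 2)) = (CLINT y|std_normal_distribution. iexp (t * y))"
    using fun_cong[OF char_std_normal_distribution, of t] by (simp add: char_def)
  also have "\<dots> = (CLINT y|lborel. std_normal_density y *\<^sub>R iexp (t * y))"
    by (subst integral_density) auto
  also have "\<dots> = (CLINT y|lborel. complex_of_real (1 / sqrt (2 * pi)) * (iexp (t * y) * complex_of_real (exp (- y\<^sup>2 / 2))))"
    by (intro Bochner_Integration.integral_cong) (auto simp: std_normal_density_def scaleR_conv_of_real mult_ac)
  also have "\<dots> = complex_of_real (1 / sqrt (2 * pi)) * (CLINT y|lborel. iexp (t * y) * complex_of_real (exp (- y\<^sup>2 / 2)))"
    by simp
  finally show ?thesis by (simp add: field_simps)
qed

lemma integrable_gaussian_real: "integrable lborel (\<lambda>y::real. exp (- y\<^sup>2 / 2))"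
proof -
  have "integrable lborel (\<lambda>y. sqrt (2 * pi) * std_normal_density y)"
    by (intro integrable_mult_right) (rule integrable_normal_density, simp)
  then show ?thesis by (simp add: std_normal_density_def)
qed

definition gaussian :: "'a::euclidean_space \<Rightarrow> real" where
  "gaussian x = exp (- (norm x)\<^sup>2 / 2)"

lemma borel_measurable_gaussian [measurable]: "gaussian \<in> borel_measurable borel"
  unfolding gaussian_def[abs_def] by measurable

lemma gaussian_bounds: "0 < gaussian x" "gaussian x \<le> 1" "\<bar>gaussian x\<bar> \<le> 1"
  by (auto simp: gaussian_def)

lemma gaussian_prod: "gaussian (x::'a::euclidean_space) = (\<Prod>b\<in>Basis. exp (- (x \<bullet> b)\<^sup>2 / 2))"
proof -
  have "(norm x)\<^sup>2 = (\<Sum>b\<in>Basis. (x \<bullet> b)\<^sup>2)"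
    by (subst power2_norm_eq_inner, subst euclidean_inner) (simp add: power2_eq_square)
  then show ?thesis
    by (simp add: gaussian_def exp_sum[symmetric] sum_negf sum_divide_distrib)
qed

lemma integrable_gaussian: "integrable lborel (gaussian :: 'a::euclidean_space \<Rightarrow> real)"
proof (rule integrableI_bounded)
  have "(\<integral>\<^sup>+x. ennreal (exp (- (x::real)\<^sup>2 / 2)) \<partial>lborel) < \<infinity>"
    using integrable_gaussian_real by (simp add: integrable_iff_bounded)
  moreover have "(\<integral>\<^sup>+x. ennreal (norm (gaussian (x::'a))) \<partial>lborel) =
      (\<Prod>b\<in>(Basis::'a set). (\<integral>\<^sup>+x. ennreal (exp (- (x::real)\<^sup>2 / 2)) \<partial>lborel))"
    by (subst nn_integral_lborel_prod[symmetric]) (auto simp: gaussian_prod prod_ennreal abs_prod)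
  ultimately show "(\<integral>\<^sup>+x. ennreal (norm (gaussian (x::'a))) \<partial>lborel) < \<infinity>"
    by (simp add: power_less_top_ennreal)
qed measurable

lemma integral_cos_gaussian:
  fixes \<xi> :: "'a::euclidean_space"
  shows "(LINT x|lborel. cos (\<xi> \<bullet> x) * gaussian x) = sqrt (2 * pi) ^ DIM('a) * gaussian \<xi>"
proof -
  interpret product_sigma_finite "\<lambda>_::'a. lborel :: real measure" ..
  let ?f = "\<lambda>b y. iexp ((\<xi> \<bullet> b) * y) * complex_of_real (exp (- y\<^sup>2 / 2))"
  have int1: "integrable lborel (?f b)" for b
    by (rule Bochner_Integration.integrable_bound[OF integrable_gaussian_real]) (auto simp: norm_mult)
  have prod: "iexp (\<xi> \<bullet> x) * complex_of_real (gaussian x) = (\<Prod>b\<in>Basis. ?f b (x \<bullet> b))" for x :: 'a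
  proof -
    have "\<xi> \<bullet> x = (\<Sum>b\<in>Basis. (\<xi> \<bullet> b) * (x \<bullet> b))" by (rule euclidean_inner)
    then have "iexp (\<xi> \<bullet> x) = (\<Prod>b\<in>Basis. iexp ((\<xi> \<bullet> b) * (x \<bullet> b)))"
      by (simp add: sum_distrib_left exp_sum)
    then show ?thesis
      by (simp only: gaussian_prod prod.distrib of_real_prod)
  qed
  have int: "integrable lborel (\<lambda>x::'a. iexp (\<xi> \<bullet> x) * complex_of_real (gaussian x))"
    by (rule Bochner_Integration.integrable_bound[OF integrable_gaussian]) (auto simp: norm_mult)
  have "(CLINT x|lborel. iexp (\<xi> \<bullet> x) * complex_of_real (gaussian x)) = (CLINT x|lborel. (\<Prod>b\<in>Basis. ?f b (x \<bullet> b)))"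
    by (simp only: prod)
  also have "\<dots> = (CLINT x|(\<Pi>\<^sub>M b\<in>(Basis::'a set). lborel). (\<Prod>b\<in>Basis. ?f b ((\<Sum>b\<in>Basis. x b *\<^sub>R b) \<bullet> b)))"
    by (subst lborel_eq) (rule integral_distr, measurable)
  also have "\<dots> = (CLINT x|(\<Pi>\<^sub>M b\<in>(Basis::'a set). lborel). (\<Prod>b\<in>Basis. ?f b (x b)))"
    by (intro Bochner_Integration.integral_cong prod.cong refl) (simp add: inner_sum_left_Basis)
  also have "\<dots> = (\<Prod>b\<in>Basis. (CLINT y|lborel. ?f b y))"
    by (rule product_integral_prod) (use int1 in auto)
  also have "\<dots> = (\<Prod>b\<in>(Basis::'a set). complex_of_real (sqrt (2 * pi) * exp (- (\<xi> \<bullet> b)\<^sup>2 / 2)))"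
    by (intro prod.cong refl integral_cos_gaussian_real)
  also have "\<dots> = complex_of_real (sqrt (2 * pi) ^ DIM('a) * gaussian \<xi>)"
    by (simp only: gaussian_prod of_real_prod[symmetric] prod.distrib prod_constant)
  finally have "Re (CLINT x|lborel. iexp (\<xi> \<bullet> x) * complex_of_real (gaussian x)) = sqrt (2 * pi) ^ DIM('a) * gaussian \<xi>"
    by (simp only: Re_complex_of_real)
  then show ?thesis
    using integral_Re[OF int] by (simp add: cis_conv_exp[symmetric] Re_exp)
qed

lemma integral_cos_gaussian_scaled:
  fixes \<xi> :: "'a::euclidean_space"
  assumes "e > 0"
  shows "(LINT x|lborel. cos (\<xi> \<bullet> x) * gaussian (e *\<^sub>R x)) = (sqrt (2 * pi) / e) ^ DIM('a) * gaussian ((1 / e) *\<^sub>R \<xi>)"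
proof -
  have "(LINT x|lborel. cos (\<xi> \<bullet> x) * gaussian (e *\<^sub>R x)) =
    (1 / e) ^ DIM('a) * (LINT x|lborel. cos (\<xi> \<bullet> ((1 / e) *\<^sub>R x)) * gaussian x)"
    using assms by (subst integral_lborel_affine[of _ "1 / e" 0]) (auto)
  also have "\<dots> = (1 / e) ^ DIM('a) * (LINT x|lborel. cos (((1 / e) *\<^sub>R \<xi>) \<bullet> x) * gaussian x)"
    by simp
  also have "\<dots> = (1 / e) ^ DIM('a) * (sqrt (2 * pi) ^ DIM('a) * gaussian ((1 / e) *\<^sub>R \<xi>))"
    by (simp only: integral_cos_gaussian)
  finally show ?thesis by (simp add: power_divide)
qed

text \<open>
  The total mass is the value of the symbol at the origin.  Against the Gaussian cut-off
  \<open>gaussian (e x)\<close> the two integrations may be exchanged, and its transform averages the symbol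
  over a neighbourhood of the origin that shrinks as \<open>e\<close> tends to \<open>0\<close>.
\<close>

lemma integrable_frac_profile:
  assumes "\<sigma> > 0"
  shows "integrable lborel (frac_profile \<sigma> :: 'a::euclidean_space \<Rightarrow> real)"
proof -
  obtain C where C: "C > 0"
    "\<And>x :: 'a. \<bar>frac_profile \<sigma> x\<bar> \<le> C * (1 + norm x) powr (- (real DIM('a) + 2 * \<sigma>))"
    using frac_profile_decay[OF assms] by blast
  show ?thesis
  proof (rule Bochner_Integration.integrable_bound)
    show "integrable lborel (\<lambda>x::'a. C * (1 + norm x) powr (- (real DIM('a) + 2 * \<sigma>)))"
      using assms by (intro integrable_mult_right integrable_one_plus_norm_powr) auto
    show "frac_profile \<sigma> \<in> borel_measurable lborel"
      using borel_measurable_continuous_onI[OF continuous_frac_profile[OF assms]] by simp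
    show "AE x in lborel. norm (frac_profile \<sigma> x) \<le> norm (C * (1 + norm (x::'a)) powr (- (real DIM('a) + 2 * \<sigma>)))"
      using C order_trans[OF C(2) abs_ge_self] by (intro AE_I2) (simp only: real_norm_def)
  qed
qed

lemma integral_frac_profile:
  assumes \<sigma>: "\<sigma> > 0"
  shows "(LINT x|lborel. frac_profile \<sigma> (x :: 'a::euclidean_space)) = 1"
proof -
  let ?n = "DIM('a)"
  have ints: "integrable lborel (symbol \<sigma> 1 :: 'a \<Rightarrow> real)" by (rule integrable_symbol) (use \<sigma> in auto)
  have intP: "integrable lborel (frac_profile \<sigma> :: 'a \<Rightarrow> real)" by (rule integrable_frac_profile[OF \<sigma>])
  have eq: "(LINT x|lborel. frac_profile \<sigma> x * gaussian (e *\<^sub>R (x::'a))) =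
      (LINT \<xi>|lborel. symbol \<sigma> 1 (e *\<^sub>R \<xi>) * gaussian (\<xi>::'a)) / sqrt (2 * pi) ^ ?n"
    if e: "e > 0" for e
  proof -
    let ?F = "\<lambda>x \<xi>::'a. cos (x \<bullet> \<xi>) * symbol \<sigma> 1 \<xi> * gaussian (e *\<^sub>R x)"
    have ig: "integrable lborel (\<lambda>x::'a. gaussian (e *\<^sub>R x))"
      using integrable_lborel_affine[OF integrable_gaussian, of e 0] e by simp
    have int: "integrable (lborel \<Otimes>\<^sub>M lborel) (\<lambda>(x, \<xi>). ?F x \<xi>)"
    proof (rule lborel_pair.Fubini_integrable)
      have "integrable lborel (\<lambda>x::'a. (LINT \<xi>::'a|lborel. symbol \<sigma> 1 \<xi>) * gaussian (e *\<^sub>R x))"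
        using ig by simp
      then show "integrable lborel (\<lambda>x. LINT \<xi>|lborel. norm (case (x, \<xi>) of (x, \<xi>) \<Rightarrow> ?F x \<xi>))"
      proof (rule Bochner_Integration.integrable_bound)
        show "AE x in lborel. norm (LINT \<xi>|lborel. norm (case (x, \<xi>) of (x, \<xi>) \<Rightarrow> ?F x \<xi>))
          \<le> norm ((LINT \<xi>::'a|lborel. symbol \<sigma> 1 \<xi>) * gaussian (e *\<^sub>R x))"
        proof (rule AE_I2)
          fix x :: 'a
          have "(LINT \<xi>|lborel. \<bar>?F x \<xi>\<bar>) \<le> (LINT \<xi>|lborel. symbol \<sigma> 1 (\<xi>::'a) * gaussian (e *\<^sub>R x))"
          proof (rule integral_mono)
            show "integrable lborel (\<lambda>\<xi>. \<bar>?F x \<xi>\<bar>)"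
              using integrable_cos_mult[OF ints, of x] by (intro integrable_abs integrable_mult_left) auto
            show "\<bar>?F x \<xi>\<bar> \<le> symbol \<sigma> 1 \<xi> * gaussian (e *\<^sub>R x)" for \<xi>
              using gaussian_bounds[of "e *\<^sub>R x"] symbol_bounds(1)[of \<sigma> 1 \<xi>]
              by (auto simp: abs_mult intro!: mult_right_mono mult_left_le_one_le)
          qed (use ints in auto)
          then show "norm (LINT \<xi>|lborel. norm (case (x, \<xi>) of (x, \<xi>) \<Rightarrow> ?F x \<xi>))
            \<le> norm ((LINT \<xi>::'a|lborel. symbol \<sigma> 1 \<xi>) * gaussian (e *\<^sub>R x))"
            by simp
        qed
      qed measurable
      show "AE x in lborel. integrable lborel (\<lambda>\<xi>. case (x, \<xi>) of (x, \<xi>) \<Rightarrow> ?F x \<xi>)"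
        using integrable_cos_mult[OF ints] by (intro AE_I2) (simp add: integrable_mult_left)
    qed measurable
    have "(LINT x|lborel. frac_profile \<sigma> x * gaussian (e *\<^sub>R (x::'a))) =
        (LINT x|lborel. (LINT \<xi>|lborel. ?F x \<xi>)) / (2 * pi) ^ ?n"
      by (simp add: frac_profile_def)
    also have "(LINT x|lborel. (LINT \<xi>|lborel. ?F x \<xi>)) = (LINT \<xi>|lborel. (LINT x|lborel. ?F x \<xi>))"
      by (rule lborel_pair.Fubini_integral[OF int, symmetric])
    also have "\<dots> = (LINT \<xi>|lborel. symbol \<sigma> 1 (\<xi>::'a) * ((sqrt (2 * pi) / e) ^ ?n * gaussian ((1 / e) *\<^sub>R \<xi>)))"
    proof (rule Bochner_Integration.integral_cong[OF refl])
      fix \<xi> :: 'a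
      have "(LINT x|lborel. ?F x \<xi>) = (LINT x|lborel. symbol \<sigma> 1 \<xi> * (cos (\<xi> \<bullet> x) * gaussian (e *\<^sub>R x)))"
        by (simp add: mult_ac inner_commute)
      then show "(LINT x|lborel. ?F x \<xi>) = symbol \<sigma> 1 \<xi> * ((sqrt (2 * pi) / e) ^ ?n * gaussian ((1 / e) *\<^sub>R \<xi>))"
        by (simp add: integral_cos_gaussian_scaled[OF e])
    qed
    also have "\<dots> = e ^ ?n * (LINT \<xi>|lborel. symbol \<sigma> 1 (e *\<^sub>R \<xi>) * ((sqrt (2 * pi) / e) ^ ?n * gaussian (\<xi>::'a)))"
    proof -
      have "(1 / e) *\<^sub>R (0 + e *\<^sub>R \<xi>) = \<xi>" for \<xi> :: 'a using e by simp
      then show ?thesis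
        using integral_lborel_affine[of "\<lambda>\<xi>. symbol \<sigma> 1 \<xi> *
            ((sqrt (2 * pi) / e) ^ ?n * gaussian ((1 / e) *\<^sub>R (\<xi>::'a)))" e 0] e
        by (simp only: abs_of_pos real_scaleR_def) simp
    qed
    also have "\<dots> = sqrt (2 * pi) ^ ?n * (LINT \<xi>|lborel. symbol \<sigma> 1 (e *\<^sub>R \<xi>) * gaussian (\<xi>::'a))"
    proof -
      have "(\<lambda>\<xi>::'a. symbol \<sigma> 1 (e *\<^sub>R \<xi>) * ((sqrt (2 * pi) / e) ^ ?n * gaussian \<xi>)) =
          (\<lambda>\<xi>. (sqrt (2 * pi) / e) ^ ?n * (symbol \<sigma> 1 (e *\<^sub>R \<xi>) * gaussian \<xi>))"
        by (simp only: mult.left_commute)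
      then have "(LINT \<xi>|lborel. symbol \<sigma> 1 (e *\<^sub>R \<xi>) * ((sqrt (2 * pi) / e) ^ ?n * gaussian (\<xi>::'a))) =
          (sqrt (2 * pi) / e) ^ ?n * (LINT \<xi>|lborel. symbol \<sigma> 1 (e *\<^sub>R \<xi>) * gaussian (\<xi>::'a))"
        by (simp only: integral_mult_right_zero)
      then show ?thesis using e by (simp add: power_divide)
    qed
    also have "(2 * pi) ^ ?n = (sqrt (2 * pi) * sqrt (2 * pi)) ^ ?n"
      by (simp only: real_sqrt_mult_self) simp
    finally show ?thesis by (simp only: power_mult_distrib[of "sqrt (2 * pi)" "sqrt (2 * pi)"]) simp
  qed
  have lim1: "((\<lambda>e. LINT x|lborel. frac_profile \<sigma> x * gaussian (e *\<^sub>R (x::'a))) \<longlongrightarrow>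
      (LINT x|lborel. frac_profile \<sigma> (x::'a))) (at 0 within {0<..})"
  proof (rule integral_dominated_convergence_within[where w="\<lambda>x. \<bar>frac_profile \<sigma> x\<bar>"])
    have "((\<lambda>e. frac_profile \<sigma> x * gaussian (e *\<^sub>R x)) \<longlongrightarrow> frac_profile \<sigma> x * gaussian (0 *\<^sub>R x)) (at 0 within {0<..})" for x :: 'a
      unfolding gaussian_def by (intro tendsto_intros) auto
    then show "AE x in lborel. ((\<lambda>e. frac_profile \<sigma> x * gaussian (e *\<^sub>R (x::'a))) \<longlongrightarrow> frac_profile \<sigma> x) (at 0 within {0<..})"
      by (simp add: gaussian_def)
  qed (use intP gaussian_bounds in \<open>auto simp: abs_mult less_imp_le intro!: always_eventually mult_right_le_one_le\<close>)
  have lim2: "((\<lambda>e. LINT \<xi>|lborel. symbol \<sigma> 1 (e *\<^sub>R \<xi>) * gaussian (\<xi>::'a)) \<longlongrightarrow>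
      (LINT \<xi>|lborel. gaussian (\<xi>::'a))) (at 0 within {0<..})"
  proof (rule integral_dominated_convergence_within[where w=gaussian])
    have "continuous_on UNIV (\<lambda>e. symbol \<sigma> 1 (e *\<^sub>R \<xi>))" for \<xi> :: 'a
      by (rule continuous_on_compose2[OF continuous_symbol[OF \<sigma>]]) (auto intro!: continuous_intros)
    then have "((\<lambda>e. symbol \<sigma> 1 (e *\<^sub>R \<xi>)) \<longlongrightarrow> symbol \<sigma> 1 (0 *\<^sub>R \<xi>)) (at 0 within {0<..})" for \<xi> :: 'a
      by (meson continuous_on_def tendsto_within_subset subset_UNIV UNIV_I)
    then have "((\<lambda>e. symbol \<sigma> 1 (e *\<^sub>R \<xi>) * gaussian \<xi>) \<longlongrightarrow> symbol \<sigma> 1 (0 *\<^sub>R \<xi>) * gaussian \<xi>) (at 0 within {0<..})" for \<xi> :: 'a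
      by (intro tendsto_mult_right)
    then show "AE \<xi> in lborel. ((\<lambda>e. symbol \<sigma> 1 (e *\<^sub>R \<xi>) * gaussian (\<xi>::'a)) \<longlongrightarrow> gaussian \<xi>) (at 0 within {0<..})"
      using \<sigma> by (simp add: symbol_def)
  qed (auto simp: abs_mult abs_of_pos gaussian_bounds(1) symbol_bounds less_imp_le integrable_gaussian
      intro!: always_eventually mult_left_le_one_le)
  have "(LINT \<xi>|lborel. gaussian (\<xi>::'a)) = sqrt (2 * pi) ^ ?n"
    using integral_cos_gaussian[of "0::'a"] by (simp add: gaussian_def)
  then have "((\<lambda>e. (LINT \<xi>|lborel. symbol \<sigma> 1 (e *\<^sub>R \<xi>) * gaussian (\<xi>::'a)) / sqrt (2 * pi) ^ ?n) \<longlongrightarrow>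
      sqrt (2 * pi) ^ ?n / sqrt (2 * pi) ^ ?n) (at 0 within {0<..})"
    using lim2 by (intro tendsto_divide tendsto_const) auto
  then have "((\<lambda>e. LINT x|lborel. frac_profile \<sigma> x * gaussian (e *\<^sub>R (x::'a))) \<longlongrightarrow> 1) (at 0 within {0<..})"
    by (subst tendsto_cong[of _ "\<lambda>e. (LINT \<xi>|lborel. symbol \<sigma> 1 (e *\<^sub>R \<xi>) * gaussian (\<xi>::'a)) / sqrt (2 * pi) ^ ?n"])
      (auto simp: eventually_at_filter eq intro!: always_eventually)
  with lim1 show ?thesis
    by (rule tendsto_unique[OF trivial_limit_at_right_real])
qed

section \<open>Convolutions\<close>

text \<open>Minkowski's integral inequality in \<open>L\<^sup>1\<close>.\<close>

lemma L1_integral_le: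
  fixes g :: "'b::euclidean_space \<Rightarrow> 'a::euclidean_space \<Rightarrow> real"
  assumes [measurable]: "case_prod g \<in> borel_measurable (borel \<Otimes>\<^sub>M borel)"
    and h: "integrable lborel h"
    and g: "\<And>z. integrable lborel (g z)" "\<And>z. (LINT x|lborel. \<bar>g z x\<bar>) \<le> h z"
  shows "integrable lborel (\<lambda>x. LINT z|lborel. g z x)"
    and "(LINT x|lborel. \<bar>LINT z|lborel. g z x\<bar>) \<le> (LINT z|lborel. h z)"
    and "AE x in lborel. integrable lborel (\<lambda>z. g z x)"
proof -
  have nn: "(LINT x|lborel. \<bar>g z x\<bar>) \<ge> 0" for z by (intro integral_nonneg_AE) auto
  have ig: "integrable lborel (\<lambda>z. LINT x|lborel. \<bar>g z x\<bar>)"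
  proof (rule Bochner_Integration.integrable_bound[OF h])
    show "AE z in lborel. norm (LINT x|lborel. \<bar>g z x\<bar>) \<le> norm (h z)"
      using g(2) nn by (intro AE_I2) (auto intro: order_trans[OF _ abs_ge_self])
  qed measurable
  have int: "integrable (lborel \<Otimes>\<^sub>M lborel) (case_prod g)"
    by (rule lborel_pair.Fubini_integrable) (use ig g in \<open>auto simp: case_prod_beta'\<close>)
  then show i: "integrable lborel (\<lambda>x. LINT z|lborel. g z x)"
    using lborel_pair.integrable_snd[of "\<lambda>x y. g x y"] by simp
  show "AE x in lborel. integrable lborel (\<lambda>z. g z x)"
    using lborel_pair.AE_integrable_snd[OF int] by simp
  have int': "integrable (lborel \<Otimes>\<^sub>M lborel) (\<lambda>(z, x). \<bar>g z x\<bar>)"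
    using integrable_abs[OF int] by (simp add: case_prod_beta')
  have "(LINT x|lborel. \<bar>LINT z|lborel. g z x\<bar>) \<le> (LINT x|lborel. LINT z|lborel. \<bar>g z x\<bar>)"
    using i lborel_pair.integrable_snd[OF int'] by (intro integral_mono) auto
  also have "\<dots> = (LINT z|lborel. LINT x|lborel. \<bar>g z x\<bar>)"
    by (rule lborel_pair.Fubini_integral[OF int'])
  also have "\<dots> \<le> (LINT z|lborel. h z)"
    by (intro integral_mono ig h g)
  finally show "(LINT x|lborel. \<bar>LINT z|lborel. g z x\<bar>) \<le> (LINT z|lborel. h z)" .
qed

definition conv :: "('a::euclidean_space \<Rightarrow> real) \<Rightarrow> ('a \<Rightarrow> real) \<Rightarrow> 'a \<Rightarrow> real" where
  "conv k f x = (LINT y|lborel. k (x - y) * f y)"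

lemma borel_measurable_conv [measurable]:
  assumes [measurable]: "k \<in> borel_measurable borel" "f \<in> borel_measurable borel"
  shows "conv k f \<in> borel_measurable borel"
  unfolding conv_def[abs_def] by measurable

lemma conv_commute:
  assumes [measurable]: "k \<in> borel_measurable borel" "f \<in> borel_measurable borel"
  shows "conv k f x = (LINT y|lborel. k y * f (x - y))"
  unfolding conv_def
  using integral_lborel_reflect(1)[of "\<lambda>y. k y * f (x - y)" x] by simp

lemma integrable_mult_bounded:
  fixes k f :: "'a \<Rightarrow> real"
  assumes k: "integrable M k" and [measurable]: "f \<in> borel_measurable M" and f: "\<And>y. \<bar>f y\<bar> \<le> m"
  shows "integrable M (\<lambda>y. k y * f y)" "\<bar>LINT y|M. k y * f y\<bar> \<le> m * (LINT y|M. \<bar>k y\<bar>)"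
proof -
  have le: "\<bar>k y * f y\<bar> \<le> m * \<bar>k y\<bar>" for y
    using f[of y] by (simp add: abs_mult mult.commute mult_right_mono)
  show i: "integrable M (\<lambda>y. k y * f y)"
    by (rule Bochner_Integration.integrable_bound[of _ "\<lambda>y. m * \<bar>k y\<bar>"])
      (use k order_trans[OF le abs_ge_self] in auto)
  have "\<bar>LINT y|M. k y * f y\<bar> \<le> (LINT y|M. \<bar>k y * f y\<bar>)" by (rule integral_abs_bound)
  also have "\<dots> \<le> (LINT y|M. m * \<bar>k y\<bar>)"
    using i k le by (intro integral_mono) auto
  finally show "\<bar>LINT y|M. k y * f y\<bar> \<le> m * (LINT y|M. \<bar>k y\<bar>)" by simp
qed

lemma conv_bounded:
  assumes k: "integrable lborel k" and [measurable]: "f \<in> borel_measurable borel" and f: "\<And>y. \<bar>f y\<bar> \<le> m"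
  shows "\<bar>conv k f x\<bar> \<le> m * (LINT y|lborel. \<bar>k y\<bar>)" "integrable lborel (\<lambda>y. k (x - y) * f y)"
proof -
  have "(LINT y|lborel. \<bar>k (x - y)\<bar>) = (LINT y|lborel. \<bar>k y\<bar>)"
    using k by (intro integral_lborel_reflect(1)[of "\<lambda>y. \<bar>k y\<bar>"]) auto
  then show "\<bar>conv k f x\<bar> \<le> m * (LINT y|lborel. \<bar>k y\<bar>)" "integrable lborel (\<lambda>y. k (x - y) * f y)"
    using integrable_mult_bounded[OF integrable_lborel_reflect(1)[OF k, of x], of f m] f
    by (simp_all add: conv_def)
qed

lemma conv_bounded':
  assumes [measurable]: "k \<in> borel_measurable borel" and k: "\<And>y. \<bar>k y\<bar> \<le> m" and f: "integrable lborel f"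
  shows "\<bar>conv k f x\<bar> \<le> m * (LINT y|lborel. \<bar>f y\<bar>)"
  using integrable_mult_bounded(2)[OF f, of "\<lambda>y. k (x - y)" m] k
  by (simp add: conv_def mult.commute)

lemma conv_L1:
  fixes k f :: "'a::euclidean_space \<Rightarrow> real"
  assumes k: "integrable lborel k" and f: "integrable lborel f"
  shows "integrable lborel (conv k f)"
    and "(LINT x|lborel. \<bar>conv k f x\<bar>) \<le> (LINT y|lborel. \<bar>k y\<bar>) * (LINT y|lborel. \<bar>f y\<bar>)"
proof -
  have [measurable]: "k \<in> borel_measurable borel" "f \<in> borel_measurable borel" using k f by auto
  have eq: "(LINT x|lborel. \<bar>k (x - y) * f y\<bar>) = (LINT y|lborel. \<bar>k y\<bar>) * \<bar>f y\<bar>" for y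
    using integral_lborel_reflect(2)[of "\<lambda>y. \<bar>k y\<bar>" y] by (simp add: abs_mult)
  have m: "(\<lambda>(y, x). k (x - y) * f y) \<in> borel_measurable (borel \<Otimes>\<^sub>M borel)" by measurable
  note L1 = L1_integral_le[of "\<lambda>y x. k (x - y) * f y" "\<lambda>y. (LINT y|lborel. \<bar>k y\<bar>) * \<bar>f y\<bar>"]
  show "integrable lborel (conv k f)"
    unfolding conv_def[abs_def]
    using m k f integrable_lborel_reflect(2)[OF k] by (intro L1(1)) (auto simp: eq)
  have "(LINT x|lborel. \<bar>conv k f x\<bar>) \<le> (LINT y|lborel. (LINT y|lborel. \<bar>k y\<bar>) * \<bar>f y\<bar>)"
    unfolding conv_def[abs_def]
    using m k f integrable_lborel_reflect(2)[OF k] by (intro L1(2)) (auto simp: eq)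
  then show "(LINT x|lborel. \<bar>conv k f x\<bar>) \<le> (LINT y|lborel. \<bar>k y\<bar>) * (LINT y|lborel. \<bar>f y\<bar>)"
    by simp
qed

lemma conv_diff_right:
  assumes "integrable lborel k" "\<And>y. \<bar>f y\<bar> \<le> m" "\<And>y. \<bar>g y\<bar> \<le> m'"
    and [measurable]: "f \<in> borel_measurable borel" "g \<in> borel_measurable borel"
  shows "conv k (\<lambda>y. f y - g y) x = conv k f x - conv k g x"
  using conv_bounded(2)[OF assms(1,4,2), of x] conv_bounded(2)[OF assms(1,5,3), of x]
  by (simp add: conv_def right_diff_distrib)

lemma conv_diff_left:
  assumes "integrable lborel k" "integrable lborel l" "\<And>y. \<bar>f y\<bar> \<le> m"
    and [measurable]: "f \<in> borel_measurable borel"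
  shows "conv (\<lambda>y. k y - l y) f x = conv k f x - conv l f x"
  using conv_bounded(2)[OF assms(1,4,3), of x] conv_bounded(2)[OF assms(2,4,3), of x]
  by (simp add: conv_def left_diff_distrib)

lemma conv_cmult_left: "conv (\<lambda>y. c * k y) f x = c * conv k f x"
  by (simp add: conv_def mult.assoc)

lemma conv_cong_AE:
  assumes "AE y in lborel. f y = g y" and [measurable]: "k \<in> borel_measurable borel" "f \<in> borel_measurable borel" "g \<in> borel_measurable borel"
  shows "conv k f x = conv k g x"
  unfolding conv_def by (intro integral_cong_AE) (use assms(1) in auto)

section \<open>Self-similar kernels\<close>

text \<open>
  All that is used of the fractional heat kernel below: it arises by scaling from one
  profile \<open>P\<close> of mass \<open>1\<close>, which is continuous and has an integrable majorant.  The scaling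
  exponent \<open>s\<close> stands for \<open>2 \<sigma>\<close>.
\<close>

locale selfsimilar_kernel =
  fixes P :: "'a::euclidean_space \<Rightarrow> real" and s B d :: real
  assumes s: "s > 0" and d: "d > 0" and B: "B > 0"
    and P_continuous: "continuous_on UNIV P"
    and P_decay: "\<And>x. \<bar>P x\<bar> \<le> B * (1 + norm x) powr (- (real DIM('a) + d))"
    and P_mass: "(LINT x|lborel. P x) = 1"
begin

definition "\<gamma> = real DIM('a) / s"
definition "K t x = t powr (- \<gamma>) * P (t powr (- 1 / s) *\<^sub>R x)"
definition "L = (LINT x|lborel. \<bar>P x\<bar>)"

lemma \<gamma>: "\<gamma> > 0" using s by (simp add: \<gamma>_def)

lemma P_measurable [measurable]: "P \<in> borel_measurable borel"
  by (rule borel_measurable_continuous_onI[OF P_continuous])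

lemma K_measurable [measurable]:
  assumes [measurable]: "f \<in> borel_measurable M" "g \<in> borel_measurable M"
  shows "(\<lambda>x. K (f x) (g x)) \<in> borel_measurable M"
  unfolding K_def by measurable

lemma P_bounded: "\<bar>P x\<bar> \<le> B"
proof -
  have "(1 + norm x) powr (- (real DIM('a) + d)) \<le> 1 powr (- (real DIM('a) + d))"
    using d by (intro powr_mono2') auto
  then have "B * (1 + norm x) powr (- (real DIM('a) + d)) \<le> B * 1"
    using B by (intro mult_left_mono) auto
  then show ?thesis using P_decay[of x] by linarith
qed

lemma P_integrable: "integrable lborel P"
proof (rule Bochner_Integration.integrable_bound)
  show "integrable lborel (\<lambda>x::'a. B * (1 + norm x) powr (- (real DIM('a) + d)))"
    using d by (intro integrable_mult_right integrable_one_plus_norm_powr) auto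
  show "AE x in lborel. norm (P x) \<le> norm (B * (1 + norm x) powr (- (real DIM('a) + d)))"
    using order_trans[OF P_decay abs_ge_self] by (intro AE_I2) (simp only: real_norm_def)
qed measurable

lemma L_ge_1: "L \<ge> 1"
  using integral_abs_bound[of lborel P] P_mass by (simp add: L_def)

lemma K_bounded: "\<bar>K t x\<bar> \<le> B * t powr (- \<gamma>)"
proof -
  have "\<bar>K t x\<bar> = t powr (- \<gamma>) * \<bar>P (t powr (- 1 / s) *\<^sub>R x)\<bar>" by (simp add: K_def abs_mult)
  also have "\<dots> \<le> t powr (- \<gamma>) * B" by (intro mult_left_mono P_bounded) auto
  finally show ?thesis by (simp add: mult.commute)
qed

lemma K_integrable: "t > 0 \<Longrightarrow> integrable lborel (K t)"
  unfolding K_def using integrable_lborel_affine[OF P_integrable, of "t powr (- 1 / s)" 0] by simp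

lemma scale_DIM: "t > 0 \<Longrightarrow> (t powr (1 / s)) ^ DIM('a) = t powr \<gamma>"
  by (subst powr_power) (auto simp: \<gamma>_def)

lemma K_L1: "t > 0 \<Longrightarrow> (LINT x|lborel. \<bar>K t x\<bar>) = L"
  using integral_lborel_affine[of "\<lambda>x. \<bar>K t x\<bar>" "t powr (1 / s)" 0] scale_DIM[of t]
  by (simp add: K_def L_def abs_mult powr_add[symmetric] mult.assoc[symmetric])

lemma conv_K_eq:
  assumes t: "t > 0" and [measurable]: "f \<in> borel_measurable borel"
  shows "conv (K t) f x = (LINT z|lborel. P z * f (x - t powr (1 / s) *\<^sub>R z))"
proof -
  have "conv (K t) f x = (LINT y|lborel. K t y * f (x - y))"
    by (rule conv_commute) measurable
  also have "\<dots> = (LINT z|lborel. P z * f (x - t powr (1 / s) *\<^sub>R z))"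
    using t scale_DIM[OF t]
    by (subst integral_lborel_affine[of _ "t powr (1 / s)" 0])
       (simp_all add: K_def powr_add[symmetric] mult.assoc[symmetric] flip: integral_mult_right_zero)
  finally show ?thesis .
qed

definition S :: "real \<Rightarrow> ('a \<Rightarrow> real) \<Rightarrow> 'a \<Rightarrow> real" where
  "S t f x = (if t = 0 then f x else conv (K t) f x)"

lemma S_eq:
  assumes "t \<ge> 0" "f \<in> borel_measurable borel"
  shows "S t f x = (LINT z|lborel. P z * f (x - t powr (1 / s) *\<^sub>R z))"
  using conv_K_eq[of t f x] assms P_mass by (cases "t = 0") (auto simp: S_def)

lemma S_bounded:
  assumes "t \<ge> 0" and [measurable]: "f \<in> borel_measurable borel" and "\<And>y. \<bar>f y\<bar> \<le> m"
  shows "\<bar>S t f x\<bar> \<le> m * L"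
  unfolding S_eq[OF assms(1,2)] L_def
  by (rule integrable_mult_bounded(2)[OF P_integrable]) (use assms in auto)

lemma S_bounded_L1:
  assumes "t > 0" "integrable lborel f"
  shows "\<bar>S t f x\<bar> \<le> B * t powr (- \<gamma>) * (LINT x|lborel. \<bar>f x\<bar>)"
  using conv_bounded'[of "K t", OF _ K_bounded assms(2)] assms(1) by (simp add: S_def)

lemma S_L1:
  assumes "t \<ge> 0" "integrable lborel f"
  shows "integrable lborel (S t f)" "(LINT x|lborel. \<bar>S t f x\<bar>) \<le> L * (LINT x|lborel. \<bar>f x\<bar>)"
proof -
  have "1 * (LINT x|lborel. \<bar>f x\<bar>) \<le> L * (LINT x|lborel. \<bar>f x\<bar>)"
    using L_ge_1 by (intro mult_right_mono integral_nonneg_AE) auto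
  then show "integrable lborel (S t f)" "(LINT x|lborel. \<bar>S t f x\<bar>) \<le> L * (LINT x|lborel. \<bar>f x\<bar>)"
    using conv_L1[OF K_integrable assms(2), of t] K_L1[of t] assms
    by (cases "t = 0"; simp add: S_def[abs_def])+
qed

text \<open>
  After the substitution \<open>y = x - t\<^sup>1\<^sup>/\<^sup>s z\<close> the dependence on \<open>t\<close> sits in a translation of
  \<open>f\<close> only, and \<open>t = 0\<close> is no exception.
\<close>

lemma S_L1_continuous:
  assumes f: "integrable lborel f" and M: "\<And>y. \<bar>f y\<bar> \<le> m" and t: "t \<ge> 0"
  shows "((\<lambda>r. LINT x|lborel. \<bar>S r f x - S t f x\<bar>) \<longlongrightarrow> 0) (at t within {0..})"
proof -
  have [measurable]: "f \<in> borel_measurable borel" using f by auto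
  let ?a = "\<lambda>r. r powr (1 / s)"
  let ?osc = "\<lambda>h. LINT x|lborel. \<bar>f (x - h) - f x\<bar>"
  have osc_le: "?osc h \<le> 2 * (LINT x|lborel. \<bar>f x\<bar>)" for h
  proof -
    have "?osc h \<le> (LINT x|lborel. \<bar>f (x - h)\<bar> + \<bar>f x\<bar>)"
      using f integrable_lborel_reflect(2)[OF f, of h] by (intro integral_mono) auto
    also have "\<dots> = 2 * (LINT x|lborel. \<bar>f x\<bar>)"
      using f integrable_lborel_reflect(2)[OF f, of h] integral_lborel_reflect(2)[of "\<lambda>x. \<bar>f x\<bar>" h] by simp
    finally show ?thesis .
  qed
  have osc_nn: "?osc h \<ge> 0" for h by (intro integral_nonneg_AE) auto
  have [measurable]: "?osc \<in> borel_measurable borel" by measurable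
  have le: "(LINT x|lborel. \<bar>S r f x - S t f x\<bar>) \<le> (LINT z|lborel. \<bar>P z\<bar> * ?osc ((?a r - ?a t) *\<^sub>R z))"
    if r: "r \<ge> 0" for r
  proof -
    have eq: "S r f x - S t f x = (LINT z|lborel. P z * (f (x - ?a r *\<^sub>R z) - f (x - ?a t *\<^sub>R z)))" for x
      unfolding S_eq[OF r \<open>f \<in> _\<close>] S_eq[OF t \<open>f \<in> _\<close>] right_diff_distrib
      by (intro Bochner_Integration.integral_diff[symmetric] integrable_mult_bounded(1)[OF P_integrable, of _ m]) (use M in auto)
    have o: "(LINT x|lborel. \<bar>P z * (f (x - ?a r *\<^sub>R z) - f (x - ?a t *\<^sub>R z))\<bar>) = \<bar>P z\<bar> * ?osc ((?a r - ?a t) *\<^sub>R z)" for z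
      using integral_lborel_reflect(2)[of "\<lambda>x. \<bar>f (x - (?a r - ?a t) *\<^sub>R z) - f x\<bar>" "?a t *\<^sub>R z"]
      by (simp add: abs_mult scaleR_left_diff_distrib)
    show ?thesis unfolding eq
    proof (rule L1_integral_le(2))
      show "integrable lborel (\<lambda>z. \<bar>P z\<bar> * ?osc ((?a r - ?a t) *\<^sub>R z))"
        using osc_le osc_nn by (intro integrable_mult_bounded(1)[of _ _ _ "2 * (LINT x|lborel. \<bar>f x\<bar>)"] integrable_abs P_integrable) auto
      show "integrable lborel (\<lambda>x. P z * (f (x - ?a r *\<^sub>R z) - f (x - ?a t *\<^sub>R z)))" for z
        using integrable_lborel_reflect(2)[OF f] by auto
    qed (use o in auto)
  qed
  have "((\<lambda>r. LINT z|lborel. \<bar>P z\<bar> * ?osc ((?a r - ?a t) *\<^sub>R z)) \<longlongrightarrow> (LINT z|(lborel::'a measure). 0)) (at t within {0..})"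
  proof (rule integral_dominated_convergence_within[where w="\<lambda>z. \<bar>P z\<bar> * (2 * (LINT x|lborel. \<bar>f x\<bar>))"])
    have a: "(?a \<longlongrightarrow> ?a t) (at t within {0..})"
      using continuous_on_powr'[of "{0..}" "\<lambda>r. r" "\<lambda>_. 1 / s"] s t by (simp add: continuous_on_def)
    have "((\<lambda>r. \<bar>P z\<bar> * ?osc ((?a r - ?a t) *\<^sub>R z)) \<longlongrightarrow> \<bar>P z\<bar> * 0) (at t within {0..})" for z
    proof (intro tendsto_mult_left filterlim_compose[OF L1_translation[OF f]])
      show "((\<lambda>r. (?a r - ?a t) *\<^sub>R z) \<longlongrightarrow> 0) (at t within {0..})"
        using tendsto_scaleR[OF tendsto_diff[OF a tendsto_const[of "?a t"]] tendsto_const[of z]] by simp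
    qed
    then show "AE z in lborel. ((\<lambda>r. \<bar>P z\<bar> * ?osc ((?a r - ?a t) *\<^sub>R z)) \<longlongrightarrow> 0) (at t within {0..})" by simp
    show "integrable lborel (\<lambda>z. \<bar>P z\<bar> * (2 * (LINT x|lborel. \<bar>f x\<bar>)))"
      using P_integrable by auto
  qed (use osc_le osc_nn in \<open>auto simp: abs_mult intro!: always_eventually mult_left_mono\<close>)
  then have lim: "((\<lambda>r. LINT z|lborel. \<bar>P z\<bar> * ?osc ((?a r - ?a t) *\<^sub>R z)) \<longlongrightarrow> 0) (at t within {0..})" by simp
  show ?thesis
    by (rule tendsto_sandwich[OF _ _ tendsto_const lim])
      (use le in \<open>auto simp: eventually_at_filter intro!: always_eventually integral_nonneg_AE\<close>)
qed

text \<open>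
  The displacement \<open>t\<^sup>1\<^sup>/\<^sup>s z\<close> is small except for large \<open>z\<close>, which carry little of the mass of \<open>P\<close>.
\<close>

lemma S_uniform_at_0:
  assumes u: "uniformly_continuous_on UNIV f" and M: "\<And>y. \<bar>f y\<bar> \<le> m" and e: "e > 0"
  shows "\<forall>\<^sub>F t in at_right 0. \<forall>x. \<bar>S t f x - f x\<bar> \<le> e"
proof -
  have [measurable]: "f \<in> borel_measurable borel"
    using uniformly_continuous_imp_continuous[OF u] by (rule borel_measurable_continuous_onI)
  have m: "m \<ge> 0" using M[of 0] by linarith
  have L: "L > 0" using L_ge_1 by linarith
  obtain \<delta> where \<delta>: "\<delta> > 0" "\<And>x y. dist x y < \<delta> \<Longrightarrow> dist (f x) (f y) < e / (2 * L)"
    using u e L unfolding uniformly_continuous_on_def by (metis UNIV_I divide_pos_pos mult_pos_pos zero_less_numeral)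
  let ?a = "\<lambda>t. t powr (1 / s)"
  let ?T = "\<lambda>t. LINT z|lborel. \<bar>P z\<bar> * (2 * m * indicator {z. norm (?a t *\<^sub>R z) \<ge> \<delta>} z)"
  have a: "(?a \<longlongrightarrow> 0) (at_right 0)" using s by real_asymp
  have "(?T \<longlongrightarrow> (LINT z|(lborel::'a measure). 0)) (at_right 0)"
  proof (rule integral_dominated_convergence_within[where w="\<lambda>z. \<bar>P z\<bar> * (2 * m)"])
    have "((\<lambda>t. \<bar>P z\<bar> * (2 * m * indicator {z. norm (?a t *\<^sub>R z) \<ge> \<delta>} z)) \<longlongrightarrow> 0) (at_right 0)" for z
    proof (rule tendsto_eventually)
      have "((\<lambda>t. norm (?a t *\<^sub>R z)) \<longlongrightarrow> norm (0 *\<^sub>R z)) (at_right 0)" by (intro tendsto_intros a)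
      then have "\<forall>\<^sub>F t in at_right 0. norm (?a t *\<^sub>R z) < \<delta>" using \<delta> by (intro order_tendstoD(2)) auto
      then show "\<forall>\<^sub>F t in at_right 0. \<bar>P z\<bar> * (2 * m * indicator {z. norm (?a t *\<^sub>R z) \<ge> \<delta>} z) = 0"
        by eventually_elim auto
    qed
    then show "AE z in lborel. ((\<lambda>t. \<bar>P z\<bar> * (2 * m * indicator {z. norm (?a t *\<^sub>R z) \<ge> \<delta>} z)) \<longlongrightarrow> 0) (at_right 0)"
      by simp
  qed (use P_integrable m in \<open>auto simp: abs_mult indicator_def intro!: always_eventually mult_left_mono\<close>)
  then have "(?T \<longlongrightarrow> 0) (at_right 0)" by simp
  then have "\<forall>\<^sub>F t in at_right 0. ?T t < e / 2" using e by (intro order_tendstoD(2)) auto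
  moreover have "\<forall>\<^sub>F t in at_right (0::real). t > 0" by (simp add: eventually_at_filter)
  ultimately show ?thesis
  proof eventually_elim
    case (elim t)
    show ?case
    proof
      fix x
      have i1: "integrable lborel (\<lambda>z. P z * f (x - ?a t *\<^sub>R z))"
        by (rule integrable_mult_bounded(1)[OF P_integrable, of _ m]) (use M in auto)
      have i2: "integrable lborel (\<lambda>z. \<bar>P z\<bar> * (2 * m * indicator {z. norm (?a t *\<^sub>R z) \<ge> \<delta>} z))"
        by (rule integrable_mult_bounded(1)[OF integrable_abs[OF P_integrable], of _ "2 * m"]) (use m in \<open>auto simp: indicator_def\<close>)
      have "S t f x - f x = (LINT z|lborel. P z * f (x - ?a t *\<^sub>R z)) - (LINT z|lborel. P z * f x)"
        using P_mass elim by (subst S_eq) auto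
      also have "\<dots> = (LINT z|lborel. P z * f (x - ?a t *\<^sub>R z) - P z * f x)"
        using i1 P_integrable by simp
      finally have "\<bar>S t f x - f x\<bar> \<le> (LINT z|lborel. \<bar>P z * f (x - ?a t *\<^sub>R z) - P z * f x\<bar>)"
        using integral_abs_bound by simp
      also have "\<dots> \<le> (LINT z|lborel. \<bar>P z\<bar> * (e / (2 * L)) + \<bar>P z\<bar> * (2 * m * indicator {z. norm (?a t *\<^sub>R z) \<ge> \<delta>} z))"
      proof (rule integral_mono)
        fix z
        have "\<bar>f (x - ?a t *\<^sub>R z) - f x\<bar> \<le> e / (2 * L) + 2 * m * indicator {z. norm (?a t *\<^sub>R z) \<ge> \<delta>} z"
        proof (cases "norm (?a t *\<^sub>R z) \<ge> \<delta>")
          case True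
          have "\<bar>f (x - ?a t *\<^sub>R z) - f x\<bar> \<le> 2 * m" using M[of x] M[of "x - ?a t *\<^sub>R z"] by linarith
          moreover have "e / (2 * L) > 0" using e L by simp
          ultimately show ?thesis using True by simp
        next
          case False
          then show ?thesis using \<delta>(2)[of "x - ?a t *\<^sub>R z" x] by (simp add: dist_norm)
        qed
        then have "\<bar>P z\<bar> * \<bar>f (x - ?a t *\<^sub>R z) - f x\<bar> \<le> \<bar>P z\<bar> * (e / (2 * L) + 2 * m * indicator {z. norm (?a t *\<^sub>R z) \<ge> \<delta>} z)"
          by (rule mult_left_mono) auto
        then show "\<bar>P z * f (x - ?a t *\<^sub>R z) - P z * f x\<bar> \<le> \<bar>P z\<bar> * (e / (2 * L)) + \<bar>P z\<bar> * (2 * m * indicator {z. norm (?a t *\<^sub>R z) \<ge> \<delta>} z)"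
          by (simp only: right_diff_distrib[symmetric] abs_mult distrib_left[symmetric])
      qed (use i1 i2 P_integrable in auto)
      also have "\<dots> = L * (e / (2 * L)) + ?T t"
        using i2 P_integrable by (simp add: L_def)
      also have "\<dots> \<le> e" using elim L by (simp add: field_simps)
      finally show "\<bar>S t f x - f x\<bar> \<le> e" .
    qed
  qed
qed

text \<open>On a neighbourhood of \<open>t > 0\<close> the decay of the profile provides a common majorant \<open>w\<close>.\<close>

lemma K_L1_continuous:
  assumes t: "t > 0"
  shows "((\<lambda>r. LINT x|lborel. \<bar>K r x - K t x\<bar>) \<longlongrightarrow> 0) (at t)"
proof -
  define k where "k = real DIM('a) + d"
  have k: "k > 0" using d by (simp add: k_def add_pos_pos)
  define c where "c = min 1 ((2 * t) powr (- 1 / s))"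
  have c: "0 < c" "c \<le> 1" using t by (auto simp: c_def)
  define w where "w = (\<lambda>x::'a. (t / 2) powr (- \<gamma>) * (B * (c powr (- k) * (1 + norm x) powr (- k))))"
  have iw: "integrable lborel w"
    unfolding w_def k_def by (intro integrable_mult_right integrable_one_plus_norm_powr d)
  have Kw: "\<bar>K r x\<bar> \<le> w x" if r: "t / 2 < r" "r < 2 * t" for r x
  proof -
    have r0: "r > 0" using r t by linarith
    have "c \<le> r powr (- 1 / s)"
      using r r0 s t unfolding c_def by (intro min.coboundedI2 powr_mono2') auto
    then have "c * (1 + norm x) \<le> 1 + norm (r powr (- 1 / s) *\<^sub>R x)"
      using c mult_right_mono[of c "r powr (- 1 / s)" "norm x"] by (simp add: distrib_left)
    then have "(1 + norm (r powr (- 1 / s) *\<^sub>R x)) powr (- k) \<le> (c * (1 + norm x)) powr (- k)"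
      using c k by (intro powr_mono2') (auto simp: add_pos_nonneg)
    also have "\<dots> = c powr (- k) * (1 + norm x) powr (- k)" using c by (simp add: powr_mult)
    finally have "\<bar>P (r powr (- 1 / s) *\<^sub>R x)\<bar> \<le> B * (c powr (- k) * (1 + norm x) powr (- k))"
      using P_decay[of "r powr (- 1 / s) *\<^sub>R x"] B unfolding k_def by (meson mult_left_mono less_imp_le order_trans)
    moreover have "r powr (- \<gamma>) \<le> (t / 2) powr (- \<gamma>)"
      using r t \<gamma> by (intro powr_mono2') auto
    ultimately show ?thesis
      unfolding w_def K_def abs_mult using B by (intro mult_mono) auto
  qed
  have ev: "\<forall>\<^sub>F r in at t. t / 2 < r \<and> r < 2 * t"
    using t eventually_at_in_open[of "{t/2<..<2*t}" t] by (auto elim: eventually_mono)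
  have "((\<lambda>r. LINT x|lborel. \<bar>K r x - K t x\<bar>) \<longlongrightarrow> (LINT x|(lborel :: 'a measure). 0)) (at t)"
  proof (rule integral_dominated_convergence_within[where w="\<lambda>x. 2 * w x"])
    show "\<forall>\<^sub>F r in at t. (\<lambda>x. \<bar>K r x - K t x\<bar>) \<in> borel_measurable lborel \<and> (AE x in lborel. norm \<bar>K r x - K t x\<bar> \<le> 2 * w x)"
      using ev
    proof eventually_elim
      case (elim r)
      have "\<bar>K r x - K t x\<bar> \<le> 2 * w x" for x using Kw[of r x] Kw[of t x] elim t by linarith
      then show ?case by simp
    qed
    have "((\<lambda>r. \<bar>K r x - K t x\<bar>) \<longlongrightarrow> \<bar>K t x - K t x\<bar>) (at t)" for x
    proof (intro tendsto_intros)
      have "isCont P y" for y using P_continuous by (simp add: continuous_on_eq_continuous_at)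
      then show "((\<lambda>r. K r x) \<longlongrightarrow> K t x) (at t)"
        unfolding K_def using t by (intro tendsto_mult isCont_tendsto_compose[of _ P] tendsto_intros) auto
    qed
    then show "AE x in lborel. ((\<lambda>r. \<bar>K r x - K t x\<bar>) \<longlongrightarrow> 0) (at t)" by simp
  qed (use iw in auto)
  then show ?thesis by simp
qed

end

section \<open>The Duhamel integral\<close>

lemma measurable_case_prod_compose:
  assumes "case_prod b \<in> borel_measurable (borel \<Otimes>\<^sub>M borel)" "f \<in> borel_measurable M" "g \<in> borel_measurable M"
  shows "(\<lambda>x. b (f x) (g x)) \<in> borel_measurable M"
  using measurable_compose[OF measurable_Pair[OF assms(2,3)] assms(1)] by simp

lemma measurable_case_prod_section:
  assumes "case_prod b \<in> borel_measurable (borel \<Otimes>\<^sub>M borel)"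
  shows "b t \<in> borel_measurable borel"
  using measurable_case_prod_compose[OF assms, of "\<lambda>_. t" borel "\<lambda>x. x"] by simp

context selfsimilar_kernel
begin

definition coeff :: "(real \<Rightarrow> real) \<Rightarrow> bool" where
  "coeff \<kappa> \<longleftrightarrow> continuous_on {0..} \<kappa> \<and> (\<forall>t\<ge>0. \<bar>\<kappa> t\<bar> \<le> 1) \<and> \<kappa> \<in> borel_measurable borel"

text \<open>
  The kernels \<open>H\<close> vanish for negative time, so that a Duhamel integral over \<open>[0, t]\<close> is
  one over the whole line.  For two values of \<open>t\<close> the integrals then differ by the kernels only, and
  \<open>hosc\<close>, integrated over time in \<open>hmod\<close> below, is a modulus of continuity for all sources at once.
\<close>

definition "H \<kappa> \<tau> x = (if \<tau> > 0 then \<kappa> \<tau> * K \<tau> x else 0)"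

definition "hosc \<kappa> r \<tau> = (LINT x|lborel. \<bar>H \<kappa> r x - H \<kappa> \<tau> x\<bar>)"

text \<open>\<open>D\<close> is the Duhamel integral of the source \<open>b\<close> with coefficient \<open>\<kappa>\<close>, and \<open>G\<close> its integrand.\<close>

definition "G \<kappa> b t \<tau> x = (if 0 \<le> \<tau> then conv (H \<kappa> (t - \<tau>)) (b \<tau>) x else 0)"

definition "D \<kappa> b t x = (LINT \<tau>|lborel. G \<kappa> b t \<tau> x)"

text \<open>
  The two classes between which the Duhamel operator acts: the solutions decay like the
  kernel, and their powers gain the integrable factor \<open>(1 + \<tau>)\<^sup>-\<^sup>k\<close>.
\<close>

definition decaying :: "real \<Rightarrow> (real \<Rightarrow> 'a \<Rightarrow> real) \<Rightarrow> bool" where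
  "decaying M w \<longleftrightarrow> case_prod w \<in> borel_measurable (borel \<Otimes>\<^sub>M borel) \<and>
     (\<forall>t\<ge>0. (\<forall>x. \<bar>w t x\<bar> \<le> M * (1 + t) powr (- \<gamma>)) \<and> integrable lborel (w t) \<and> (LINT x|lborel. \<bar>w t x\<bar>) \<le> M)"

definition source :: "real \<Rightarrow> real \<Rightarrow> (real \<Rightarrow> 'a \<Rightarrow> real) \<Rightarrow> bool" where
  "source k A b \<longleftrightarrow> case_prod b \<in> borel_measurable (borel \<Otimes>\<^sub>M borel) \<and>
     (\<forall>t\<ge>0. (\<forall>x. \<bar>b t x\<bar> \<le> A * ((1 + t) powr (- \<gamma>) * (1 + t) powr (- k))) \<and> integrable lborel (b t) \<and>
        (LINT x|lborel. \<bar>b t x\<bar>) \<le> A * (1 + t) powr (- k))"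

lemma source_nonneg: "source k A b \<Longrightarrow> A \<ge> 0"
proof -
  assume "source k A b"
  then have "(LINT x|lborel. \<bar>b 0 x\<bar>) \<le> A" by (auto simp: source_def dest!: spec[of _ 0])
  moreover have "0 \<le> (LINT x|lborel. \<bar>b 0 x\<bar>)" by (intro integral_nonneg_AE) auto
  ultimately show "A \<ge> 0" by linarith
qed

lemma coeff_measurable: "coeff \<kappa> \<Longrightarrow> \<kappa> \<in> borel_measurable borel"
  by (simp add: coeff_def)

lemma H_measurable:
  assumes "coeff \<kappa>" and [measurable]: "f \<in> borel_measurable M" "g \<in> borel_measurable M"
  shows "(\<lambda>x. H \<kappa> (f x) (g x)) \<in> borel_measurable M"
proof -
  note [measurable] = coeff_measurable[OF assms(1)]
  show ?thesis unfolding H_def by measurable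
qed

lemma H_section_measurable: "coeff \<kappa> \<Longrightarrow> H \<kappa> \<tau> \<in> borel_measurable borel"
  using H_measurable[of \<kappa> "\<lambda>_. \<tau>" borel "\<lambda>x. x"] by simp

lemma H_le_K: "coeff \<kappa> \<Longrightarrow> \<tau> > 0 \<Longrightarrow> \<bar>H \<kappa> \<tau> x\<bar> \<le> \<bar>K \<tau> x\<bar>"
  by (auto simp: H_def abs_mult coeff_def intro: mult_left_le_one_le)

lemma H_integrable: "coeff \<kappa> \<Longrightarrow> integrable lborel (H \<kappa> \<tau>)"
  using K_integrable[of \<tau>] by (cases "\<tau> > 0") (auto simp: H_def[abs_def])

lemma H_L1:
  assumes "coeff \<kappa>"
  shows "(LINT x|lborel. \<bar>H \<kappa> \<tau> x\<bar>) \<le> L"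
proof (cases "\<tau> > 0")
  case True
  have "(LINT x|lborel. \<bar>H \<kappa> \<tau> x\<bar>) \<le> (LINT x|lborel. \<bar>K \<tau> x\<bar>)"
    using True assms H_le_K H_integrable K_integrable by (intro integral_mono integrable_abs) auto
  then show ?thesis using K_L1[OF True] by simp
qed (use L_ge_1 in \<open>simp add: H_def\<close>)

lemma H_bounded: "coeff \<kappa> \<Longrightarrow> \<bar>H \<kappa> \<tau> x\<bar> \<le> B * \<tau> powr (- \<gamma>)"
  using H_le_K[of \<kappa> \<tau> x] K_bounded[of \<tau> x] B by (cases "\<tau> > 0") (auto simp: H_def)

lemma hosc_bounds:
  assumes "coeff \<kappa>"
  shows "0 \<le> hosc \<kappa> r \<tau>" "hosc \<kappa> r \<tau> \<le> 2 * L"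
proof -
  have "hosc \<kappa> r \<tau> \<le> (LINT x|lborel. \<bar>H \<kappa> r x\<bar> + \<bar>H \<kappa> \<tau> x\<bar>)"
    unfolding hosc_def using H_integrable[OF assms] by (intro integral_mono) auto
  also have "\<dots> \<le> 2 * L"
    using H_integrable[OF assms] H_L1[OF assms, of r] H_L1[OF assms, of \<tau>] by simp
  finally show "hosc \<kappa> r \<tau> \<le> 2 * L" .
qed (simp add: hosc_def integral_nonneg_AE)

lemma hosc_tendsto:
  assumes \<kappa>: "coeff \<kappa>" and \<tau>: "\<tau> \<noteq> 0"
  shows "((\<lambda>r. hosc \<kappa> r \<tau>) \<longlongrightarrow> 0) (at \<tau>)"
proof (cases "\<tau> > 0")
  case True
  have ev: "\<forall>\<^sub>F r in at \<tau>. r > 0"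
    using order_tendstoD(1)[OF tendsto_ident_at True] .
  have \<kappa>\<tau>: "(\<kappa> \<longlongrightarrow> \<kappa> \<tau>) (at \<tau>)"
  proof -
    have "continuous_on {0<..} \<kappa>" using \<kappa> by (auto simp: coeff_def intro: continuous_on_subset)
    then show ?thesis using True by (simp add: continuous_on_eq_continuous_at isCont_def)
  qed
  have "((\<lambda>r. 1 * (LINT x|lborel. \<bar>K r x - K \<tau> x\<bar>) + \<bar>\<kappa> r - \<kappa> \<tau>\<bar> * L) \<longlongrightarrow> 1 * 0 + \<bar>\<kappa> \<tau> - \<kappa> \<tau>\<bar> * L) (at \<tau>)"
    by (intro tendsto_intros K_L1_continuous True \<kappa>\<tau>)
  then have lim: "((\<lambda>r. (LINT x|lborel. \<bar>K r x - K \<tau> x\<bar>) + \<bar>\<kappa> r - \<kappa> \<tau>\<bar> * L) \<longlongrightarrow> 0) (at \<tau>)" by simp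
  show ?thesis
  proof (rule tendsto_sandwich[OF _ _ tendsto_const lim])
    show "\<forall>\<^sub>F r in at \<tau>. hosc \<kappa> r \<tau> \<le> (LINT x|lborel. \<bar>K r x - K \<tau> x\<bar>) + \<bar>\<kappa> r - \<kappa> \<tau>\<bar> * L"
      using ev
    proof eventually_elim
      case (elim r)
      note i = K_integrable[OF elim] K_integrable[OF True]
      have "hosc \<kappa> r \<tau> \<le> (LINT x|lborel. \<bar>K r x - K \<tau> x\<bar> + \<bar>\<kappa> r - \<kappa> \<tau>\<bar> * \<bar>K \<tau> x\<bar>)"
        unfolding hosc_def
      proof (rule integral_mono)
        fix x
        have "\<bar>H \<kappa> r x - H \<kappa> \<tau> x\<bar> = \<bar>\<kappa> r * (K r x - K \<tau> x) + (\<kappa> r - \<kappa> \<tau>) * K \<tau> x\<bar>"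
          using elim True by (simp add: H_def algebra_simps)
        also have "\<dots> \<le> \<bar>\<kappa> r\<bar> * \<bar>K r x - K \<tau> x\<bar> + \<bar>\<kappa> r - \<kappa> \<tau>\<bar> * \<bar>K \<tau> x\<bar>"
          by (rule order_trans[OF abs_triangle_ineq]) (simp add: abs_mult)
        also have "\<bar>\<kappa> r\<bar> * \<bar>K r x - K \<tau> x\<bar> \<le> \<bar>K r x - K \<tau> x\<bar>"
          using \<kappa> elim by (intro mult_left_le_one_le) (auto simp: coeff_def)
        finally show "\<bar>H \<kappa> r x - H \<kappa> \<tau> x\<bar> \<le> \<bar>K r x - K \<tau> x\<bar> + \<bar>\<kappa> r - \<kappa> \<tau>\<bar> * \<bar>K \<tau> x\<bar>" by simp
      qed (use i H_integrable[OF \<kappa>] in auto)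
      also have "\<dots> = (LINT x|lborel. \<bar>K r x - K \<tau> x\<bar>) + \<bar>\<kappa> r - \<kappa> \<tau>\<bar> * L"
        using i K_L1[OF True] by simp
      finally show ?case .
    qed
  qed (use hosc_bounds(1)[OF \<kappa>] in auto)
next
  case False
  then have "\<tau> < 0" using \<tau> by simp
  then have "\<forall>\<^sub>F r in at \<tau>. r < 0" by (rule order_tendstoD(2)[OF tendsto_ident_at])
  then have "\<forall>\<^sub>F r in at \<tau>. hosc \<kappa> r \<tau> = 0"
    by eventually_elim (use \<open>\<tau> < 0\<close> in \<open>simp add: hosc_def H_def\<close>)
  then show ?thesis by (rule tendsto_eventually)
qed

lemma hosc_measurable:
  assumes "coeff \<kappa>" and [measurable]: "f \<in> borel_measurable M" "g \<in> borel_measurable M"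
  shows "(\<lambda>x. hosc \<kappa> (f x) (g x)) \<in> borel_measurable M"
proof -
  have [measurable]: "(\<lambda>p. H \<kappa> (f (fst p)) (snd p)) \<in> borel_measurable (M \<Otimes>\<^sub>M lborel)"
    "(\<lambda>p. H \<kappa> (g (fst p)) (snd p)) \<in> borel_measurable (M \<Otimes>\<^sub>M lborel)"
    by (intro H_measurable[OF assms(1)]; measurable)+
  have "(\<lambda>(x, y). \<bar>H \<kappa> (f x) y - H \<kappa> (g x) y\<bar>) \<in> borel_measurable (M \<Otimes>\<^sub>M lborel)"
    unfolding case_prod_beta' by measurable
  then show ?thesis
    unfolding hosc_def by (rule lborel.borel_measurable_lebesgue_integral)
qed

definition "hmod \<kappa> t r = (LINT \<tau>|lborel. indicator {0..t + 1} \<tau> * hosc \<kappa> (r - \<tau>) (t - \<tau>))"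

lemma hmod_integrable:
  assumes "coeff \<kappa>"
  shows "integrable lborel (\<lambda>\<tau>. indicator {0..t + 1} \<tau> * hosc \<kappa> (r - \<tau>) (t - \<tau>))"
proof -
  have [measurable]: "(\<lambda>\<tau>. hosc \<kappa> (r - \<tau>) (t - \<tau>)) \<in> borel_measurable lborel"
    by (intro hosc_measurable[OF assms]) measurable
  show ?thesis
    using hosc_bounds[OF assms]
    by (intro integrable_mult_bounded(1)[of _ _ _ "2 * L"] integrable_real_indicator)
      (auto simp: emeasure_lborel_Icc_eq)
qed

text \<open>
  The oscillation tends to \<open>0\<close> for every \<open>\<tau> \<noteq> t\<close> and is bounded by \<open>2 L\<close>; the jump of \<open>H\<close> at time \<open>0\<close>
  affects the single point \<open>\<tau> = t\<close>.
\<close>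

lemma hmod_tendsto:
  assumes \<kappa>: "coeff \<kappa>"
  shows "((\<lambda>r. hmod \<kappa> t r) \<longlongrightarrow> 0) (at t)"
proof -
  have meas[measurable]: "(\<lambda>\<tau>. hosc \<kappa> (r - \<tau>) (t - \<tau>)) \<in> borel_measurable lborel" for r
    by (intro hosc_measurable[OF assms]) measurable
  have "((\<lambda>r. hmod \<kappa> t r) \<longlongrightarrow> (LINT \<tau>|(lborel :: real measure). 0)) (at t)"
    unfolding hmod_def
  proof (rule integral_dominated_convergence_within[where w="\<lambda>\<tau>. indicator {0..t + 1} \<tau> * (2 * L)"])
    have "((\<lambda>r. indicator {0..t + 1} \<tau> * hosc \<kappa> (r - \<tau>) (t - \<tau>)) \<longlongrightarrow> indicator {0..t + 1} \<tau> * 0) (at t)"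
      if "\<tau> \<noteq> t" for \<tau>
    proof (intro tendsto_mult_left filterlim_compose[OF hosc_tendsto[OF \<kappa>, of "t - \<tau>"]])
      show "filterlim (\<lambda>r. r - \<tau>) (at (t - \<tau>)) (at t)"
        by (auto simp: filterlim_at eventually_at_filter intro!: tendsto_intros)
    qed (use that in auto)
    then show "AE \<tau> in lborel. ((\<lambda>r. indicator {0..t + 1} \<tau> * hosc \<kappa> (r - \<tau>) (t - \<tau>)) \<longlongrightarrow> 0) (at t)"
      using AE_lborel_singleton[of t] by (auto elim: eventually_mono)
    show "integrable lborel (\<lambda>\<tau>. indicator {0..t + 1} \<tau> * (2 * L))"
      by (intro integrable_mult_left integrable_real_indicator) (auto simp: emeasure_lborel_Icc_eq)
    show "\<forall>\<^sub>F r in at t. (\<lambda>\<tau>. indicator {0..t + 1} \<tau> * hosc \<kappa> (r - \<tau>) (t - \<tau>)) \<in> borel_measurable lborel \<and>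
       (AE \<tau> in lborel. norm (indicator {0..t + 1} \<tau> * hosc \<kappa> (r - \<tau>) (t - \<tau>)) \<le> indicator {0..t + 1} \<tau> * (2 * L))"
      using hosc_bounds[OF \<kappa>] by (intro always_eventually allI conjI AE_I2) (auto simp: indicator_def)
  qed measurable
  then show ?thesis by simp
qed

lemma G_measurable:
  assumes \<kappa>: "coeff \<kappa>" and b: "case_prod b \<in> borel_measurable (borel \<Otimes>\<^sub>M borel)"
    and [measurable]: "f \<in> borel_measurable M" "g \<in> borel_measurable M" "h \<in> borel_measurable M"
  shows "(\<lambda>x. G \<kappa> b (f x) (g x) (h x)) \<in> borel_measurable M"
proof -
  have [measurable]: "(\<lambda>p. H \<kappa> (f (fst p) - g (fst p)) (h (fst p) - snd p)) \<in> borel_measurable (M \<Otimes>\<^sub>M lborel)"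
    by (intro H_measurable[OF \<kappa>]) measurable
  have [measurable]: "(\<lambda>p. b (g (fst p)) (snd p)) \<in> borel_measurable (M \<Otimes>\<^sub>M lborel)"
    by (intro measurable_case_prod_compose[OF b]) measurable
  have "(\<lambda>(x, y). H \<kappa> (f x - g x) (h x - y) * b (g x) y) \<in> borel_measurable (M \<Otimes>\<^sub>M lborel)"
    unfolding case_prod_beta' by measurable
  then have [measurable]: "(\<lambda>x. conv (H \<kappa> (f x - g x)) (b (g x)) (h x)) \<in> borel_measurable M"
    unfolding conv_def by (rule lborel.borel_measurable_lebesgue_integral)
  show ?thesis unfolding G_def by measurable
qed

lemma D_measurable:
  assumes \<kappa>: "coeff \<kappa>" and b: "case_prod b \<in> borel_measurable (borel \<Otimes>\<^sub>M borel)"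
  shows "case_prod (D \<kappa> b) \<in> borel_measurable (borel \<Otimes>\<^sub>M borel)"
proof -
  have "(\<lambda>q. G \<kappa> b (fst (fst q)) (snd q) (snd (fst q))) \<in> borel_measurable ((borel \<Otimes>\<^sub>M borel) \<Otimes>\<^sub>M lborel)"
    by (intro G_measurable[OF \<kappa> b]) measurable
  then have "(\<lambda>(p, \<tau>). G \<kappa> b (fst p) \<tau> (snd p)) \<in> borel_measurable ((borel \<Otimes>\<^sub>M borel) \<Otimes>\<^sub>M lborel)"
    by (simp add: case_prod_beta')
  then have "(\<lambda>p. LINT \<tau>|lborel. G \<kappa> b (fst p) \<tau> (snd p)) \<in> borel_measurable (borel \<Otimes>\<^sub>M borel)"
    by (rule lborel.borel_measurable_lebesgue_integral)
  then show ?thesis by (simp add: D_def case_prod_beta')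
qed

lemma powr_neg_le_1: "t \<ge> 0 \<Longrightarrow> k \<ge> 0 \<Longrightarrow> (1 + t) powr (- k) \<le> (1::real)"
  using powr_mono2'[of "- k" 1 "1 + t"] by simp

lemma decay_after_half_time:
  assumes t: "t \<ge> 0" and a: "a \<ge> (1 + t) / 2"
  shows "a powr (- \<gamma>) \<le> 2 powr \<gamma> * (1 + t) powr (- \<gamma>)"
proof -
  have "a powr (- \<gamma>) \<le> ((1 + t) / 2) powr (- \<gamma>)" using a t \<gamma> by (intro powr_mono2') auto
  also have "\<dots> = 2 powr \<gamma> * (1 + t) powr (- \<gamma>)"
    using t by (simp add: powr_divide powr_minus divide_simps)
  finally show ?thesis .
qed

text \<open>
  The kernel supplies the decay when \<open>\<tau>\<close> lies in the first half of \<open>[0, t]\<close>, by the estimate from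
  \<open>L\<^sup>1\<close> to \<open>L\<^sup>\<infinity>\<close>; in the second half the source itself has already decayed, and the
  kernel is only used as a bounded operator on \<open>L\<^sup>\<infinity>\<close>, which avoids its singularity at \<open>\<tau> = t\<close>.
\<close>

lemma G_bounded:
  assumes \<kappa>: "coeff \<kappa>" and b: "source k A b" and t: "t \<ge> 0" and k: "k > 1"
  shows "\<bar>G \<kappa> b t \<tau> x\<bar> \<le> ((L + B) * 2 powr \<gamma> * A * (1 + t) powr (- \<gamma>)) * (1 + \<bar>\<tau>\<bar>) powr (- k)"
proof (cases "0 \<le> \<tau> \<and> \<tau> < t")
  case False
  then have "G \<kappa> b t \<tau> x = 0" by (auto simp: G_def H_def conv_def)
  then show ?thesis using source_nonneg[OF b] L_ge_1 B by simp
next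
  case True
  have A: "A \<ge> 0" by (rule source_nonneg[OF b])
  have bm: "b \<tau> \<in> borel_measurable borel" and bi: "integrable lborel (b \<tau>)"
    and b1: "\<And>x. \<bar>b \<tau> x\<bar> \<le> A * ((1 + \<tau>) powr (- \<gamma>) * (1 + \<tau>) powr (- k))"
    and b2: "(LINT x|lborel. \<bar>b \<tau> x\<bar>) \<le> A * (1 + \<tau>) powr (- k)"
    using b True measurable_case_prod_section by (auto simp: source_def)
  have Geq: "G \<kappa> b t \<tau> x = conv (H \<kappa> (t - \<tau>)) (b \<tau>) x" using True by (simp add: G_def)
  note half = decay_after_half_time[OF t]
  have nn: "0 \<le> 2 powr \<gamma> * (1 + t) powr (- \<gamma>) * (A * (1 + \<tau>) powr (- k))" using A by simp
  have "\<bar>G \<kappa> b t \<tau> x\<bar> \<le> (L + B) * (2 powr \<gamma> * (1 + t) powr (- \<gamma>) * (A * (1 + \<tau>) powr (- k)))"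
  proof (cases "1 + \<tau> \<ge> (1 + t) / 2")
    case True
    have "\<bar>G \<kappa> b t \<tau> x\<bar> \<le> A * ((1 + \<tau>) powr (- \<gamma>) * (1 + \<tau>) powr (- k)) * (LINT y|lborel. \<bar>H \<kappa> (t - \<tau>) y\<bar>)"
      unfolding Geq by (rule conv_bounded(1)[OF H_integrable[OF \<kappa>] bm b1])
    also have "\<dots> \<le> A * ((1 + \<tau>) powr (- \<gamma>) * (1 + \<tau>) powr (- k)) * L"
      using A by (intro mult_left_mono H_L1[OF \<kappa>]) auto
    also have "\<dots> = (1 + \<tau>) powr (- \<gamma>) * (L * (A * (1 + \<tau>) powr (- k)))" by simp
    also have "\<dots> \<le> (2 powr \<gamma> * (1 + t) powr (- \<gamma>)) * (L * (A * (1 + \<tau>) powr (- k)))"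
      using A L_ge_1 by (intro mult_right_mono half[OF True]) auto
    also have "\<dots> = L * (2 powr \<gamma> * (1 + t) powr (- \<gamma>) * (A * (1 + \<tau>) powr (- k)))" by simp
    also have "\<dots> \<le> (L + B) * (2 powr \<gamma> * (1 + t) powr (- \<gamma>) * (A * (1 + \<tau>) powr (- k)))"
      using B by (intro mult_right_mono nn) auto
    finally show ?thesis .
  next
    case False
    then have "t - \<tau> \<ge> (1 + t) / 2" by (simp add: field_simps)
    note h = half[OF this]
    have "\<bar>G \<kappa> b t \<tau> x\<bar> \<le> (B * (t - \<tau>) powr (- \<gamma>)) * (LINT y|lborel. \<bar>b \<tau> y\<bar>)"
      unfolding Geq by (rule conv_bounded'[OF H_section_measurable[OF \<kappa>] H_bounded[OF \<kappa>] bi])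
    also have "\<dots> \<le> (B * (2 powr \<gamma> * (1 + t) powr (- \<gamma>))) * (A * (1 + \<tau>) powr (- k))"
      using B A by (intro mult_mono mult_left_mono h b2) (auto intro!: integral_nonneg_AE)
    also have "\<dots> = B * (2 powr \<gamma> * (1 + t) powr (- \<gamma>) * (A * (1 + \<tau>) powr (- k)))" by simp
    also have "\<dots> \<le> (L + B) * (2 powr \<gamma> * (1 + t) powr (- \<gamma>) * (A * (1 + \<tau>) powr (- k)))"
      using L_ge_1 by (intro mult_right_mono nn) auto
    finally show ?thesis .
  qed
  also have "\<dots> = ((L + B) * 2 powr \<gamma> * A * (1 + t) powr (- \<gamma>)) * (1 + \<bar>\<tau>\<bar>) powr (- k)"
    using True by simp
  finally show ?thesis .
qed

lemma G_L1:
  assumes \<kappa>: "coeff \<kappa>" and b: "source k A b"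
  shows "integrable lborel (G \<kappa> b t \<tau>)" "(LINT x|lborel. \<bar>G \<kappa> b t \<tau> x\<bar>) \<le> (L * A) * (1 + \<bar>\<tau>\<bar>) powr (- k)"
proof -
  have *: "integrable lborel (G \<kappa> b t \<tau>) \<and> (LINT x|lborel. \<bar>G \<kappa> b t \<tau> x\<bar>) \<le> (L * A) * (1 + \<bar>\<tau>\<bar>) powr (- k)"
  proof (cases "\<tau> \<ge> 0")
    case True
    have bi: "integrable lborel (b \<tau>)" and b2: "(LINT x|lborel. \<bar>b \<tau> x\<bar>) \<le> A * (1 + \<tau>) powr (- k)"
      using b True by (auto simp: source_def)
    have "(LINT x|lborel. \<bar>conv (H \<kappa> (t - \<tau>)) (b \<tau>) x\<bar>) \<le> (LINT y|lborel. \<bar>H \<kappa> (t - \<tau>) y\<bar>) * (LINT y|lborel. \<bar>b \<tau> y\<bar>)"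
      by (rule conv_L1(2)[OF H_integrable[OF \<kappa>] bi])
    also have "\<dots> \<le> L * (A * (1 + \<tau>) powr (- k))"
      using L_ge_1 by (intro mult_mono H_L1[OF \<kappa>] b2 integral_nonneg_AE) auto
    finally show ?thesis
      using True conv_L1(1)[OF H_integrable[OF \<kappa>] bi] by (simp add: G_def[abs_def])
  qed (use source_nonneg[OF b] L_ge_1 in \<open>simp add: G_def[abs_def]\<close>)
  from * show "integrable lborel (G \<kappa> b t \<tau>)" by blast
  from * show "(LINT x|lborel. \<bar>G \<kappa> b t \<tau> x\<bar>) \<le> (L * A) * (1 + \<bar>\<tau>\<bar>) powr (- k)" by blast
qed

lemma G_diff:
  assumes \<kappa>: "coeff \<kappa>" and b: "source k A b" and k: "k > 1" and r: "r \<le> t + 1"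
  shows "\<bar>G \<kappa> b r \<tau> x - G \<kappa> b t \<tau> x\<bar> \<le> A * (indicator {0..t + 1} \<tau> * hosc \<kappa> (r - \<tau>) (t - \<tau>))"
    and "(LINT x|lborel. \<bar>G \<kappa> b r \<tau> x - G \<kappa> b t \<tau> x\<bar>) \<le> A * (indicator {0..t + 1} \<tau> * hosc \<kappa> (r - \<tau>) (t - \<tau>))"
proof -
  have *: "\<bar>G \<kappa> b r \<tau> x - G \<kappa> b t \<tau> x\<bar> \<le> A * (indicator {0..t + 1} \<tau> * hosc \<kappa> (r - \<tau>) (t - \<tau>)) \<and>
    (LINT x|lborel. \<bar>G \<kappa> b r \<tau> x - G \<kappa> b t \<tau> x\<bar>) \<le> A * (indicator {0..t + 1} \<tau> * hosc \<kappa> (r - \<tau>) (t - \<tau>))"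
  proof (cases "\<tau> \<in> {0..t + 1}")
    case False
    then show ?thesis using r by (auto simp: G_def H_def conv_def)
  next
    case True
    then have \<tau>: "\<tau> \<ge> 0" by simp
    have A: "A \<ge> 0" by (rule source_nonneg[OF b])
    have bm: "b \<tau> \<in> borel_measurable borel" and bi: "integrable lborel (b \<tau>)"
      and b1: "\<And>x. \<bar>b \<tau> x\<bar> \<le> A * ((1 + \<tau>) powr (- \<gamma>) * (1 + \<tau>) powr (- k))"
      and b2: "(LINT x|lborel. \<bar>b \<tau> x\<bar>) \<le> A * (1 + \<tau>) powr (- k)"
      using b \<tau> measurable_case_prod_section by (auto simp: source_def)
    have p: "(1 + \<tau>) powr (- k) \<le> 1" "(1 + \<tau>) powr (- \<gamma>) \<le> 1"
      using k \<tau> \<gamma> by (auto intro!: powr_neg_le_1)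
    then have "A * ((1 + \<tau>) powr (- \<gamma>) * (1 + \<tau>) powr (- k)) \<le> A * 1"
      using A by (intro mult_left_mono mult_le_one) auto
    then have b1': "\<bar>b \<tau> x\<bar> \<le> A" for x using b1[of x] by linarith
    have b2': "(LINT x|lborel. \<bar>b \<tau> x\<bar>) \<le> A"
      using b2 mult_left_mono[OF p(1) A] by linarith
    let ?h = "\<lambda>y. H \<kappa> (r - \<tau>) y - H \<kappa> (t - \<tau>) y"
    have hi: "integrable lborel ?h" using H_integrable[OF \<kappa>] by auto
    have eq: "G \<kappa> b r \<tau> x - G \<kappa> b t \<tau> x = conv ?h (b \<tau>) x" for x
      using \<tau> conv_diff_left[OF H_integrable[OF \<kappa>] H_integrable[OF \<kappa>] b1' bm] by (simp add: G_def)
    have "\<bar>conv ?h (b \<tau>) x\<bar> \<le> A * hosc \<kappa> (r - \<tau>) (t - \<tau>)"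
      unfolding hosc_def by (rule conv_bounded(1)[OF hi bm b1'])
    moreover have "(LINT x|lborel. \<bar>conv ?h (b \<tau>) x\<bar>) \<le> hosc \<kappa> (r - \<tau>) (t - \<tau>) * A"
      using conv_L1(2)[OF hi bi] mult_left_mono[OF b2' hosc_bounds(1)[OF \<kappa>]] unfolding hosc_def by (rule order_trans)
    ultimately show ?thesis using True by (simp add: eq mult.commute)
  qed
  from * show "\<bar>G \<kappa> b r \<tau> x - G \<kappa> b t \<tau> x\<bar> \<le> A * (indicator {0..t + 1} \<tau> * hosc \<kappa> (r - \<tau>) (t - \<tau>))" by blast
  from * show "(LINT x|lborel. \<bar>G \<kappa> b r \<tau> x - G \<kappa> b t \<tau> x\<bar>) \<le> A * (indicator {0..t + 1} \<tau> * hosc \<kappa> (r - \<tau>) (t - \<tau>))" by blast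
qed

definition "J k = (LINT \<tau>|lborel. (1 + \<bar>\<tau>::real\<bar>) powr (- k))"

lemma J_integrable: "k > 1 \<Longrightarrow> integrable lborel (\<lambda>\<tau>::real. (1 + \<bar>\<tau>\<bar>) powr (- k))"
  using integrable_one_plus_norm_powr[of "k - 1", where 'a=real] by simp

lemma J_nonneg: "J k \<ge> 0"
  unfolding J_def by (intro integral_nonneg_AE) auto

definition "duhamel_const k = (L + B) * 2 powr \<gamma> * J k"

lemma duhamel_const_nonneg: "duhamel_const k \<ge> 0" "L * J k \<le> duhamel_const k"
proof -
  show "duhamel_const k \<ge> 0" using L_ge_1 B J_nonneg by (simp add: duhamel_const_def)
  have "L * 1 \<le> (L + B) * 2 powr \<gamma>"
    using L_ge_1 B \<gamma> ge_one_powr_ge_zero[of 2 \<gamma>] by (intro mult_mono) auto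
  then have "L * 1 * J k \<le> (L + B) * 2 powr \<gamma> * J k" using J_nonneg by (intro mult_right_mono)
  then show "L * J k \<le> duhamel_const k" by (simp add: duhamel_const_def)
qed

lemma D_at_0: "D \<kappa> b 0 x = 0"
  unfolding D_def by (rule integral_eq_zero_AE) (simp add: G_def H_def conv_def)

lemma G_time_integrable:
  assumes \<kappa>: "coeff \<kappa>" and b: "source k A b" and t: "t \<ge> 0" and k: "k > 1"
  shows "integrable lborel (\<lambda>\<tau>. G \<kappa> b t \<tau> x)"
proof (rule Bochner_Integration.integrable_bound)
  show "integrable lborel (\<lambda>\<tau>. ((L + B) * 2 powr \<gamma> * A * (1 + t) powr (- \<gamma>)) * (1 + \<bar>\<tau>\<bar>) powr (- k))"
    by (intro integrable_mult_right J_integrable k)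
  show "(\<lambda>\<tau>. G \<kappa> b t \<tau> x) \<in> borel_measurable lborel"
    using b by (intro G_measurable[OF \<kappa>]) (auto simp: source_def)
  show "AE \<tau> in lborel. norm (G \<kappa> b t \<tau> x) \<le> norm (((L + B) * 2 powr \<gamma> * A * (1 + t) powr (- \<gamma>)) * (1 + \<bar>\<tau>\<bar>) powr (- k))"
    using order_trans[OF G_bounded[OF \<kappa> b t k] abs_ge_self] by (intro AE_I2) (simp only: real_norm_def)
qed

lemma D_decaying:
  assumes \<kappa>: "coeff \<kappa>" and b: "source k A b" and k: "k > 1"
  shows "decaying (duhamel_const k * A) (D \<kappa> b)"
  unfolding decaying_def
proof (intro conjI allI impI)
  have bm: "case_prod b \<in> borel_measurable (borel \<Otimes>\<^sub>M borel)" using b by (simp add: source_def)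
  show "case_prod (D \<kappa> b) \<in> borel_measurable (borel \<Otimes>\<^sub>M borel)" by (rule D_measurable[OF \<kappa> bm])
  fix t :: real assume t: "t \<ge> 0"
  show "\<bar>D \<kappa> b t x\<bar> \<le> duhamel_const k * A * (1 + t) powr (- \<gamma>)" for x
  proof -
    have "\<bar>D \<kappa> b t x\<bar> \<le> (LINT \<tau>|lborel. \<bar>G \<kappa> b t \<tau> x\<bar>)" unfolding D_def by (rule integral_abs_bound)
    also have "\<dots> \<le> (LINT \<tau>|lborel. ((L + B) * 2 powr \<gamma> * A * (1 + t) powr (- \<gamma>)) * (1 + \<bar>\<tau>\<bar>) powr (- k))"
      using G_time_integrable[OF \<kappa> b t k] G_bounded[OF \<kappa> b t k] J_integrable[OF k]
      by (intro integral_mono integrable_abs integrable_mult_right) auto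
    finally show ?thesis by (simp add: duhamel_const_def J_def mult_ac)
  qed
  have "(\<lambda>p. G \<kappa> b t (fst p) (snd p)) \<in> borel_measurable (borel \<Otimes>\<^sub>M borel)"
    by (intro G_measurable[OF \<kappa> bm]) measurable
  then have m: "case_prod (G \<kappa> b t) \<in> borel_measurable (borel \<Otimes>\<^sub>M borel)" by (simp add: case_prod_beta')
  note L1 = L1_integral_le[OF m integrable_mult_right[OF J_integrable[OF k]] G_L1(1)[OF \<kappa> b] G_L1(2)[OF \<kappa> b]]
  show "integrable lborel (D \<kappa> b t)" using L1(1) by (simp add: D_def[abs_def])
  have "(LINT x|lborel. \<bar>D \<kappa> b t x\<bar>) \<le> L * A * J k" using L1(2) by (simp add: D_def J_def)
  also have "\<dots> = (L * J k) * A" by simp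
  also have "\<dots> \<le> duhamel_const k * A" using source_nonneg[OF b] by (intro mult_right_mono duhamel_const_nonneg)
  finally show "(LINT x|lborel. \<bar>D \<kappa> b t x\<bar>) \<le> duhamel_const k * A" .
qed

lemma D_modulus:
  assumes \<kappa>: "coeff \<kappa>" and b: "source k A b" and k: "k > 1" and t: "t \<ge> 0" and r: "r \<ge> 0" "r \<le> t + 1"
  shows "\<bar>D \<kappa> b r x - D \<kappa> b t x\<bar> \<le> A * hmod \<kappa> t r"
    and "(LINT x|lborel. \<bar>D \<kappa> b r x - D \<kappa> b t x\<bar>) \<le> A * hmod \<kappa> t r"
proof -
  have bm: "case_prod b \<in> borel_measurable (borel \<Otimes>\<^sub>M borel)" using b by (simp add: source_def)
  have ih: "integrable lborel (\<lambda>\<tau>. A * (indicator {0..t + 1} \<tau> * hosc \<kappa> (r - \<tau>) (t - \<tau>)))"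
    by (intro integrable_mult_right hmod_integrable[OF \<kappa>])
  note i = G_time_integrable[OF \<kappa> b r(1) k] G_time_integrable[OF \<kappa> b t k]
  have eq: "D \<kappa> b r x - D \<kappa> b t x = (LINT \<tau>|lborel. G \<kappa> b r \<tau> x - G \<kappa> b t \<tau> x)" for x
    unfolding D_def using i by simp
  have "\<bar>D \<kappa> b r x - D \<kappa> b t x\<bar> \<le> (LINT \<tau>|lborel. \<bar>G \<kappa> b r \<tau> x - G \<kappa> b t \<tau> x\<bar>)"
    unfolding eq by (rule integral_abs_bound)
  also have "\<dots> \<le> (LINT \<tau>|lborel. A * (indicator {0..t + 1} \<tau> * hosc \<kappa> (r - \<tau>) (t - \<tau>)))"
    using i by (intro integral_mono ih G_diff(1)[OF \<kappa> b k r(2)]) auto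
  also have "\<dots> = A * hmod \<kappa> t r" by (simp add: hmod_def)
  finally show "\<bar>D \<kappa> b r x - D \<kappa> b t x\<bar> \<le> A * hmod \<kappa> t r" .
  have "(\<lambda>p. G \<kappa> b r (fst p) (snd p) - G \<kappa> b t (fst p) (snd p)) \<in> borel_measurable (borel \<Otimes>\<^sub>M borel)"
    by (intro borel_measurable_diff G_measurable[OF \<kappa> bm]) measurable
  then have m: "(\<lambda>(\<tau>, x). G \<kappa> b r \<tau> x - G \<kappa> b t \<tau> x) \<in> borel_measurable (borel \<Otimes>\<^sub>M borel)"
    by (simp add: case_prod_beta')
  have "(LINT x|lborel. \<bar>D \<kappa> b r x - D \<kappa> b t x\<bar>) \<le> (LINT \<tau>|lborel. A * (indicator {0..t + 1} \<tau> * hosc \<kappa> (r - \<tau>) (t - \<tau>)))"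
    unfolding eq using G_L1(1)[OF \<kappa> b]
    by (intro L1_integral_le(2)[OF m ih _ G_diff(2)[OF \<kappa> b k r(2)]]) auto
  also have "\<dots> = A * hmod \<kappa> t r" by (simp add: hmod_def)
  finally show "(LINT x|lborel. \<bar>D \<kappa> b r x - D \<kappa> b t x\<bar>) \<le> A * hmod \<kappa> t r" .
qed

lemma D_diff:
  assumes \<kappa>: "coeff \<kappa>" and b: "source k A b" and b': "source k A' b'" and k: "k > 1" and t: "t \<ge> 0"
  shows "D \<kappa> (\<lambda>\<tau> x. b \<tau> x - b' \<tau> x) t x = D \<kappa> b t x - D \<kappa> b' t x"
proof -
  have "G \<kappa> (\<lambda>\<tau> x. b \<tau> x - b' \<tau> x) t \<tau> x = G \<kappa> b t \<tau> x - G \<kappa> b' t \<tau> x" for \<tau>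
  proof (cases "\<tau> \<ge> 0")
    case True
    have m: "b \<tau> \<in> borel_measurable borel" "b' \<tau> \<in> borel_measurable borel"
      and b1: "\<And>x. \<bar>b \<tau> x\<bar> \<le> A * ((1 + \<tau>) powr (- \<gamma>) * (1 + \<tau>) powr (- k))"
      and b2: "\<And>x. \<bar>b' \<tau> x\<bar> \<le> A' * ((1 + \<tau>) powr (- \<gamma>) * (1 + \<tau>) powr (- k))"
      using b b' True measurable_case_prod_section by (auto simp: source_def)
    show ?thesis
      using True conv_diff_right[OF H_integrable[OF \<kappa>] b1 b2 m] by (simp add: G_def)
  qed (simp add: G_def)
  then show ?thesis
    using G_time_integrable[OF \<kappa> b t k] G_time_integrable[OF \<kappa> b' t k] by (simp add: D_def)
qed

text \<open>
  At \<open>\<tau> = t\<close> the operator \<open>S\<close> is the identity whereas \<open>H\<close> vanishes; the two integrands agree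
  elsewhere.
\<close>

lemma D_eq_set_integral:
  assumes \<kappa>: "coeff \<kappa>" and b: "source k A b" and k: "k > 1" and t: "t \<ge> 0"
  shows "set_integrable lborel {0..t} (\<lambda>\<tau>. \<kappa> (t - \<tau>) * S (t - \<tau>) (b \<tau>) x)"
    and "(LINT \<tau>:{0..t}|lborel. \<kappa> (t - \<tau>) * S (t - \<tau>) (b \<tau>) x) = D \<kappa> b t x"
proof -
  have bm: "case_prod b \<in> borel_measurable (borel \<Otimes>\<^sub>M borel)" using b by (simp add: source_def)
  note [measurable] = coeff_measurable[OF \<kappa>]
  let ?f = "\<lambda>\<tau>. indicator {0..t} \<tau> *\<^sub>R (\<kappa> (t - \<tau>) * S (t - \<tau>) (b \<tau>) x)"
  have [measurable]: "(\<lambda>p. b (fst p) (snd p)) \<in> borel_measurable (lborel \<Otimes>\<^sub>M lborel)"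
    using measurable_case_prod_compose[OF bm, of fst "lborel \<Otimes>\<^sub>M lborel" snd] by simp
  have [measurable]: "(\<lambda>\<tau>. b \<tau> x) \<in> borel_measurable borel"
    using measurable_case_prod_compose[OF bm, of "\<lambda>\<tau>. \<tau>" borel "\<lambda>_. x"] by simp
  have "(\<lambda>(\<tau>, y). K (t - \<tau>) (x - y) * b \<tau> y) \<in> borel_measurable (lborel \<Otimes>\<^sub>M lborel)"
    unfolding case_prod_beta' by measurable
  then have [measurable]: "(\<lambda>\<tau>. conv (K (t - \<tau>)) (b \<tau>) x) \<in> borel_measurable lborel"
    unfolding conv_def by (rule lborel.borel_measurable_lebesgue_integral)
  have m: "?f \<in> borel_measurable lborel" unfolding S_def by measurable
  have gi: "integrable lborel (\<lambda>\<tau>. G \<kappa> b t \<tau> x)" by (rule G_time_integrable[OF \<kappa> b t k])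
  have eq: "AE \<tau> in lborel. ?f \<tau> = G \<kappa> b t \<tau> x"
    using AE_lborel_singleton[of t]
  proof eventually_elim
    case (elim \<tau>)
    then show ?case
      by (auto simp: G_def H_def[abs_def] S_def indicator_def conv_def mult.assoc)
  qed
  show "set_integrable lborel {0..t} (\<lambda>\<tau>. \<kappa> (t - \<tau>) * S (t - \<tau>) (b \<tau>) x)"
    unfolding set_integrable_def using integrable_cong_AE[OF m _ eq] gi by auto
  show "(LINT \<tau>:{0..t}|lborel. \<kappa> (t - \<tau>) * S (t - \<tau>) (b \<tau>) x) = D \<kappa> b t x"
    unfolding set_lebesgue_integral_def D_def using integral_cong_AE[OF m _ eq] gi by auto
qed

end

section \<open>Solving the integral system by iteration\<close>

context selfsimilar_kernel
begin

lemma decaying_nonneg: "decaying M w \<Longrightarrow> M \<ge> 0"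
proof -
  assume "decaying M w"
  then have "(LINT x|lborel. \<bar>w 0 x\<bar>) \<le> M" by (auto simp: decaying_def dest!: spec[of _ 0])
  moreover have "0 \<le> (LINT x|lborel. \<bar>w 0 x\<bar>)" by (intro integral_nonneg_AE) auto
  ultimately show "M \<ge> 0" by linarith
qed

lemma decaying_bounded:
  assumes w: "decaying M w" and t: "t \<ge> 0"
  shows "\<bar>w t x\<bar> \<le> M"
proof -
  have "\<bar>w t x\<bar> \<le> M * (1 + t) powr (- \<gamma>)" using w t by (auto simp: decaying_def)
  also have "\<dots> \<le> M * 1"
    using decaying_nonneg[OF w] t \<gamma> by (intro mult_left_mono powr_neg_le_1) auto
  finally show ?thesis by simp
qed

lemma decaying_mono:
  assumes "decaying M w" "M \<le> M'"
  shows "decaying M' w"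
proof -
  have "M * (1 + t) powr (- \<gamma>) \<le> M' * (1 + t) powr (- \<gamma>)" for t
    using assms(2) by (intro mult_right_mono) auto
  then show ?thesis using assms unfolding decaying_def by (meson order_trans)
qed

lemma decaying_cong:
  assumes "decaying M w" "case_prod w' \<in> borel_measurable (borel \<Otimes>\<^sub>M borel)"
    and "\<And>t x. t \<ge> 0 \<Longrightarrow> w' t x = w t x"
  shows "decaying M w'"
proof -
  have "w' t = w t" if "t \<ge> 0" for t using assms(3)[OF that] by auto
  then show ?thesis using assms(1,2) by (simp add: decaying_def)
qed

lemma decaying_add:
  assumes w: "decaying M w" and w': "decaying M' w'"
  shows "decaying (M + M') (\<lambda>t x. w t x + w' t x)"
  unfolding decaying_def
proof (intro conjI allI impI)
  show "(\<lambda>(t, x). w t x + w' t x) \<in> borel_measurable (borel \<Otimes>\<^sub>M borel)"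
    using w w' unfolding decaying_def case_prod_beta' by auto
  fix t :: real assume t: "t \<ge> 0"
  have i: "integrable lborel (w t)" "integrable lborel (w' t)"
    and l: "(LINT x|lborel. \<bar>w t x\<bar>) \<le> M" "(LINT x|lborel. \<bar>w' t x\<bar>) \<le> M'"
    and p: "\<And>x. \<bar>w t x\<bar> \<le> M * (1 + t) powr (- \<gamma>)" "\<And>x. \<bar>w' t x\<bar> \<le> M' * (1 + t) powr (- \<gamma>)"
    using w w' t by (auto simp: decaying_def)
  show "\<bar>w t x + w' t x\<bar> \<le> (M + M') * (1 + t) powr (- \<gamma>)" for x
    using p(1)[of x] p(2)[of x] by (simp add: distrib_right)
  show "integrable lborel (\<lambda>x. w t x + w' t x)" using i by auto
  have "(LINT x|lborel. \<bar>w t x + w' t x\<bar>) \<le> (LINT x|lborel. \<bar>w t x\<bar> + \<bar>w' t x\<bar>)"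
    using i by (intro integral_mono) auto
  also have "\<dots> \<le> M + M'" using i l by simp
  finally show "(LINT x|lborel. \<bar>w t x + w' t x\<bar>) \<le> M + M'" .
qed

lemma decaying_zero: "M \<ge> 0 \<Longrightarrow> decaying M (\<lambda>t x. 0)"
  by (simp add: decaying_def)

lemma decaying_sum:
  assumes "finite I" "\<And>i. i \<in> I \<Longrightarrow> decaying (M i) (w i)"
  shows "decaying (\<Sum>i\<in>I. M i) (\<lambda>t x. \<Sum>i\<in>I. w i t x)"
  using assms
proof (induction I rule: finite_induct)
  case (insert i I)
  then show ?case using decaying_add[of "M i" "w i" "\<Sum>i\<in>I. M i" "\<lambda>t x. \<Sum>i\<in>I. w i t x"] by simp
qed (simp add: decaying_zero)

text \<open>Pointwise limits suffice: the bound in \<open>L\<^sup>1\<close> passes to the limit by Fatou's lemma.\<close>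

lemma decaying_limit:
  assumes u: "\<And>l. decaying E (u l)" and v: "case_prod v \<in> borel_measurable (borel \<Otimes>\<^sub>M borel)"
    and lim: "\<And>t x. t \<ge> 0 \<Longrightarrow> (\<lambda>l. u l t x) \<longlonglongrightarrow> v t x"
  shows "decaying E v"
  unfolding decaying_def
proof (intro conjI allI impI v)
  fix t :: real assume t: "t \<ge> 0"
  have p: "\<And>l x. \<bar>u l t x\<bar> \<le> E * (1 + t) powr (- \<gamma>)" and i: "\<And>l. integrable lborel (u l t)"
    and I: "\<And>l. (LINT x|lborel. \<bar>u l t x\<bar>) \<le> E"
    using u t by (auto simp: decaying_def)
  have [measurable]: "u l t \<in> borel_measurable borel" for l using i[of l] by auto
  have [measurable]: "v t \<in> borel_measurable borel" by (rule measurable_case_prod_section[OF v])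
  show "\<bar>v t x\<bar> \<le> E * (1 + t) powr (- \<gamma>)" for x
    using tendsto_rabs[OF lim[OF t, of x]] by (rule LIMSEQ_le_const2) (use p in auto)
  have "(\<integral>\<^sup>+x. ennreal \<bar>v t x\<bar> \<partial>lborel) = (\<integral>\<^sup>+x. liminf (\<lambda>l. ennreal \<bar>u l t x\<bar>) \<partial>lborel)"
  proof (intro nn_integral_cong)
    fix x
    have "(\<lambda>l. ennreal \<bar>u l t x\<bar>) \<longlonglongrightarrow> ennreal \<bar>v t x\<bar>"
      using lim[OF t, of x] by (intro tendsto_intros)
    then show "ennreal \<bar>v t x\<bar> = liminf (\<lambda>l. ennreal \<bar>u l t x\<bar>)"
      by (rule lim_imp_Liminf[symmetric, rotated]) simp
  qed
  also have "\<dots> \<le> liminf (\<lambda>l. \<integral>\<^sup>+x. ennreal \<bar>u l t x\<bar> \<partial>lborel)"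
    by (intro nn_integral_liminf) measurable
  also have "\<dots> \<le> liminf (\<lambda>l::nat. ennreal E)"
  proof (intro Liminf_mono always_eventually allI)
    fix l
    have "(\<integral>\<^sup>+x. ennreal \<bar>u l t x\<bar> \<partial>lborel) = ennreal (LINT x|lborel. \<bar>u l t x\<bar>)"
      using i by (intro nn_integral_eq_integral) auto
    then show "(\<integral>\<^sup>+x. ennreal \<bar>u l t x\<bar> \<partial>lborel) \<le> ennreal E"
      using I[of l] by (simp add: ennreal_leI)
  qed
  also have "\<dots> = ennreal E" by (rule Liminf_const) simp
  finally have nn: "(\<integral>\<^sup>+x. ennreal \<bar>v t x\<bar> \<partial>lborel) \<le> ennreal E" .
  then show iv: "integrable lborel (v t)"
    by (intro integrableI_bounded) (auto intro: le_less_trans)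
  have "ennreal (LINT x|lborel. \<bar>v t x\<bar>) \<le> ennreal E"
    using nn iv by (subst nn_integral_eq_integral[symmetric]) auto
  then show "(LINT x|lborel. \<bar>v t x\<bar>) \<le> E"
    using decaying_nonneg[OF u] by (simp add: ennreal_le_iff)
qed

lemma S_joint_measurable:
  assumes [measurable]: "f \<in> borel_measurable borel"
  shows "case_prod (\<lambda>t. S t f) \<in> borel_measurable (borel \<Otimes>\<^sub>M borel)"
proof -
  have "(\<lambda>(p, y). K (fst p) (snd p - y) * f y) \<in> borel_measurable ((borel \<Otimes>\<^sub>M borel) \<Otimes>\<^sub>M lborel)"
    unfolding case_prod_beta' by measurable
  then have [measurable]: "(\<lambda>p. conv (K (fst p)) f (snd p)) \<in> borel_measurable (borel \<Otimes>\<^sub>M borel)"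
    unfolding conv_def by (rule lborel.borel_measurable_lebesgue_integral)
  show ?thesis unfolding S_def case_prod_beta' by measurable
qed

lemma S_decaying:
  assumes f: "integrable lborel f" and m: "\<And>y. \<bar>f y\<bar> \<le> m" "(LINT y|lborel. \<bar>f y\<bar>) \<le> m" and \<kappa>: "coeff \<kappa>"
  shows "decaying ((L + B) * 2 powr \<gamma> * m) (\<lambda>t x. \<kappa> t * S t f x)"
  unfolding decaying_def
proof (intro conjI allI impI)
  have [measurable]: "f \<in> borel_measurable borel" "\<kappa> \<in> borel_measurable borel"
    using f coeff_measurable[OF \<kappa>] by auto
  have m0: "m \<ge> 0" using m(1)[of 0] by linarith
  have "(\<lambda>p. S (fst p) f (snd p)) \<in> borel_measurable (borel \<Otimes>\<^sub>M borel)"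
    using S_joint_measurable[of f] by (simp add: case_prod_beta')
  then show "(\<lambda>(t, x). \<kappa> t * S t f x) \<in> borel_measurable (borel \<Otimes>\<^sub>M borel)"
    unfolding case_prod_beta' by measurable
  fix t :: real assume t: "t \<ge> 0"
  have \<kappa>t: "\<bar>\<kappa> t\<bar> \<le> 1" using \<kappa> t by (simp add: coeff_def)
  note half = decay_after_half_time[OF t]
  show "\<bar>\<kappa> t * S t f x\<bar> \<le> (L + B) * 2 powr \<gamma> * m * (1 + t) powr (- \<gamma>)" for x
  proof -
    have nn: "0 \<le> 2 powr \<gamma> * (1 + t) powr (- \<gamma>) * m" using m0 by simp
    have "\<bar>\<kappa> t * S t f x\<bar> \<le> \<bar>S t f x\<bar>" using \<kappa>t by (simp add: abs_mult mult_left_le_one_le)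
    also have "\<dots> \<le> (L + B) * (2 powr \<gamma> * (1 + t) powr (- \<gamma>) * m)"
    proof (cases "t \<le> 1")
      case True
      have "\<bar>S t f x\<bar> \<le> m * L" using S_bounded[OF t _ m(1)] by simp
      also have "\<dots> = 1 powr (- \<gamma>) * (L * m)" by simp
      also have "\<dots> \<le> (2 powr \<gamma> * (1 + t) powr (- \<gamma>)) * (L * m)"
        using True m0 L_ge_1 by (intro mult_right_mono half) auto
      also have "\<dots> = L * (2 powr \<gamma> * (1 + t) powr (- \<gamma>) * m)" by simp
      also have "\<dots> \<le> (L + B) * (2 powr \<gamma> * (1 + t) powr (- \<gamma>) * m)"
        using B by (intro mult_right_mono nn) auto
      finally show ?thesis .
    next
      case False
      then have "\<bar>S t f x\<bar> \<le> B * t powr (- \<gamma>) * (LINT x|lborel. \<bar>f x\<bar>)"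
        by (intro S_bounded_L1 f) auto
      also have "\<dots> \<le> B * (2 powr \<gamma> * (1 + t) powr (- \<gamma>)) * m"
        using False B m m0 by (intro mult_mono mult_left_mono half) (auto intro!: integral_nonneg_AE)
      also have "\<dots> = B * (2 powr \<gamma> * (1 + t) powr (- \<gamma>) * m)" by simp
      also have "\<dots> \<le> (L + B) * (2 powr \<gamma> * (1 + t) powr (- \<gamma>) * m)"
        using L_ge_1 by (intro mult_right_mono nn) auto
      finally show ?thesis .
    qed
    finally show ?thesis by (simp add: mult_ac)
  qed
  note SL = S_L1[OF t f]
  show "integrable lborel (\<lambda>x. \<kappa> t * S t f x)" using SL by auto
  have "(LINT x|lborel. \<bar>\<kappa> t * S t f x\<bar>) = \<bar>\<kappa> t\<bar> * (LINT x|lborel. \<bar>S t f x\<bar>)" by (simp add: abs_mult)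
  also have "\<dots> \<le> (LINT x|lborel. \<bar>S t f x\<bar>)"
    using \<kappa>t by (intro mult_left_le_one_le integral_nonneg_AE) auto
  also have "\<dots> \<le> L * m" using SL(2) m(2) L_ge_1 mult_left_mono[of "LINT x|lborel. \<bar>f x\<bar>" m L] by linarith
  also have "\<dots> \<le> (L + B) * 2 powr \<gamma> * m"
  proof -
    have "L * 1 \<le> (L + B) * 2 powr \<gamma>"
      using L_ge_1 B \<gamma> ge_one_powr_ge_zero[of 2 \<gamma>] by (intro mult_mono) auto
    then show ?thesis using m0 mult_right_mono by fastforce
  qed
  finally show "(LINT x|lborel. \<bar>\<kappa> t * S t f x\<bar>) \<le> (L + B) * 2 powr \<gamma> * m" .
qed

end

text \<open>
  The integral system for an arbitrary finite number of components.  The exponent \<open>r\<close> of the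
  nonlinearity is supercritical: \<open>\<gamma> (r - 1) > 1\<close> makes the gain of decay integrable in time.
\<close>

locale kernel_system = selfsimilar_kernel P s B d
  for P :: "'a::euclidean_space \<Rightarrow> real" and s B d :: real +
  fixes \<kappa> :: "'k::finite \<Rightarrow> 'k \<Rightarrow> real \<Rightarrow> real" and N :: "'k \<Rightarrow> real \<Rightarrow> real" and r \<Lambda> :: real
  assumes \<kappa>: "\<And>i j. coeff (\<kappa> i j)"
    and \<kappa>_0: "\<And>i j. \<kappa> i j 0 = (if i = j then 1 else 0)"
    and N_measurable: "\<And>j. N j \<in> borel_measurable borel"
    and N_0: "\<And>j. N j 0 = 0"
    and N_diff: "\<And>j a b. \<bar>a\<bar> \<le> 1 \<Longrightarrow> \<bar>b\<bar> \<le> 1 \<Longrightarrow>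
       \<bar>N j a - N j b\<bar> \<le> \<Lambda> * max \<bar>a\<bar> \<bar>b\<bar> powr (r - 1) * \<bar>a - b\<bar>"
    and \<Lambda>: "\<Lambda> \<ge> 0" and r: "r > 1" and supercritical: "\<gamma> * (r - 1) > 1"
begin

definition "k = \<gamma> * (r - 1)"

lemma k: "k > 1" using supercritical by (simp add: k_def)

text \<open>
  Two factors are gained from the nonlinearity: \<open>M\<^sup>r\<^sup>-\<^sup>1\<close>, which makes the iteration contract for small
  \<open>M\<close>, and \<open>(1 + t)\<^sup>-\<^sup>k\<close> with \<open>k > 1\<close>, which makes the Duhamel integral converge.
\<close>

lemma nonlinearity_source:
  assumes w: "decaying M w" and w': "decaying M w'" and e: "decaying E (\<lambda>t x. w t x - w' t x)" and M: "M \<le> 1"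
  shows "source k (\<Lambda> * M powr (r - 1) * E) (\<lambda>t x. N j (w t x) - N j (w' t x))"
  unfolding source_def
proof (intro conjI allI impI)
  have M0: "M \<ge> 0" by (rule decaying_nonneg[OF w])
  have E0: "E \<ge> 0" by (rule decaying_nonneg[OF e])
  note [measurable] = N_measurable
  have [measurable]: "(\<lambda>p. w (fst p) (snd p)) \<in> borel_measurable (borel \<Otimes>\<^sub>M borel)"
    "(\<lambda>p. w' (fst p) (snd p)) \<in> borel_measurable (borel \<Otimes>\<^sub>M borel)"
    using w w' by (auto simp: decaying_def case_prod_beta')
  show m: "(\<lambda>(t, x). N j (w t x) - N j (w' t x)) \<in> borel_measurable (borel \<Otimes>\<^sub>M borel)"
    unfolding case_prod_beta' by measurable
  fix t :: real assume t: "t \<ge> 0"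
  let ?c = "\<Lambda> * M powr (r - 1) * (1 + t) powr (- k)"
  have c0: "?c \<ge> 0" using \<Lambda> by simp
  have p: "\<And>x. \<bar>w t x\<bar> \<le> M * (1 + t) powr (- \<gamma>)" "\<And>x. \<bar>w' t x\<bar> \<le> M * (1 + t) powr (- \<gamma>)"
    and pe: "\<And>x. \<bar>w t x - w' t x\<bar> \<le> E * (1 + t) powr (- \<gamma>)"
    and ie: "integrable lborel (\<lambda>x. w t x - w' t x)" and Ie: "(LINT x|lborel. \<bar>w t x - w' t x\<bar>) \<le> E"
    using w w' e t by (auto simp: decaying_def)
  have "M * (1 + t) powr (- \<gamma>) \<le> 1 * 1"
    using M M0 t \<gamma> by (intro mult_mono powr_neg_le_1) auto
  then have le1: "\<bar>w t x\<bar> \<le> 1" "\<bar>w' t x\<bar> \<le> 1" for x using p[of x] by auto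
  have le: "\<bar>N j (w t x) - N j (w' t x)\<bar> \<le> ?c * \<bar>w t x - w' t x\<bar>" for x
  proof -
    have "max \<bar>w t x\<bar> \<bar>w' t x\<bar> powr (r - 1) \<le> (M * (1 + t) powr (- \<gamma>)) powr (r - 1)"
      using p r by (intro powr_mono2) auto
    also have "\<dots> = M powr (r - 1) * (1 + t) powr (- k)"
      using M0 t by (simp add: powr_mult powr_powr k_def)
    finally have "\<Lambda> * max \<bar>w t x\<bar> \<bar>w' t x\<bar> powr (r - 1) \<le> ?c"
      using \<Lambda> by (simp add: mult_left_mono mult.assoc)
    then have "\<Lambda> * max \<bar>w t x\<bar> \<bar>w' t x\<bar> powr (r - 1) * \<bar>w t x - w' t x\<bar> \<le> ?c * \<bar>w t x - w' t x\<bar>"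
      by (rule mult_right_mono) simp
    then show ?thesis using N_diff[OF le1[of x], of j] by linarith
  qed
  show "\<bar>N j (w t x) - N j (w' t x)\<bar> \<le> \<Lambda> * M powr (r - 1) * E * ((1 + t) powr (- \<gamma>) * (1 + t) powr (- k))" for x
    using le[of x] mult_left_mono[OF pe[of x] c0] by (simp add: mult_ac)
  have [measurable]: "w t \<in> borel_measurable borel" "w' t \<in> borel_measurable borel"
    using w w' t by (auto simp: decaying_def)
  show i: "integrable lborel (\<lambda>x. N j (w t x) - N j (w' t x))"
  proof (rule Bochner_Integration.integrable_bound)
    show "integrable lborel (\<lambda>x. ?c * (w t x - w' t x))" using ie by (rule integrable_mult_right)
    show "AE x in lborel. norm (N j (w t x) - N j (w' t x)) \<le> norm (?c * (w t x - w' t x))"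
      using le by (intro AE_I2) (simp add: abs_mult abs_of_nonneg[OF \<Lambda>])
  qed measurable
  have "(LINT x|lborel. \<bar>N j (w t x) - N j (w' t x)\<bar>) \<le> (LINT x|lborel. ?c * \<bar>w t x - w' t x\<bar>)"
    using i ie le by (intro integral_mono) auto
  also have "\<dots> = ?c * (LINT x|lborel. \<bar>w t x - w' t x\<bar>)" by simp
  also have "\<dots> \<le> ?c * E" by (intro mult_left_mono Ie c0)
  finally show "(LINT x|lborel. \<bar>N j (w t x) - N j (w' t x)\<bar>) \<le> \<Lambda> * M powr (r - 1) * E * (1 + t) powr (- k)"
    by (simp add: mult_ac)
qed

lemma nonlinearity_source_0:
  assumes w: "decaying M w" and M: "M \<le> 1"
  shows "source k (\<Lambda> * M powr (r - 1) * M) (\<lambda>t x. N j (w t x))"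
  using nonlinearity_source[OF w decaying_zero _ M, of M j] decaying_nonneg[OF w] w by (simp add: N_0)

definition "duh w i t x = (\<Sum>j\<in>UNIV. D (\<kappa> i j) (\<lambda>\<tau> y. N j (w j \<tau> y)) t x)"

definition "lin f i t x = (\<Sum>j\<in>UNIV. \<kappa> i j t * S t (f j) x)"

text \<open>The Lipschitz constant of \<open>duh\<close> on solutions of size \<open>M\<close>.\<close>

definition "contraction M = real CARD('k) * (duhamel_const k * (\<Lambda> * M powr (r - 1)))"

definition "lin_const = real CARD('k) * ((L + B) * 2 powr \<gamma>)"

lemma lin_const_pos: "lin_const > 0"
proof -
  have "L + B > 0" using L_ge_1 B by linarith
  then show ?thesis by (simp add: lin_const_def)
qed

lemma contraction_nonneg: "contraction M \<ge> 0"
  using duhamel_const_nonneg(1) \<Lambda> by (simp add: contraction_def)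

lemma duh_decaying:
  assumes w: "\<And>j. decaying M (w j)" and M: "M \<le> 1"
  shows "decaying (contraction M * M) (duh w i)"
proof -
  have "decaying (\<Sum>j\<in>(UNIV::'k set). duhamel_const k * (\<Lambda> * M powr (r - 1) * M)) (duh w i)"
    unfolding duh_def by (intro decaying_sum D_decaying \<kappa> nonlinearity_source_0 w M k) auto
  then show ?thesis by (simp add: contraction_def mult_ac)
qed

lemma duh_measurable:
  assumes w: "\<And>j. decaying M (w j)" and M: "M \<le> 1"
  shows "case_prod (duh w i) \<in> borel_measurable (borel \<Otimes>\<^sub>M borel)"
  using duh_decaying[OF w M] by (simp add: decaying_def)

lemma duh_diff_decaying:
  assumes w: "\<And>j. decaying M (w j)" and w': "\<And>j. decaying M (w' j)"
    and e: "\<And>j. decaying E (\<lambda>t x. w j t x - w' j t x)" and M: "M \<le> 1"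
  shows "decaying (contraction M * E) (\<lambda>t x. duh w i t x - duh w' i t x)"
proof -
  have *: "decaying (\<Sum>j\<in>(UNIV::'k set). duhamel_const k * (\<Lambda> * M powr (r - 1) * E))
      (\<lambda>t x. \<Sum>j\<in>UNIV. D (\<kappa> i j) (\<lambda>\<tau> y. N j (w j \<tau> y) - N j (w' j \<tau> y)) t x)"
    by (intro decaying_sum D_decaying \<kappa> nonlinearity_source[OF w w' e M] k) auto
  have "decaying (\<Sum>j\<in>(UNIV::'k set). duhamel_const k * (\<Lambda> * M powr (r - 1) * E)) (\<lambda>t x. duh w i t x - duh w' i t x)"
  proof (rule decaying_cong[OF *])
    show "(\<lambda>(t, x). duh w i t x - duh w' i t x) \<in> borel_measurable (borel \<Otimes>\<^sub>M borel)"
      using duh_measurable[where i=i, OF w M] duh_measurable[where i=i, OF w' M] unfolding case_prod_beta' by auto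
    fix t :: real and x assume t: "t \<ge> 0"
    have "D (\<kappa> i j) (\<lambda>\<tau> y. N j (w j \<tau> y) - N j (w' j \<tau> y)) t x =
        D (\<kappa> i j) (\<lambda>\<tau> y. N j (w j \<tau> y)) t x - D (\<kappa> i j) (\<lambda>\<tau> y. N j (w' j \<tau> y)) t x" for j
      by (rule D_diff[OF \<kappa> nonlinearity_source_0[OF w M] nonlinearity_source_0[OF w' M] k t])
    then show "duh w i t x - duh w' i t x = (\<Sum>j\<in>UNIV. D (\<kappa> i j) (\<lambda>\<tau> y. N j (w j \<tau> y) - N j (w' j \<tau> y)) t x)"
      by (simp add: duh_def sum_subtractf)
  qed
  then show ?thesis by (simp add: contraction_def mult_ac)
qed

definition bounded_data :: "real \<Rightarrow> ('k \<Rightarrow> 'a \<Rightarrow> real) \<Rightarrow> bool" where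
  "bounded_data m f \<longleftrightarrow> (\<forall>j. integrable lborel (f j) \<and> (\<forall>y. \<bar>f j y\<bar> \<le> m) \<and> (LINT y|lborel. \<bar>f j y\<bar>) \<le> m)"

lemma lin_decaying:
  assumes "bounded_data m f"
  shows "decaying (lin_const * m) (lin f i)"
proof -
  have "decaying (\<Sum>j\<in>(UNIV::'k set). (L + B) * 2 powr \<gamma> * m) (lin f i)"
    unfolding lin_def using assms unfolding bounded_data_def
    by (intro decaying_sum S_decaying \<kappa>) auto
  then show ?thesis by (simp add: lin_const_def mult_ac)
qed

primrec picard :: "('k \<Rightarrow> 'a \<Rightarrow> real) \<Rightarrow> nat \<Rightarrow> 'k \<Rightarrow> real \<Rightarrow> 'a \<Rightarrow> real" where
  "picard f 0 i = lin f i"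
| "picard f (Suc n) i = (\<lambda>t x. lin f i t x + duh (picard f n) i t x)"

definition solves :: "('k \<Rightarrow> 'a \<Rightarrow> real) \<Rightarrow> real \<Rightarrow> ('k \<Rightarrow> real \<Rightarrow> 'a \<Rightarrow> real) \<Rightarrow> bool" where
  "solves f M w \<longleftrightarrow> (\<forall>i. decaying M (w i)) \<and> (\<forall>i t x. t \<ge> 0 \<longrightarrow> w i t x = lin f i t x + duh w i t x)"

text \<open>
  The iteration takes place on functions, not on equivalence classes: all bounds hold at every
  point, consecutive iterates differ by at most \<open>M / 2\<^sup>n\<close>, and the limit satisfies the equation for
  every \<open>t \<ge> 0\<close> and \<open>x\<close>.
\<close>

theorem ex_solution:
  assumes f: "bounded_data m f" and M: "2 * (lin_const * m) \<le> M" "M \<le> 1" and q: "contraction M \<le> 1 / 2"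
  shows "\<exists>w. solves f M w"
proof -
  let ?W = "picard f"
  have m0: "m \<ge> 0" using f by (auto simp: bounded_data_def intro: order_trans[OF abs_ge_zero])
  then have M0: "M \<ge> 0" using M(1) lin_const_pos mult_nonneg_nonneg[of lin_const m] by linarith
  have qM: "contraction M * E \<le> E / 2" if "E \<ge> 0" for E using mult_right_mono[OF q that] by simp
  have W: "decaying M (?W n i)" for n i
  proof (induction n arbitrary: i)
    case 0
    show ?case using decaying_mono[OF lin_decaying[OF f], of M i] M(1) M0 by simp
  next
    case (Suc n)
    have "decaying (lin_const * m + contraction M * M) (?W (Suc n) i)"
      using decaying_add[OF lin_decaying[OF f] duh_decaying[OF Suc M(2)]] by simp
    then show ?case using M(1) qM[OF M0] by (elim decaying_mono) linarith
  qed
  have step: "decaying (M * (1/2) ^ n) (\<lambda>t x. ?W (Suc n) i t x - ?W n i t x)" for n i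
  proof (induction n arbitrary: i)
    case 0
    show ?case using decaying_mono[OF duh_decaying[of M "?W 0", OF W M(2)], of M i] qM[OF M0] M0 by simp
  next
    case (Suc n)
    have "decaying (contraction M * (M * (1/2) ^ n)) (\<lambda>t x. ?W (Suc (Suc n)) i t x - ?W (Suc n) i t x)"
      using duh_diff_decaying[of M "?W (Suc n)" "?W n", OF W W Suc M(2)] by simp
    then show ?case using qM[of "M * (1/2) ^ n"] M0 by (elim decaying_mono) simp
  qed
  have tele: "decaying (2 * M * ((1/2) ^ n - (1/2) ^ (n + l))) (\<lambda>t x. ?W (n + l) i t x - ?W n i t x)" for n l i
  proof (induction l)
    case 0
    show ?case by (simp add: decaying_zero)
  next
    case (Suc l)
    show ?case
      using decaying_add[OF Suc step[of "n + l" i]] by (simp add: algebra_simps del: picard.simps)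
  qed
  have tele': "decaying (2 * M * (1/2) ^ n) (\<lambda>t x. ?W (n + l) i t x - ?W n i t x)" for n l i
    by (rule decaying_mono[OF tele]) (use M0 in \<open>simp add: right_diff_distrib\<close>)
  have geo: "(\<lambda>n. c * (2 * M * (1/2) ^ n)) \<longlonglongrightarrow> 0" for c
    by (intro tendsto_mult_right_zero LIMSEQ_power_zero) auto
  define w where "w = (\<lambda>i t x. lim (\<lambda>n. ?W n i t x))"
  have lim: "(\<lambda>n. ?W n i t x) \<longlonglongrightarrow> w i t x" if t: "t \<ge> 0" for i t x
  proof -
    have "Cauchy (\<lambda>n. ?W n i t x)"
    proof (rule metric_CauchyI)
      fix e :: real assume "e > 0"
      then have "\<forall>\<^sub>F n in sequentially. 1 * (2 * M * (1/2) ^ n) < e / 2"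
        by (intro order_tendstoD(2)[OF geo]) simp
      then obtain n where n: "2 * M * (1/2) ^ n < e / 2"
        by (auto simp: eventually_sequentially)
      have near: "\<bar>?W a i t x - ?W n i t x\<bar> < e / 2" if "a \<ge> n" for a
        using decaying_bounded[OF tele'[of n "a - n" i] t, of x] n that by simp
      show "\<exists>n. \<forall>a\<ge>n. \<forall>b\<ge>n. dist (?W a i t x) (?W b i t x) < e"
      proof (intro exI allI impI)
        fix a b assume "n \<le> a" "n \<le> b"
        then show "dist (?W a i t x) (?W b i t x) < e"
          using near[of a] near[of b] unfolding dist_real_def by linarith
      qed
    qed
    then show ?thesis unfolding w_def by (simp add: Cauchy_convergent_iff convergent_LIMSEQ_iff)
  qed
  have wm: "case_prod (w i) \<in> borel_measurable (borel \<Otimes>\<^sub>M borel)" for i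
  proof -
    have "(\<lambda>p. ?W n i (fst p) (snd p)) \<in> borel_measurable (borel \<Otimes>\<^sub>M borel)" for n
      using W[of n i] by (simp add: decaying_def case_prod_beta')
    then show ?thesis unfolding w_def case_prod_beta' by (rule borel_measurable_lim_metric)
  qed
  have wM: "decaying M (w i)" for i
    by (rule decaying_limit[OF W wm lim])
  have wd: "decaying (2 * M * (1/2) ^ n) (\<lambda>t x. w i t x - ?W n i t x)" for n i
  proof (rule decaying_limit[OF tele'])
    show "(\<lambda>(t, x). w i t x - ?W n i t x) \<in> borel_measurable (borel \<Otimes>\<^sub>M borel)"
      using wM[of i] W[of n i] unfolding decaying_def case_prod_beta' by auto
    show "(\<lambda>l. ?W (n + l) i t x - ?W n i t x) \<longlonglongrightarrow> w i t x - ?W n i t x" if "t \<ge> 0" for t x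
      using LIMSEQ_ignore_initial_segment[OF lim[OF that], of n i x] by (intro tendsto_intros) (simp add: add.commute)
  qed
  have "w i t x = lin f i t x + duh w i t x" if t: "t \<ge> 0" for i t x
  proof (rule LIMSEQ_unique)
    show "(\<lambda>n. ?W (Suc n) i t x) \<longlonglongrightarrow> w i t x" using lim[OF t] by (rule LIMSEQ_Suc)
    have "(\<lambda>n. duh w i t x - duh (?W n) i t x) \<longlonglongrightarrow> 0"
    proof (rule Lim_null_comparison[OF _ geo[of "contraction M"]])
      show "\<forall>\<^sub>F n in sequentially. norm (duh w i t x - duh (?W n) i t x) \<le> contraction M * (2 * M * (1/2) ^ n)"
      proof (intro always_eventually allI)
        fix n
        show "norm (duh w i t x - duh (?W n) i t x) \<le> contraction M * (2 * M * (1/2) ^ n)"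
          using decaying_bounded[OF duh_diff_decaying[of M w "?W n", OF wM W wd M(2)] t] by simp
      qed
    qed
    then have "(\<lambda>n. lin f i t x + (duh w i t x - (duh w i t x - duh (?W n) i t x))) \<longlonglongrightarrow> lin f i t x + (duh w i t x - 0)"
      by (intro tendsto_intros)
    then show "(\<lambda>n. ?W (Suc n) i t x) \<longlonglongrightarrow> lin f i t x + duh w i t x" by simp
  qed
  then show ?thesis using wM by (auto simp: solves_def)
qed

end

section \<open>Continuity of the solution in time\<close>

lemma sum_abs_integral_le:
  fixes u v :: "'j \<Rightarrow> 'a::euclidean_space \<Rightarrow> real"
  assumes "finite I" "\<And>j. j \<in> I \<Longrightarrow> integrable lborel (u j)"
  shows "(LINT x|lborel. \<bar>\<Sum>j\<in>I. u j x\<bar>) \<le> (\<Sum>j\<in>I. LINT x|lborel. \<bar>u j x\<bar>)"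
proof -
  have "(LINT x|lborel. \<bar>\<Sum>j\<in>I. u j x\<bar>) \<le> (LINT x|lborel. (\<Sum>j\<in>I. \<bar>u j x\<bar>))"
    using assms by (intro integral_mono) auto
  also have "\<dots> = (\<Sum>j\<in>I. LINT x|lborel. \<bar>u j x\<bar>)"
    using assms by (intro Bochner_Integration.integral_sum) auto
  finally show ?thesis .
qed

context kernel_system
begin

lemma duh_modulus:
  assumes w: "\<And>j. decaying M (w j)" and M: "M \<le> 1" and t: "t \<ge> 0" and a: "a \<ge> 0" "a \<le> t + 1"
  shows "\<bar>duh w i a x - duh w i t x\<bar> \<le> (\<Sum>j\<in>UNIV. \<Lambda> * M powr (r - 1) * M * hmod (\<kappa> i j) t a)"
    and "(LINT x|lborel. \<bar>duh w i a x - duh w i t x\<bar>) \<le> (\<Sum>j\<in>UNIV. \<Lambda> * M powr (r - 1) * M * hmod (\<kappa> i j) t a)"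
proof -
  let ?b = "\<lambda>j \<tau> y. N j (w j \<tau> y)"
  let ?d = "\<lambda>j x. D (\<kappa> i j) (?b j) a x - D (\<kappa> i j) (?b j) t x"
  have eq: "duh w i a x - duh w i t x = (\<Sum>j\<in>UNIV. ?d j x)" for x
    by (simp add: duh_def sum_subtractf)
  note src = nonlinearity_source_0[OF w M]
  note mod = D_modulus[OF \<kappa> src k t a]
  have int: "integrable lborel (?d j)" for j
    using D_decaying[OF \<kappa>[of i j] src[of j j] k] t a by (auto simp: decaying_def)
  have "\<bar>duh w i a x - duh w i t x\<bar> \<le> (\<Sum>j\<in>UNIV. \<bar>?d j x\<bar>)" unfolding eq by (rule sum_abs)
  also have "\<dots> \<le> (\<Sum>j\<in>UNIV. \<Lambda> * M powr (r - 1) * M * hmod (\<kappa> i j) t a)"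
    by (intro sum_mono mod(1))
  finally show "\<bar>duh w i a x - duh w i t x\<bar> \<le> (\<Sum>j\<in>UNIV. \<Lambda> * M powr (r - 1) * M * hmod (\<kappa> i j) t a)" .
  have "(LINT x|lborel. \<bar>duh w i a x - duh w i t x\<bar>) \<le> (\<Sum>j\<in>UNIV. LINT x|lborel. \<bar>?d j x\<bar>)"
    unfolding eq by (rule sum_abs_integral_le) (use int in auto)
  also have "\<dots> \<le> (\<Sum>j\<in>UNIV. \<Lambda> * M powr (r - 1) * M * hmod (\<kappa> i j) t a)"
    by (intro sum_mono mod(2))
  finally show "(LINT x|lborel. \<bar>duh w i a x - duh w i t x\<bar>) \<le> (\<Sum>j\<in>UNIV. \<Lambda> * M powr (r - 1) * M * hmod (\<kappa> i j) t a)" .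
qed

lemma duh_modulus_tendsto: "((\<lambda>a. \<Sum>j\<in>UNIV. c * hmod (\<kappa> i j) t a) \<longlongrightarrow> 0) (at t within A)"
proof (rule tendsto_within_subset[of _ _ _ UNIV])
  have "((\<lambda>a. \<Sum>j\<in>UNIV. c * hmod (\<kappa> i j) t a) \<longlongrightarrow> (\<Sum>j\<in>(UNIV::'k set). c * 0)) (at t)"
    by (intro tendsto_sum tendsto_mult_left hmod_tendsto \<kappa>)
  then show "((\<lambda>a. \<Sum>j\<in>UNIV. c * hmod (\<kappa> i j) t a) \<longlongrightarrow> 0) (at t)" by simp
qed simp

lemma eventually_near_time:
  assumes "t \<ge> (0::real)"
  shows "\<forall>\<^sub>F a in at t within {0..}. 0 \<le> a \<and> a \<le> t + 1"
proof -
  have "\<forall>\<^sub>F a in at t within {0..}. a < t + 1"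
    by (rule order_tendstoD(2)[OF tendsto_ident_at]) simp
  moreover have "\<forall>\<^sub>F a in at t within {0..}. a \<in> {0..}" by (simp add: eventually_at_filter)
  ultimately show ?thesis by eventually_elim auto
qed

lemma lin_L1_continuous:
  assumes f: "bounded_data m f" and t: "t \<ge> 0"
  shows "((\<lambda>a. LINT x|lborel. \<bar>lin f i a x - lin f i t x\<bar>) \<longlongrightarrow> 0) (at t within {0..})"
proof -
  let ?u = "\<lambda>a j. (LINT x|lborel. \<bar>S a (f j) x - S t (f j) x\<bar>) + \<bar>\<kappa> i j a - \<kappa> i j t\<bar> * (LINT x|lborel. \<bar>S t (f j) x\<bar>)"
  have fi: "integrable lborel (f j)" and fb: "\<And>y. \<bar>f j y\<bar> \<le> m" for j using f by (auto simp: bounded_data_def)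
  have "((\<lambda>a. \<Sum>j\<in>UNIV. ?u a j) \<longlongrightarrow> (\<Sum>j\<in>UNIV. 0 + \<bar>\<kappa> i j t - \<kappa> i j t\<bar> * (LINT x|lborel. \<bar>S t (f j) x\<bar>))) (at t within {0..})"
  proof (intro tendsto_sum tendsto_add tendsto_mult tendsto_rabs tendsto_diff tendsto_const S_L1_continuous[OF fi fb t])
    fix j
    show "(\<kappa> i j \<longlongrightarrow> \<kappa> i j t) (at t within {0..})"
      using \<kappa>[of i j] t by (auto simp: coeff_def continuous_on_def)
  qed
  then have lim: "((\<lambda>a. \<Sum>j\<in>UNIV. ?u a j) \<longlongrightarrow> 0) (at t within {0..})" by simp
  show ?thesis
  proof (rule tendsto_sandwich[OF _ _ tendsto_const lim])
    show "\<forall>\<^sub>F a in at t within {0..}. (LINT x|lborel. \<bar>lin f i a x - lin f i t x\<bar>) \<le> (\<Sum>j\<in>UNIV. ?u a j)"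
      using eventually_near_time[OF t]
    proof eventually_elim
      case (elim a)
      then have a: "a \<ge> 0" by simp
      note Si = S_L1(1)[OF a fi] S_L1(1)[OF t fi]
      have "(LINT x|lborel. \<bar>lin f i a x - lin f i t x\<bar>) =
          (LINT x|lborel. \<bar>\<Sum>j\<in>UNIV. \<kappa> i j a * S a (f j) x - \<kappa> i j t * S t (f j) x\<bar>)"
        by (simp add: lin_def sum_subtractf)
      also have "\<dots> \<le> (\<Sum>j\<in>UNIV. LINT x|lborel. \<bar>\<kappa> i j a * S a (f j) x - \<kappa> i j t * S t (f j) x\<bar>)"
        by (rule sum_abs_integral_le) (use Si in auto)
      also have "\<dots> \<le> (\<Sum>j\<in>UNIV. ?u a j)"
      proof (rule sum_mono)
        fix j
        have "(LINT x|lborel. \<bar>\<kappa> i j a * S a (f j) x - \<kappa> i j t * S t (f j) x\<bar>) \<le>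
          (LINT x|lborel. \<bar>S a (f j) x - S t (f j) x\<bar> + \<bar>\<kappa> i j a - \<kappa> i j t\<bar> * \<bar>S t (f j) x\<bar>)"
        proof (rule integral_mono)
          fix x
          have "\<bar>\<kappa> i j a * S a (f j) x - \<kappa> i j t * S t (f j) x\<bar> =
              \<bar>\<kappa> i j a * (S a (f j) x - S t (f j) x) + (\<kappa> i j a - \<kappa> i j t) * S t (f j) x\<bar>"
            by (simp add: algebra_simps)
          also have "\<dots> \<le> \<bar>\<kappa> i j a\<bar> * \<bar>S a (f j) x - S t (f j) x\<bar> + \<bar>\<kappa> i j a - \<kappa> i j t\<bar> * \<bar>S t (f j) x\<bar>"
            by (rule order_trans[OF abs_triangle_ineq]) (simp add: abs_mult)
          also have "\<bar>\<kappa> i j a\<bar> * \<bar>S a (f j) x - S t (f j) x\<bar> \<le> \<bar>S a (f j) x - S t (f j) x\<bar>"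
            using \<kappa>[of i j] a by (intro mult_left_le_one_le) (auto simp: coeff_def)
          finally show "\<bar>\<kappa> i j a * S a (f j) x - \<kappa> i j t * S t (f j) x\<bar> \<le>
              \<bar>S a (f j) x - S t (f j) x\<bar> + \<bar>\<kappa> i j a - \<kappa> i j t\<bar> * \<bar>S t (f j) x\<bar>" by simp
        qed (use Si in auto)
        also have "\<dots> = ?u a j" using Si by simp
        finally show "(LINT x|lborel. \<bar>\<kappa> i j a * S a (f j) x - \<kappa> i j t * S t (f j) x\<bar>) \<le> ?u a j" .
      qed
      finally show ?case .
    qed
  qed (auto intro!: always_eventually integral_nonneg_AE)
qed

lemma solution_L1_continuous:
  assumes f: "bounded_data m f" and w: "solves f M w" and M: "M \<le> 1" and t: "t \<ge> 0"
  shows "((\<lambda>a. LINT x|lborel. \<bar>w i a x - w i t x\<bar>) \<longlongrightarrow> 0) (at t within {0..})"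
proof -
  have wd: "\<And>j. decaying M (w j)" and weq: "\<And>i t x. t \<ge> 0 \<Longrightarrow> w i t x = lin f i t x + duh w i t x"
    using w by (auto simp: solves_def)
  let ?c = "\<Lambda> * M powr (r - 1) * M"
  have lim: "((\<lambda>a. (LINT x|lborel. \<bar>lin f i a x - lin f i t x\<bar>) + (\<Sum>j\<in>UNIV. ?c * hmod (\<kappa> i j) t a)) \<longlongrightarrow> 0) (at t within {0..})"
    using tendsto_add[OF lin_L1_continuous[OF f t] duh_modulus_tendsto] by simp
  show ?thesis
  proof (rule tendsto_sandwich[OF _ _ tendsto_const lim])
    show "\<forall>\<^sub>F a in at t within {0..}. (LINT x|lborel. \<bar>w i a x - w i t x\<bar>) \<le>
        (LINT x|lborel. \<bar>lin f i a x - lin f i t x\<bar>) + (\<Sum>j\<in>UNIV. ?c * hmod (\<kappa> i j) t a)"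
      using eventually_near_time[OF t]
    proof eventually_elim
      case (elim a)
      have i1: "integrable lborel (lin f i a)" "integrable lborel (lin f i t)"
        using lin_decaying[where i=i, OF f] elim t by (auto simp: decaying_def)
      have i2: "integrable lborel (duh w i a)" "integrable lborel (duh w i t)"
        using duh_decaying[where i=i, OF wd M] elim t by (auto simp: decaying_def)
      have "(LINT x|lborel. \<bar>w i a x - w i t x\<bar>) \<le>
          (LINT x|lborel. \<bar>lin f i a x - lin f i t x\<bar> + \<bar>duh w i a x - duh w i t x\<bar>)"
      proof (rule integral_mono)
        have "w i a = (\<lambda>x. lin f i a x + duh w i a x)" "w i t = (\<lambda>x. lin f i t x + duh w i t x)"
          using weq elim t by auto
        then show "integrable lborel (\<lambda>x. \<bar>w i a x - w i t x\<bar>)" using i1 i2 by simp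
      qed (use i1 i2 weq elim t in auto)
      also have "\<dots> = (LINT x|lborel. \<bar>lin f i a x - lin f i t x\<bar>) + (LINT x|lborel. \<bar>duh w i a x - duh w i t x\<bar>)"
        using i1 i2 by simp
      also have "(LINT x|lborel. \<bar>duh w i a x - duh w i t x\<bar>) \<le> (\<Sum>j\<in>UNIV. ?c * hmod (\<kappa> i j) t a)"
        using elim by (intro duh_modulus(2)[OF wd M t]) auto
      finally show ?case by simp
    qed
  qed (auto intro!: always_eventually integral_nonneg_AE)
qed

lemma solution_sup_continuous:
  assumes f: "bounded_data m f" and w: "solves f M w" and M: "M \<le> 1" and t: "t > 0" and e: "e > 0"
  shows "\<forall>\<^sub>F a in at t. \<forall>x. \<bar>w i a x - w i t x\<bar> \<le> e"
proof -
  have wd: "\<And>j. decaying M (w j)" and weq: "\<And>i t x. t \<ge> 0 \<Longrightarrow> w i t x = lin f i t x + duh w i t x"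
    using w by (auto simp: solves_def)
  have "integrable lborel (f j)" and fb: "\<And>y. \<bar>f j y\<bar> \<le> m" for j using f by (auto simp: bounded_data_def)
  then have fi: "f j \<in> borel_measurable borel" for j using borel_measurable_integrable[of lborel "f j"] by simp
  let ?c = "\<Lambda> * M powr (r - 1) * M"
  have "((\<lambda>a. (\<Sum>j\<in>UNIV. m * hosc (\<kappa> i j) a t) + (\<Sum>j\<in>UNIV. ?c * hmod (\<kappa> i j) t a)) \<longlongrightarrow> (\<Sum>j\<in>(UNIV::'k set). m * 0) + 0) (at t)"
    using t by (intro tendsto_add tendsto_sum tendsto_mult_left hosc_tendsto \<kappa> duh_modulus_tendsto) auto
  then have "\<forall>\<^sub>F a in at t. (\<Sum>j\<in>UNIV. m * hosc (\<kappa> i j) a t) + (\<Sum>j\<in>UNIV. ?c * hmod (\<kappa> i j) t a) < e"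
    by (rule order_tendstoD(2)) (use e in simp)
  moreover have "\<forall>\<^sub>F a in at t. 0 < a" by (rule order_tendstoD(1)[OF tendsto_ident_at t])
  moreover have "\<forall>\<^sub>F a in at t. a < t + 1" by (rule order_tendstoD(2)[OF tendsto_ident_at]) simp
  ultimately show ?thesis
  proof eventually_elim
    case (elim a)
    show ?case
    proof
      fix x
      have "\<bar>\<kappa> i j a * S a (f j) x - \<kappa> i j t * S t (f j) x\<bar> \<le> m * hosc (\<kappa> i j) a t" for j
      proof -
        note hi = H_integrable[OF \<kappa>[of i j]]
        have "\<kappa> i j a * S a (f j) x - \<kappa> i j t * S t (f j) x = conv (H (\<kappa> i j) a) (f j) x - conv (H (\<kappa> i j) t) (f j) x"
          using t elim by (simp add: S_def H_def[abs_def] conv_cmult_left)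
        also have "\<dots> = conv (\<lambda>y. H (\<kappa> i j) a y - H (\<kappa> i j) t y) (f j) x"
          by (rule conv_diff_left[OF hi hi fb fi, symmetric])
        finally show ?thesis
          using conv_bounded(1)[of "\<lambda>y. H (\<kappa> i j) a y - H (\<kappa> i j) t y", OF _ fi fb] hi by (simp add: hosc_def)
      qed
      then have "(\<Sum>j\<in>UNIV. \<bar>\<kappa> i j a * S a (f j) x - \<kappa> i j t * S t (f j) x\<bar>) \<le> (\<Sum>j\<in>UNIV. m * hosc (\<kappa> i j) a t)"
        by (intro sum_mono) auto
      then have "\<bar>lin f i a x - lin f i t x\<bar> \<le> (\<Sum>j\<in>UNIV. m * hosc (\<kappa> i j) a t)"
        unfolding lin_def sum_subtractf[symmetric] by (rule order_trans[OF sum_abs])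
      moreover have "\<bar>duh w i a x - duh w i t x\<bar> \<le> (\<Sum>j\<in>UNIV. ?c * hmod (\<kappa> i j) t a)"
        using elim t by (intro duh_modulus(1)[OF wd M]) auto
      ultimately show "\<bar>w i a x - w i t x\<bar> \<le> e"
        using weq[of a i x] weq[of t i x] elim t by linarith
    qed
  qed
qed

text \<open>
  Only the component's own datum has to be uniformly continuous: as \<open>\<kappa> i j 0 = 0\<close> for
  \<open>i \<noteq> j\<close>, the contributions of the other data vanish uniformly as time tends to \<open>0\<close>.
\<close>

lemma solution_sup_at_0:
  assumes f: "bounded_data m f" and w: "solves f M w" and M: "M \<le> 1"
    and g: "uniformly_continuous_on UNIV g" "\<And>y. \<bar>g y\<bar> \<le> m" and fg: "AE y in lborel. f i y = g y" and e: "e > 0"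
  shows "\<forall>\<^sub>F a in at_right 0. \<forall>x. \<bar>w i a x - g x\<bar> \<le> e"
proof -
  have wd: "\<And>j. decaying M (w j)" and weq: "\<And>i t x. t \<ge> 0 \<Longrightarrow> w i t x = lin f i t x + duh w i t x"
    using w by (auto simp: solves_def)
  have "integrable lborel (f j)" and fb: "\<And>y. \<bar>f j y\<bar> \<le> m" for j using f by (auto simp: bounded_data_def)
  then have fi: "f j \<in> borel_measurable borel" for j using borel_measurable_integrable[of lborel "f j"] by simp
  have gi: "g \<in> borel_measurable borel"
    using uniformly_continuous_imp_continuous[OF g(1)] by (rule borel_measurable_continuous_onI)
  let ?c = "\<Lambda> * M powr (r - 1) * M"
  let ?\<delta> = "\<lambda>j. if i = j then 1 else 0 :: real"
  have \<kappa>lim: "(\<kappa> i j \<longlongrightarrow> ?\<delta> j) (at_right 0)" for j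
  proof -
    have "(\<kappa> i j \<longlongrightarrow> \<kappa> i j 0) (at 0 within {0..})"
      using \<kappa>[of i j] by (auto simp: coeff_def continuous_on_def)
    then show ?thesis unfolding \<kappa>_0 by (rule tendsto_within_subset) auto
  qed
  have "((\<lambda>a. (\<Sum>j\<in>UNIV. \<bar>\<kappa> i j a - ?\<delta> j\<bar> * (m * L)) + (\<Sum>j\<in>UNIV. ?c * hmod (\<kappa> i j) 0 a)) \<longlongrightarrow>
      (\<Sum>j\<in>UNIV. \<bar>?\<delta> j - ?\<delta> j\<bar> * (m * L)) + 0) (at_right 0)"
    by (intro tendsto_add tendsto_sum tendsto_mult_right tendsto_rabs tendsto_diff tendsto_const \<kappa>lim duh_modulus_tendsto)
  then have "\<forall>\<^sub>F a in at_right 0. (\<Sum>j\<in>UNIV. \<bar>\<kappa> i j a - ?\<delta> j\<bar> * (m * L)) + (\<Sum>j\<in>UNIV. ?c * hmod (\<kappa> i j) 0 a) < e / 2"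
    by (rule order_tendstoD(2)) (use e in simp)
  moreover have "\<forall>\<^sub>F a in at_right (0::real). 0 < a" by (simp add: eventually_at_filter)
  moreover have "\<forall>\<^sub>F a in at_right (0::real). a < 1" by (rule order_tendstoD(2)[OF tendsto_ident_at]) simp
  moreover have "\<forall>\<^sub>F a in at_right 0. \<forall>x. \<bar>S a g x - g x\<bar> \<le> e / 2"
    by (rule S_uniform_at_0[OF g]) (use e in simp)
  ultimately show ?thesis
  proof eventually_elim
    case (elim a)
    show ?case
    proof
      fix x
      have Sg: "S a (f i) x = S a g x"
        using elim conv_cong_AE[OF fg _ fi gi, of "K a"] by (simp add: S_def)
      have "lin f i a x - S a g x = (\<Sum>j\<in>UNIV. (\<kappa> i j a - ?\<delta> j) * S a (f j) x)"
        by (simp add: lin_def left_diff_distrib sum_subtractf if_distrib[of "\<lambda>c. c * _"] Sg cong: if_cong)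
      also have "\<bar>\<dots>\<bar> \<le> (\<Sum>j\<in>UNIV. \<bar>\<kappa> i j a - ?\<delta> j\<bar> * \<bar>S a (f j) x\<bar>)"
        by (rule order_trans[OF sum_abs]) (simp add: abs_mult)
      also have "\<dots> \<le> (\<Sum>j\<in>UNIV. \<bar>\<kappa> i j a - ?\<delta> j\<bar> * (m * L))"
        using elim by (intro sum_mono mult_left_mono S_bounded fi fb) auto
      finally have 1: "\<bar>lin f i a x - S a g x\<bar> \<le> (\<Sum>j\<in>UNIV. \<bar>\<kappa> i j a - ?\<delta> j\<bar> * (m * L))" .
      have "duh w i 0 x = 0" by (simp add: duh_def D_at_0)
      moreover have "\<bar>duh w i a x - duh w i 0 x\<bar> \<le> (\<Sum>j\<in>UNIV. ?c * hmod (\<kappa> i j) 0 a)"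
        using elim by (intro duh_modulus(1)[OF wd M]) auto
      ultimately have 2: "\<bar>duh w i a x\<bar> \<le> (\<Sum>j\<in>UNIV. ?c * hmod (\<kappa> i j) 0 a)"
        by simp
      have 3: "\<bar>S a g x - g x\<bar> \<le> e / 2" using elim(4) by blast
      show "\<bar>w i a x - g x\<bar> \<le> e"
        using 1 2 3 elim(1) weq[of a i x] elim(2) by linarith
    qed
  qed
qed

section \<open>Mild solutions and their uniqueness\<close>

definition mild :: "('k \<Rightarrow> 'a \<Rightarrow> real) \<Rightarrow> ('k \<Rightarrow> real \<Rightarrow> 'a \<Rightarrow> real) \<Rightarrow> bool" where
  "mild f w \<longleftrightarrow> (\<forall>i. \<forall>t\<ge>0. AE x in lborel.
     set_integrable lborel {0..t} (\<lambda>\<tau>. \<Sum>j\<in>UNIV. \<kappa> i j (t - \<tau>) * S (t - \<tau>) (\<lambda>y. N j (w j \<tau> y)) x) \<and>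
     w i t x = lin f i t x +
       (LINT \<tau>:{0..t}|lborel. \<Sum>j\<in>UNIV. \<kappa> i j (t - \<tau>) * S (t - \<tau>) (\<lambda>y. N j (w j \<tau> y)) x))"

definition L1_curve :: "(real \<Rightarrow> 'a \<Rightarrow> real) \<Rightarrow> bool" where
  "L1_curve w \<longleftrightarrow> (\<forall>t\<ge>0. integrable lborel (w t)) \<and>
     (\<forall>t\<ge>0. ((\<lambda>a. LINT x|lborel. \<bar>w a x - w t x\<bar>) \<longlongrightarrow> 0) (at t within {0..}))"

definition locally_bounded :: "(real \<Rightarrow> 'a \<Rightarrow> real) \<Rightarrow> bool" where
  "locally_bounded w \<longleftrightarrow> (\<forall>T. \<exists>R. \<forall>t\<in>{0..T}. AE x in lborel. \<bar>w t x\<bar> \<le> R)"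

lemma solution_mild:
  assumes w: "solves f M w" and M: "M \<le> 1"
  shows "mild f w"
  unfolding mild_def
proof (intro allI impI AE_I2 conjI)
  have wd: "\<And>j. decaying M (w j)" and weq: "\<And>i t x. t \<ge> 0 \<Longrightarrow> w i t x = lin f i t x + duh w i t x"
    using w by (auto simp: solves_def)
  fix i and t :: real and x :: 'a assume t: "t \<ge> 0"
  note D = D_eq_set_integral[OF \<kappa> nonlinearity_source_0[OF wd M] k t]
  show "set_integrable lborel {0..t} (\<lambda>\<tau>. \<Sum>j\<in>UNIV. \<kappa> i j (t - \<tau>) * S (t - \<tau>) (\<lambda>y. N j (w j \<tau> y)) x)"
    using D(1) unfolding set_integrable_def scaleR_sum_right by (intro Bochner_Integration.integrable_sum) auto
  have "(LINT \<tau>:{0..t}|lborel. \<Sum>j\<in>UNIV. \<kappa> i j (t - \<tau>) * S (t - \<tau>) (\<lambda>y. N j (w j \<tau> y)) x) =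
      (\<Sum>j\<in>UNIV. LINT \<tau>:{0..t}|lborel. \<kappa> i j (t - \<tau>) * S (t - \<tau>) (\<lambda>y. N j (w j \<tau> y)) x)"
    using D(1) unfolding set_integrable_def set_lebesgue_integral_def scaleR_sum_right
    by (intro Bochner_Integration.integral_sum) auto
  then show "w i t x = lin f i t x + (LINT \<tau>:{0..t}|lborel. \<Sum>j\<in>UNIV. \<kappa> i j (t - \<tau>) * S (t - \<tau>) (\<lambda>y. N j (w j \<tau> y)) x)"
    using weq[OF t, of i x] D(2) by (simp add: duh_def)
qed

text \<open>
  A mild solution is not assumed to be measurable jointly in time and space.  For an
  \<open>L\<^sup>1\<close>-continuous source the function \<open>G\<close> still is, being the limit of the functions
  belonging to sources that are piecewise constant in time.
\<close>

lemma G_measurable_L1_curve: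
  assumes \<kappa>': "coeff \<kappa>'" and b: "L1_curve b" and bb: "\<And>\<tau> y. \<bar>b \<tau> y\<bar> \<le> R"
  shows "(\<lambda>p. G \<kappa>' b t (fst p) (snd p)) \<in> borel_measurable (borel \<Otimes>\<^sub>M borel)"
proof -
  define \<theta> where "\<theta> = (\<lambda>n \<tau>. max 0 (real_of_int \<lfloor>real (Suc n) * \<tau>\<rfloor> / real (Suc n)))"
  have bi: "integrable lborel (b \<tau>)" if "\<tau> \<ge> 0" for \<tau> using b that by (simp add: L1_curve_def)
  have bm: "case_prod (\<lambda>\<tau>. b (\<theta> n \<tau>)) \<in> borel_measurable (borel \<Otimes>\<^sub>M borel)" for n
  proof -
    have "(\<lambda>p. b (max 0 (real_of_int \<lfloor>real (Suc n) * fst p\<rfloor> / real (Suc n))) (snd p)) \<in> borel_measurable (borel \<Otimes>\<^sub>M borel)"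
    proof (rule measurable_compose_countable[where g="\<lambda>p. \<lfloor>real (Suc n) * fst p\<rfloor>"])
      fix i :: int
      have [measurable]: "b (max 0 (real_of_int i / real (Suc n))) \<in> borel_measurable borel"
        using bi[of "max 0 (real_of_int i / real (Suc n))"] by auto
      show "(\<lambda>p. b (max 0 (real_of_int i / real (Suc n))) (snd p)) \<in> borel_measurable (borel \<Otimes>\<^sub>M borel)"
        by measurable
    qed measurable
    then show ?thesis by (simp add: \<theta>_def case_prod_beta')
  qed
  have "(\<lambda>p. lim (\<lambda>n. G \<kappa>' (\<lambda>\<tau>. b (\<theta> n \<tau>)) t (fst p) (snd p))) \<in> borel_measurable (borel \<Otimes>\<^sub>M borel)"
    by (intro borel_measurable_lim_metric G_measurable[OF \<kappa>' bm]) measurable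
  moreover have "(\<lambda>n. G \<kappa>' (\<lambda>\<tau>. b (\<theta> n \<tau>)) t \<tau> x) \<longlonglongrightarrow> G \<kappa>' b t \<tau> x" for \<tau> x
  proof (cases "\<tau> \<ge> 0")
    case True
    have \<theta>0: "\<theta> n \<tau> \<ge> 0" for n by (simp add: \<theta>_def)
    have lim\<theta>: "(\<lambda>n. \<theta> n \<tau>) \<longlonglongrightarrow> \<tau>"
    proof (rule real_tendsto_sandwich[OF _ _ LIMSEQ_inverse_real_of_nat_add_minus[of \<tau>] tendsto_const])
      have "\<tau> + - inverse (real (Suc n)) \<le> \<theta> n \<tau>" "\<theta> n \<tau> \<le> \<tau>" for n
      proof -
        have "real (Suc n) * \<tau> - 1 \<le> real_of_int \<lfloor>real (Suc n) * \<tau>\<rfloor>" by linarith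
        then have "(real (Suc n) * \<tau> - 1) / real (Suc n) \<le> real_of_int \<lfloor>real (Suc n) * \<tau>\<rfloor> / real (Suc n)"
          by (rule divide_right_mono) simp
        then show "\<tau> + - inverse (real (Suc n)) \<le> \<theta> n \<tau>"
          unfolding \<theta>_def by (simp add: diff_divide_distrib inverse_eq_divide)
        have "real_of_int \<lfloor>real (Suc n) * \<tau>\<rfloor> / real (Suc n) \<le> (real (Suc n) * \<tau>) / real (Suc n)"
          by (intro divide_right_mono of_int_floor_le) simp
        then show "\<theta> n \<tau> \<le> \<tau>" using True unfolding \<theta>_def by simp
      qed
      then show "\<forall>\<^sub>F n in sequentially. \<tau> + - inverse (real (Suc n)) \<le> \<theta> n \<tau>"
        "\<forall>\<^sub>F n in sequentially. \<theta> n \<tau> \<le> \<tau>" by auto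
    qed
    have cont: "continuous (at \<tau> within {0..}) (\<lambda>a. LINT x|lborel. \<bar>b a x - b \<tau> x\<bar>)"
      using b True by (simp add: continuous_within L1_curve_def)
    have lim: "(\<lambda>n. LINT x|lborel. \<bar>b (\<theta> n \<tau>) x - b \<tau> x\<bar>) \<longlonglongrightarrow> 0"
      using continuous_within_tendsto_compose'[OF cont _ lim\<theta>] \<theta>0 by simp
    have "(\<lambda>n. G \<kappa>' (\<lambda>\<tau>. b (\<theta> n \<tau>)) t \<tau> x - G \<kappa>' b t \<tau> x) \<longlonglongrightarrow> 0"
    proof (rule Lim_null_comparison)
      show "(\<lambda>n. B * (t - \<tau>) powr (- \<gamma>) * (LINT x|lborel. \<bar>b (\<theta> n \<tau>) x - b \<tau> x\<bar>)) \<longlonglongrightarrow> 0"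
        by (intro tendsto_mult_right_zero lim)
      show "\<forall>\<^sub>F n in sequentially. norm (G \<kappa>' (\<lambda>\<tau>. b (\<theta> n \<tau>)) t \<tau> x - G \<kappa>' b t \<tau> x) \<le>
          B * (t - \<tau>) powr (- \<gamma>) * (LINT x|lborel. \<bar>b (\<theta> n \<tau>) x - b \<tau> x\<bar>)"
      proof (intro always_eventually allI)
        fix n
        have m: "b (\<theta> n \<tau>) \<in> borel_measurable borel" "b \<tau> \<in> borel_measurable borel"
          using bi[OF \<theta>0] bi[OF True] by auto
        have "G \<kappa>' (\<lambda>\<tau>. b (\<theta> n \<tau>)) t \<tau> x - G \<kappa>' b t \<tau> x = conv (H \<kappa>' (t - \<tau>)) (\<lambda>y. b (\<theta> n \<tau>) y - b \<tau> y) x"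
          using True conv_diff_right[OF H_integrable[OF \<kappa>'] bb bb m] by (simp add: G_def)
        also have "\<bar>\<dots>\<bar> \<le> B * (t - \<tau>) powr (- \<gamma>) * (LINT x|lborel. \<bar>b (\<theta> n \<tau>) x - b \<tau> x\<bar>)"
          using bi[OF \<theta>0] bi[OF True]
          by (intro conv_bounded'[OF H_section_measurable[OF \<kappa>'] H_bounded[OF \<kappa>']]) auto
        finally show "norm (G \<kappa>' (\<lambda>\<tau>. b (\<theta> n \<tau>)) t \<tau> x - G \<kappa>' b t \<tau> x) \<le>
          B * (t - \<tau>) powr (- \<gamma>) * (LINT x|lborel. \<bar>b (\<theta> n \<tau>) x - b \<tau> x\<bar>)" by simp
      qed
    qed
    then show ?thesis by (rule LIM_zero_cancel)
  qed (simp add: G_def)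
  then have "lim (\<lambda>n. G \<kappa>' (\<lambda>\<tau>. b (\<theta> n \<tau>)) t \<tau> x) = G \<kappa>' b t \<tau> x" for \<tau> x
    by (rule limI)
  ultimately show ?thesis by simp
qed

end

text \<open>Gronwall's lemma, read off from the maximum of \<open>d t exp (- l t)\<close> for a large \<open>l\<close>.\<close>

lemma gronwall_zero:
  fixes d :: "real \<Rightarrow> real"
  assumes cont: "continuous_on {0..T} d" and nn: "\<And>t. t \<in> {0..T} \<Longrightarrow> d t \<ge> 0" and C: "C \<ge> 0"
    and le: "\<And>t. t \<in> {0..T} \<Longrightarrow> d t \<le> C * (LINT \<tau>|lborel. indicator {0..t} \<tau> * d \<tau>)"
    and t: "t \<in> {0..T}"
  shows "d t = 0"
proof -
  define l where "l = 2 * C + 1"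
  have l: "l > 0" using C by (simp add: l_def)
  have "continuous_on {0..T} (\<lambda>t. d t * exp (- l * t))"
    by (intro continuous_intros cont)
  then obtain z where z: "z \<in> {0..T}" "\<And>t. t \<in> {0..T} \<Longrightarrow> d t * exp (- l * t) \<le> d z * exp (- l * z)"
    using continuous_attains_sup[of "{0..T}" "\<lambda>t. d t * exp (- l * t)"] t by auto
  define m where "m = d z * exp (- l * z)"
  have m0: "m \<ge> 0" using nn z by (simp add: m_def)
  have dm: "d \<tau> \<le> m * exp (l * \<tau>)" if "\<tau> \<in> {0..T}" for \<tau>
  proof -
    have "d \<tau> = (d \<tau> * exp (- l * \<tau>)) * exp (l * \<tau>)"
      by (simp add: mult.assoc exp_add[symmetric])
    also have "\<dots> \<le> m * exp (l * \<tau>)"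
      using z(2)[OF that] unfolding m_def by (rule mult_right_mono) simp
    finally show ?thesis .
  qed
  have FTC: "has_bochner_integral lborel (\<lambda>\<tau>. exp (l * \<tau>) * indicator {0..z} \<tau>) (exp (l * z) / l - exp (l * 0) / l)"
    using z l by (intro has_bochner_integral_FTC_Icc_real) (auto intro!: derivative_eq_intros continuous_intros)
  have "(LINT \<tau>|lborel. indicator {0..z} \<tau> * d \<tau>) \<le> (LINT \<tau>|lborel. m * (exp (l * \<tau>) * indicator {0..z} \<tau>))"
  proof (rule integral_mono)
    have "continuous_on {0..z} d" using cont z by (auto intro: continuous_on_subset)
    then show "integrable lborel (\<lambda>\<tau>. indicator {0..z} \<tau> * d \<tau>)"
      using borel_integrable_atLeastAtMost'[of 0 z d] by (simp add: set_integrable_def)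
    show "integrable lborel (\<lambda>\<tau>. m * (exp (l * \<tau>) * indicator {0..z} \<tau>))"
      using FTC by (intro integrable_mult_right) (auto simp: has_bochner_integral_iff)
    show "indicator {0..z} \<tau> * d \<tau> \<le> m * (exp (l * \<tau>) * indicator {0..z} \<tau>)" for \<tau>
      using dm[of \<tau>] z by (auto simp: indicator_def)
  qed
  also have "\<dots> = m * (exp (l * z) / l - exp (l * 0) / l)"
    using FTC by (simp add: has_bochner_integral_iff)
  also have "\<dots> \<le> m * (exp (l * z) / l)"
    using m0 l by (intro mult_left_mono) auto
  finally have "d z \<le> C * (m * (exp (l * z) / l))"
    using le[OF z(1)] mult_left_mono[OF _ C] by fastforce
  then have "d z * exp (- l * z) \<le> C * (m * (exp (l * z) / l)) * exp (- l * z)"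
    by (rule mult_right_mono) simp
  also have "\<dots> = C / l * m" by (simp add: exp_minus field_simps)
  finally have "m \<le> C / l * m" by (simp add: m_def)
  moreover have "C / l \<le> 1 / 2" using C l by (simp add: l_def field_simps)
  ultimately have "m \<le> 1 / 2 * m" using mult_right_mono[of "C / l" "1 / 2" m] m0 by linarith
  then have "m = 0" using m0 by simp
  then show ?thesis using dm[OF t] nn[OF t] by simp
qed

context kernel_system
begin

text \<open>
  With \<open>\<Delta> j t\<close> the \<open>L\<^sup>1\<close> distance of the \<open>j\<close>-th components, the Duhamel integrals of the
  differences \<open>b j\<close> of the nonlinear terms give \<open>\<Delta> i t \<le> C \<Sum>\<^sub>j \<integral>\<^sub>0\<^sup>t \<Delta> j\<close>.
\<close>

theorem mild_unique:
  assumes lip: "\<And>R. \<exists>\<Lambda>'. \<forall>j a b. \<bar>a\<bar> \<le> R \<longrightarrow> \<bar>b\<bar> \<le> R \<longrightarrow> \<bar>N j a - N j b\<bar> \<le> \<Lambda>' * \<bar>a - b\<bar>"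
    and w: "\<And>j. L1_curve (w j)" "\<And>j. locally_bounded (w j)" "mild f w"
    and w': "\<And>j. L1_curve (w' j)" "\<And>j. locally_bounded (w' j)" "mild f w'"
    and T: "T \<ge> 0"
  shows "AE x in lborel. w i T x = w' i T x"
proof -
  have "\<forall>j. \<exists>R. \<forall>t\<in>{0..T}. AE x in lborel. \<bar>w j t x\<bar> \<le> R"
    using w(2) unfolding locally_bounded_def by blast
  then obtain R1 where R1: "\<And>j. \<forall>t\<in>{0..T}. AE x in lborel. \<bar>w j t x\<bar> \<le> R1 j"
    unfolding choice_iff by blast
  have "\<forall>j. \<exists>R. \<forall>t\<in>{0..T}. AE x in lborel. \<bar>w' j t x\<bar> \<le> R"
    using w'(2) unfolding locally_bounded_def by blast
  then obtain R2 where R2: "\<And>j. \<forall>t\<in>{0..T}. AE x in lborel. \<bar>w' j t x\<bar> \<le> R2 j"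
    unfolding choice_iff by blast
  define R0 where "R0 = (\<Sum>j\<in>UNIV. \<bar>R1 j\<bar> + \<bar>R2 j\<bar>)"
  have le: "R1 j \<le> R0" "R2 j \<le> R0" for j
  proof -
    have "\<bar>R1 j\<bar> + \<bar>R2 j\<bar> \<le> R0"
      unfolding R0_def by (rule member_le_sum) auto
    then show "R1 j \<le> R0" "R2 j \<le> R0" by linarith+
  qed
  have R0: "AE x in lborel. \<bar>w j t x\<bar> \<le> R0" "AE x in lborel. \<bar>w' j t x\<bar> \<le> R0" if t: "t \<in> {0..T}" for j t
  proof -
    show "AE x in lborel. \<bar>w j t x\<bar> \<le> R0"
      using bspec[OF R1[of j] t] by eventually_elim (use le(1)[of j] in linarith)
    show "AE x in lborel. \<bar>w' j t x\<bar> \<le> R0"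
      using bspec[OF R2[of j] t] by eventually_elim (use le(2)[of j] in linarith)
  qed
  define R where "R = max R0 0"
  have R: "R \<ge> 0" "AE x in lborel. \<bar>w j t x\<bar> \<le> R" "AE x in lborel. \<bar>w' j t x\<bar> \<le> R" if "t \<in> {0..T}" for j t
    using R0[OF that, of j] by (auto simp: R_def max.coboundedI1 elim: eventually_mono)
  have R00: "R \<ge> 0" by (simp add: R_def)
  obtain \<Lambda>0 where \<Lambda>0: "\<And>j a b. \<bar>a\<bar> \<le> R \<Longrightarrow> \<bar>b\<bar> \<le> R \<Longrightarrow> \<bar>N j a - N j b\<bar> \<le> \<Lambda>0 * \<bar>a - b\<bar>"
    using lip[of R] by blast
  define \<Lambda>' where "\<Lambda>' = max \<Lambda>0 0"
  have \<Lambda>'0: "\<Lambda>' \<ge> 0" by (simp add: \<Lambda>'_def)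
  \<comment> \<open>The cut-off changes the solutions on null sets only, and makes all bounds hold everywhere.\<close>
  define cut where "cut = (\<lambda>a::real. max (- R) (min R a))"
  have cut: "\<bar>cut a\<bar> \<le> R" "\<bar>cut a - cut b\<bar> \<le> \<bar>a - b\<bar>" "\<bar>a\<bar> \<le> R \<Longrightarrow> cut a = a" for a b
    using R00 by (auto simp: cut_def)
  have [measurable]: "cut \<in> borel_measurable borel" unfolding cut_def by measurable
  have Ncut: "\<bar>N j (cut a) - N j (cut b)\<bar> \<le> \<Lambda>' * \<bar>a - b\<bar>" for j a b
  proof -
    have "\<bar>N j (cut a) - N j (cut b)\<bar> \<le> \<Lambda>0 * \<bar>cut a - cut b\<bar>" by (intro \<Lambda>0 cut)
    also have "\<dots> \<le> \<Lambda>' * \<bar>a - b\<bar>"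
      using cut(2)[of a b] by (intro mult_mono) (auto simp: \<Lambda>'_def)
    finally show ?thesis .
  qed
  have Nb: "\<bar>N j (cut a)\<bar> \<le> \<Lambda>' * R" for j a
  proof -
    have "\<bar>N j (cut a) - N j 0\<bar> \<le> \<Lambda>0 * \<bar>cut a - 0\<bar>" using R00 by (intro \<Lambda>0 cut) auto
    also have "\<dots> \<le> \<Lambda>' * R" using cut(1)[of a] by (intro mult_mono) (auto simp: \<Lambda>'_def)
    finally show ?thesis by (simp add: N_0)
  qed
  note [measurable] = N_measurable
  have wi: "integrable lborel (w j t)" "integrable lborel (w' j t)" if "t \<ge> 0" for j t
    using w(1) w'(1) that by (auto simp: L1_curve_def)
  define b where "b = (\<lambda>j t y. N j (cut (w j t y)) - N j (cut (w' j t y)))"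
  define \<Delta> where "\<Delta> = (\<lambda>j t. LINT y|lborel. \<bar>w j t y - w' j t y\<bar>)"
  have \<Delta>0: "\<Delta> j t \<ge> 0" for j t unfolding \<Delta>_def by (intro integral_nonneg_AE) auto
  have b_le: "\<bar>b j t y\<bar> \<le> \<Lambda>' * \<bar>w j t y - w' j t y\<bar>" for j t y unfolding b_def by (rule Ncut)
  have b_bd: "\<bar>b j t y\<bar> \<le> \<Lambda>' * R + \<Lambda>' * R" for j t y
    unfolding b_def using Nb[of j "w j t y"] Nb[of j "w' j t y"] by linarith
  have bi: "integrable lborel (b j t)" if t: "t \<ge> 0" for j t
  proof (rule Bochner_Integration.integrable_bound)
    have [measurable]: "w j t \<in> borel_measurable borel" "w' j t \<in> borel_measurable borel" using wi[OF t] by auto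
    show "b j t \<in> borel_measurable lborel" unfolding b_def by measurable
    show "integrable lborel (\<lambda>y. \<Lambda>' * \<bar>w j t y - w' j t y\<bar>)" using wi[OF t] by auto
    show "AE y in lborel. norm (b j t y) \<le> norm (\<Lambda>' * \<bar>w j t y - w' j t y\<bar>)"
      using order_trans[OF b_le abs_ge_self] by (intro AE_I2) (simp only: real_norm_def)
  qed
  have bI: "(LINT y|lborel. \<bar>b j t y\<bar>) \<le> \<Lambda>' * \<Delta> j t" if t: "t \<ge> 0" for j t
  proof -
    have "(LINT y|lborel. \<bar>b j t y\<bar>) \<le> (LINT y|lborel. \<Lambda>' * \<bar>w j t y - w' j t y\<bar>)"
      using bi[OF t] wi[OF t] by (intro integral_mono b_le) auto
    then show ?thesis by (simp add: \<Delta>_def)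
  qed
  have b_curve: "L1_curve (b j)" for j
    unfolding L1_curve_def
  proof (intro conjI allI impI bi)
    fix t :: real assume t: "t \<ge> 0"
    let ?u = "\<lambda>a. \<Lambda>' * ((LINT y|lborel. \<bar>w j a y - w j t y\<bar>) + (LINT y|lborel. \<bar>w' j a y - w' j t y\<bar>))"
    have "(?u \<longlongrightarrow> \<Lambda>' * (0 + 0)) (at t within {0..})"
      using w(1)[of j] w'(1)[of j] t unfolding L1_curve_def by (intro tendsto_intros) auto
    then have lim: "(?u \<longlongrightarrow> 0) (at t within {0..})" by simp
    show "((\<lambda>a. LINT x|lborel. \<bar>b j a x - b j t x\<bar>) \<longlongrightarrow> 0) (at t within {0..})"
    proof (rule tendsto_sandwich[OF _ _ tendsto_const lim])
      show "\<forall>\<^sub>F a in at t within {0..}. (LINT x|lborel. \<bar>b j a x - b j t x\<bar>) \<le> ?u a"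
        using eventually_near_time[OF t]
      proof eventually_elim
        case (elim a)
        then have a: "a \<ge> 0" by simp
        have "(LINT x|lborel. \<bar>b j a x - b j t x\<bar>) \<le>
            (LINT x|lborel. \<Lambda>' * (\<bar>w j a x - w j t x\<bar> + \<bar>w' j a x - w' j t x\<bar>))"
        proof (rule integral_mono)
          fix x
          show "\<bar>b j a x - b j t x\<bar> \<le> \<Lambda>' * (\<bar>w j a x - w j t x\<bar> + \<bar>w' j a x - w' j t x\<bar>)"
            using Ncut[of j "w j a x" "w j t x"] Ncut[of j "w' j a x" "w' j t x"]
            unfolding b_def distrib_left by linarith
        qed (use bi[OF a] bi[OF t] wi[OF a] wi[OF t] in auto)
        also have "\<dots> = ?u a" using wi[OF a] wi[OF t] by simp
        finally show ?case .
      qed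
    qed (auto intro!: always_eventually integral_nonneg_AE)
  qed
  have \<Delta>_cont: "continuous_on {0..} (\<Delta> j)" for j
    unfolding continuous_on_def
  proof (intro ballI)
    fix t :: real assume "t \<in> {0..}"
    then have t: "t \<ge> 0" by simp
    let ?u = "\<lambda>a. (LINT y|lborel. \<bar>w j a y - w j t y\<bar>) + (LINT y|lborel. \<bar>w' j a y - w' j t y\<bar>)"
    have "(?u \<longlongrightarrow> 0 + 0) (at t within {0..})"
      using w(1)[of j] w'(1)[of j] t unfolding L1_curve_def by (intro tendsto_intros) auto
    then have lim: "(?u \<longlongrightarrow> 0) (at t within {0..})" by simp
    have "((\<lambda>a. \<Delta> j a - \<Delta> j t) \<longlongrightarrow> 0) (at t within {0..})"
    proof (rule Lim_null_comparison[OF _ lim])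
      show "\<forall>\<^sub>F a in at t within {0..}. norm (\<Delta> j a - \<Delta> j t) \<le> ?u a"
        using eventually_near_time[OF t]
      proof eventually_elim
        case (elim a)
        then have a: "a \<ge> 0" by simp
        note i = wi[OF a, of j] wi[OF t, of j]
        have "\<Delta> j a - \<Delta> j t = (LINT y|lborel. \<bar>w j a y - w' j a y\<bar> - \<bar>w j t y - w' j t y\<bar>)"
          using i by (simp add: \<Delta>_def)
        also have "\<bar>\<dots>\<bar> \<le> (LINT y|lborel. \<bar>\<bar>w j a y - w' j a y\<bar> - \<bar>w j t y - w' j t y\<bar>\<bar>)"
          by (rule integral_abs_bound)
        also have "\<dots> \<le> (LINT y|lborel. \<bar>w j a y - w j t y\<bar> + \<bar>w' j a y - w' j t y\<bar>)"
          using i by (intro integral_mono) auto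
        also have "\<dots> = ?u a" using i by simp
        finally show ?case by simp
      qed
    qed
    then show "(\<Delta> j \<longlongrightarrow> \<Delta> j t) (at t within {0..})" by (rule LIM_zero_cancel)
  qed
  have \<Delta>i: "integrable lborel (\<lambda>\<tau>. indicator {0..t} \<tau> * \<Delta> j \<tau>)" for t j
    using borel_integrable_atLeastAtMost'[OF continuous_on_subset[OF \<Delta>_cont[of j], of "{0..t}"]]
    by (auto simp: set_integrable_def)
  have est: "\<Delta> i t \<le> L * \<Lambda>' * (\<Sum>j\<in>UNIV. LINT \<tau>|lborel. indicator {0..t} \<tau> * \<Delta> j \<tau>)" if t: "t \<in> {0..T}" for i t
  proof -
    let ?g = "\<lambda>\<tau> x. \<Sum>j\<in>UNIV. G (\<kappa> i j) (b j) t \<tau> x"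
    let ?h = "\<lambda>\<tau>. \<Sum>j\<in>UNIV. L * \<Lambda>' * (indicator {0..t} \<tau> * \<Delta> j \<tau>)"
    have Gm: "(\<lambda>p. G (\<kappa> i j) (b j) t (fst p) (snd p)) \<in> borel_measurable (borel \<Otimes>\<^sub>M borel)" for j
      by (rule G_measurable_L1_curve[OF \<kappa> b_curve b_bd])
    have gm: "case_prod ?g \<in> borel_measurable (borel \<Otimes>\<^sub>M borel)"
      using Gm unfolding case_prod_beta' by (intro borel_measurable_sum)
    have hi: "integrable lborel ?h" using \<Delta>i by auto
    have Gi: "integrable lborel (G (\<kappa> i j) (b j) t \<tau>) \<and>
        (LINT x|lborel. \<bar>G (\<kappa> i j) (b j) t \<tau> x\<bar>) \<le> L * \<Lambda>' * (indicator {0..t} \<tau> * \<Delta> j \<tau>)" for j \<tau>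
    proof (cases "\<tau> \<in> {0..t}")
      case True
      then have \<tau>: "\<tau> \<ge> 0" by simp
      have "(LINT x|lborel. \<bar>conv (H (\<kappa> i j) (t - \<tau>)) (b j \<tau>) x\<bar>) \<le>
          (LINT y|lborel. \<bar>H (\<kappa> i j) (t - \<tau>) y\<bar>) * (LINT y|lborel. \<bar>b j \<tau> y\<bar>)"
        by (rule conv_L1(2)[OF H_integrable[OF \<kappa>] bi[OF \<tau>]])
      also have "\<dots> \<le> L * (\<Lambda>' * \<Delta> j \<tau>)"
        using L_ge_1 by (intro mult_mono H_L1[OF \<kappa>] bI[OF \<tau>] integral_nonneg_AE) auto
      finally show ?thesis
        using True conv_L1(1)[OF H_integrable[OF \<kappa>] bi[OF \<tau>]] by (simp add: G_def[abs_def])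
    next
      case False
      then have "G (\<kappa> i j) (b j) t \<tau> = (\<lambda>x. 0)" by (auto simp: G_def H_def conv_def fun_eq_iff)
      then show ?thesis using False by simp
    qed
    have gi: "integrable lborel (?g \<tau>)" for \<tau> using Gi by auto
    have gI: "(LINT x|lborel. \<bar>?g \<tau> x\<bar>) \<le> ?h \<tau>" for \<tau>
    proof -
      have "(LINT x|lborel. \<bar>?g \<tau> x\<bar>) \<le> (\<Sum>j\<in>UNIV. LINT x|lborel. \<bar>G (\<kappa> i j) (b j) t \<tau> x\<bar>)"
        by (rule sum_abs_integral_le) (use Gi in auto)
      also have "\<dots> \<le> ?h \<tau>" using Gi by (intro sum_mono) auto
      finally show ?thesis .
    qed
    note L1 = L1_integral_le[OF gm hi gi gI]
    have t0: "t \<ge> 0" using t by simp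
    let ?F = "\<lambda>w x \<tau>. \<Sum>j\<in>UNIV. \<kappa> i j (t - \<tau>) * S (t - \<tau>) (\<lambda>y. N j (w j \<tau> y)) x"
    have "AE x in lborel. set_integrable lborel {0..t} (?F w x) \<and> w i t x = lin f i t x + (LINT \<tau>:{0..t}|lborel. ?F w x \<tau>)"
      using w(3) t0 by (simp add: mild_def)
    moreover have "AE x in lborel. set_integrable lborel {0..t} (?F w' x) \<and> w' i t x = lin f i t x + (LINT \<tau>:{0..t}|lborel. ?F w' x \<tau>)"
      using w'(3) t0 by (simp add: mild_def)
    ultimately have "AE x in lborel. w i t x - w' i t x = (LINT \<tau>|lborel. ?g \<tau> x)"
      using L1(3)
    proof eventually_elim
      case (elim x)
      have "w i t x - w' i t x = (LINT \<tau>:{0..t}|lborel. ?F w x \<tau> - ?F w' x \<tau>)"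
        using elim by (subst set_integral_diff(2)) auto
      also have "\<dots> = (LINT \<tau>|lborel. ?g \<tau> x)"
        unfolding set_lebesgue_integral_def
      proof (rule integral_cong_AE)
        have "set_integrable lborel {0..t} (\<lambda>\<tau>. ?F w x \<tau> - ?F w' x \<tau>)"
          using elim by (intro set_integral_diff(1)) auto
        then show "(\<lambda>\<tau>. indicator {0..t} \<tau> *\<^sub>R (?F w x \<tau> - ?F w' x \<tau>)) \<in> borel_measurable lborel"
          unfolding set_integrable_def by (rule borel_measurable_integrable)
        show "(\<lambda>\<tau>. ?g \<tau> x) \<in> borel_measurable lborel" using elim(3) by (rule borel_measurable_integrable)
        show "AE \<tau> in lborel. indicator {0..t} \<tau> *\<^sub>R (?F w x \<tau> - ?F w' x \<tau>) = ?g \<tau> x"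
          using AE_lborel_singleton[of t]
        proof eventually_elim
          case (elim \<tau>)
          show ?case
          proof (cases "\<tau> \<in> {0..t}")
            case False
            then have "G (\<kappa> i j) (b j) t \<tau> x = 0" for j by (auto simp: G_def H_def conv_def)
            then show ?thesis using False by simp
          next
            case True
            then have \<tau>: "\<tau> \<ge> 0" "\<tau> < t" "\<tau> \<in> {0..T}" using elim t by auto
            have "\<kappa> i j (t - \<tau>) * S (t - \<tau>) (\<lambda>y. N j (w j \<tau> y)) x - \<kappa> i j (t - \<tau>) * S (t - \<tau>) (\<lambda>y. N j (w' j \<tau> y)) x
                = G (\<kappa> i j) (b j) t \<tau> x" for j
            proof -
              have [measurable]: "w j \<tau> \<in> borel_measurable borel" "w' j \<tau> \<in> borel_measurable borel"
                using wi[OF \<tau>(1)] by auto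
              have Km: "K (t - \<tau>) \<in> borel_measurable borel" by measurable
              have "AE y in lborel. N j (w j \<tau> y) = N j (cut (w j \<tau> y))"
                using R(2)[OF \<tau>(3), of j] by eventually_elim (simp add: cut)
              then have 1: "conv (K (t - \<tau>)) (\<lambda>y. N j (w j \<tau> y)) x = conv (K (t - \<tau>)) (\<lambda>y. N j (cut (w j \<tau> y))) x"
                by (rule conv_cong_AE) measurable
              have "AE y in lborel. N j (w' j \<tau> y) = N j (cut (w' j \<tau> y))"
                using R(3)[OF \<tau>(3), of j] by eventually_elim (simp add: cut)
              then have 2: "conv (K (t - \<tau>)) (\<lambda>y. N j (w' j \<tau> y)) x = conv (K (t - \<tau>)) (\<lambda>y. N j (cut (w' j \<tau> y))) x"
                by (rule conv_cong_AE) measurable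
              have "conv (K (t - \<tau>)) (b j \<tau>) x = conv (K (t - \<tau>)) (\<lambda>y. N j (cut (w j \<tau> y))) x - conv (K (t - \<tau>)) (\<lambda>y. N j (cut (w' j \<tau> y))) x"
                unfolding b_def using \<tau> Nb by (intro conv_diff_right K_integrable) (auto intro: Nb)
              then show ?thesis
                using \<tau> by (simp add: S_def G_def H_def[abs_def] conv_cmult_left 1 2 right_diff_distrib)
            qed
            then show ?thesis using True by (simp add: sum_subtractf[symmetric])
          qed
        qed
      qed
      finally show ?case .
    qed
    then have "\<Delta> i t = (LINT x|lborel. \<bar>LINT \<tau>|lborel. ?g \<tau> x\<bar>)"
      unfolding \<Delta>_def using wi[OF t0, of i] L1(1) by (intro integral_cong_AE) auto
    also have "\<dots> \<le> (LINT \<tau>|lborel. ?h \<tau>)" by (rule L1(2))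
    also have "\<dots> = L * \<Lambda>' * (\<Sum>j\<in>UNIV. LINT \<tau>|lborel. indicator {0..t} \<tau> * \<Delta> j \<tau>)"
      using \<Delta>i by (simp add: sum_distrib_left Bochner_Integration.integral_sum)
    finally show ?thesis .
  qed
  define d where "d = (\<lambda>t. \<Sum>i\<in>UNIV. \<Delta> i t)"
  have "d T = 0"
  proof (rule gronwall_zero[of T d "real CARD('k) * (L * \<Lambda>')"])
    show "continuous_on {0..T} d"
      unfolding d_def by (intro continuous_intros continuous_on_subset[OF \<Delta>_cont]) auto
    show "0 \<le> d t" for t unfolding d_def by (intro sum_nonneg \<Delta>0)
    show "0 \<le> real CARD('k) * (L * \<Lambda>')" using L_ge_1 \<Lambda>'0 by simp
    fix t assume t: "t \<in> {0..T}"
    have "d t \<le> (\<Sum>i\<in>(UNIV::'k set). L * \<Lambda>' * (\<Sum>j\<in>UNIV. LINT \<tau>|lborel. indicator {0..t} \<tau> * \<Delta> j \<tau>))"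
      unfolding d_def by (intro sum_mono est[OF t])
    also have "\<dots> = real CARD('k) * (L * \<Lambda>') * (\<Sum>j\<in>UNIV. LINT \<tau>|lborel. indicator {0..t} \<tau> * \<Delta> j \<tau>)" by simp
    also have "(\<Sum>j\<in>UNIV. LINT \<tau>|lborel. indicator {0..t} \<tau> * \<Delta> j \<tau>) = (LINT \<tau>|lborel. indicator {0..t} \<tau> * d \<tau>)"
      unfolding d_def sum_distrib_left using \<Delta>i by (intro Bochner_Integration.integral_sum[symmetric]) auto
    finally show "d t \<le> real CARD('k) * (L * \<Lambda>') * (LINT \<tau>|lborel. indicator {0..t} \<tau> * d \<tau>)" .
  qed (use T in auto)
  then have "\<Delta> i T = 0"
    unfolding d_def using \<Delta>0 by (subst (asm) sum_nonneg_eq_0_iff) auto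
  then have "AE x in lborel. \<bar>w i T x - w' i T x\<bar> = 0"
    unfolding \<Delta>_def using wi[OF T, of i] by (subst (asm) integral_nonneg_eq_0_iff_AE) auto
  then show ?thesis by eventually_elim simp
qed

end

section \<open>Lebesgue spaces\<close>

lemma Lp_infI:
  fixes f :: "'a::euclidean_space \<Rightarrow> real"
  assumes f: "f \<in> borel_measurable borel" and c: "AE x in lborel. \<bar>f x\<bar> \<le> c" "c \<ge> 0"
  shows "f \<in> Lp_space \<infinity>" "Lp_norm \<infinity> f \<le> c"
proof -
  have m: "(\<lambda>x. ennreal \<bar>f x\<bar>) \<in> borel_measurable lborel" using f by measurable
  have "AE x in lborel. ennreal \<bar>f x\<bar> \<le> ennreal c"
    using c(1) by eventually_elim (rule ennreal_leI)
  with m have le: "esssup lborel (\<lambda>x. ennreal \<bar>f x\<bar>) \<le> ennreal c" by (rule esssup_I)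
  then show "f \<in> Lp_space \<infinity>" using f by (auto simp: Lp_space_def intro: le_less_trans)
  show "Lp_norm \<infinity> f \<le> c" using le c(2) by (simp add: Lp_norm_def enn2real_leI)
qed

lemma Lp_infD:
  assumes "f \<in> Lp_space \<infinity>"
  shows "AE x in lborel. \<bar>f x\<bar> \<le> Lp_norm \<infinity> f"
proof -
  have fin: "esssup lborel (\<lambda>x. ennreal \<bar>f x\<bar>) < top" using assms by (simp add: Lp_space_def)
  have "AE x in lborel. ennreal \<bar>f x\<bar> \<le> esssup lborel (\<lambda>x. ennreal \<bar>f x\<bar>)" by (rule esssup_AE)
  then show ?thesis
  proof eventually_elim
    case (elim x)
    then have "enn2real (ennreal \<bar>f x\<bar>) \<le> enn2real (esssup lborel (\<lambda>x. ennreal \<bar>f x\<bar>))"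
      using fin by (rule enn2real_mono)
    then show ?case by (simp add: Lp_norm_def)
  qed
qed

lemma Lp_norm_nonneg: "Lp_norm m f \<ge> 0"
  by (simp add: Lp_norm_def)

lemma Lp_1_iff: "f \<in> Lp_space 1 \<longleftrightarrow> integrable lborel f"
proof -
  have "(\<lambda>x. \<bar>f x\<bar> powr 1) = (\<lambda>x. \<bar>f x\<bar>)" by auto
  then show ?thesis
    by (auto simp: Lp_space_def integrable_abs_iff)
qed

lemma Lp_norm_1: "Lp_norm 1 f = (LINT x|lborel. \<bar>f x\<bar>)"
proof -
  have "(LINT x|lborel. \<bar>f x\<bar>) \<ge> 0" by (intro integral_nonneg_AE) auto
  then show ?thesis by (simp add: Lp_norm_def)
qed

lemma exponent_ge_1: "(m::ennreal) \<ge> 1 \<Longrightarrow> m \<noteq> \<infinity> \<Longrightarrow> enn2real m \<ge> 1"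
  by (cases m rule: ennreal_cases) (auto simp: ennreal_1[symmetric] simp del: ennreal_1)

lemma Lp_finiteI:
  fixes f :: "'a::euclidean_space \<Rightarrow> real"
  assumes f: "integrable lborel f" "\<And>x. \<bar>f x\<bar> \<le> M" and m: "m \<ge> 1" "m \<noteq> \<infinity>"
  shows "f \<in> Lp_space m"
    "Lp_norm m f \<le> (M powr (enn2real m - 1) * (LINT x|lborel. \<bar>f x\<bar>)) powr (1 / enn2real m)"
proof -
  have m1: "enn2real m \<ge> 1" by (rule exponent_ge_1[OF m])
  note I = powr_integral_interpolation[OF f m1]
  show "f \<in> Lp_space m" using I(1) m f by (auto simp: Lp_space_def)
  have "0 \<le> (LINT x|lborel. \<bar>f x\<bar> powr enn2real m)" by (intro integral_nonneg_AE) auto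
  then show "Lp_norm m f \<le> (M powr (enn2real m - 1) * (LINT x|lborel. \<bar>f x\<bar>)) powr (1 / enn2real m)"
    using m m1 I(2) by (auto simp: Lp_norm_def intro!: powr_mono2)
qed

lemma (in selfsimilar_kernel) decaying_Lp_norm:
  assumes w: "decaying M w" and t: "t \<ge> 0" and m: "m \<ge> 1"
  shows "Lp_norm m (w t) \<le> M * (1 + t) powr (- \<gamma> * (1 - enn2real (1 / m)))"
proof -
  have M0: "M \<ge> 0" by (rule decaying_nonneg[OF w])
  have p: "\<And>x. \<bar>w t x\<bar> \<le> M * (1 + t) powr (- \<gamma>)" and i: "integrable lborel (w t)" and I: "(LINT x|lborel. \<bar>w t x\<bar>) \<le> M"
    using w t by (auto simp: decaying_def)
  show ?thesis
  proof (cases "m = \<infinity>")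
    case True
    have "Lp_norm \<infinity> (w t) \<le> M * (1 + t) powr (- \<gamma>)"
      using i p M0 by (intro Lp_infI(2)) auto
    then show ?thesis using True by simp
  next
    case False
    define k where "k = enn2real m"
    have k: "k \<ge> 1" unfolding k_def by (rule exponent_ge_1[OF m False])
    have k1: "enn2real (1 / m) = 1 / k"
      using m False k_def by (cases m rule: ennreal_cases) (auto simp: divide_ennreal ennreal_1[symmetric] simp del: ennreal_1)
    have "Lp_norm m (w t) \<le> ((M * (1 + t) powr (- \<gamma>)) powr (k - 1) * (LINT x|lborel. \<bar>w t x\<bar>)) powr (1 / k)"
      using Lp_finiteI(2)[OF i p m False] by (simp add: k_def)
    also have "\<dots> \<le> ((M * (1 + t) powr (- \<gamma>)) powr (k - 1) * M) powr (1 / k)"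
      using k I by (intro powr_mono2 mult_left_mono mult_nonneg_nonneg integral_nonneg_AE) auto
    also have "\<dots> = M * (1 + t) powr (- \<gamma> * (1 - 1 / k))"
    proof (cases "M = 0")
      case False
      then have M: "M > 0" using M0 by simp
      have e: "(M * (1 + t) powr (- \<gamma>)) powr (k - 1) * M = M powr (k - 1 + 1) * (1 + t) powr (- \<gamma> * (k - 1))"
      proof -
        have "(M * (1 + t) powr (- \<gamma>)) powr (k - 1) * M = (M powr (k - 1) * M powr 1) * (1 + t) powr (- \<gamma> * (k - 1))"
          using M t by (simp add: powr_mult powr_powr)
        then show ?thesis by (simp only: powr_add)
      qed
      have "((M * (1 + t) powr (- \<gamma>)) powr (k - 1) * M) powr (1 / k) =
          M powr (k * (1 / k)) * (1 + t) powr (- \<gamma> * (k - 1) * (1 / k))"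
        unfolding e using M by (simp add: powr_mult powr_powr)
      also have "k * (1 / k) = 1" using k by simp
      also have "- \<gamma> * (k - 1) * (1 / k) = - \<gamma> * (1 - 1 / k)" using k by (simp add: field_simps)
      finally show ?thesis using M by simp
    qed simp
    finally show ?thesis using k1 by simp
  qed
qed

text \<open>
  Bounded curves that converge in \<open>L\<^sup>1\<close> converge weak-*: a test function splits into a
  bounded part and a part of small \<open>L\<^sup>1\<close> norm.
\<close>

lemma weak_star_limit:
  fixes w :: "real \<Rightarrow> 'a::euclidean_space \<Rightarrow> real"
  assumes \<phi>: "integrable lborel \<phi>" and b: "\<And>t x. t \<ge> 0 \<Longrightarrow> \<bar>w t x\<bar> \<le> M"
    and i: "\<And>t. t \<ge> 0 \<Longrightarrow> integrable lborel (w t)"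
    and L1: "((\<lambda>t. LINT x|lborel. \<bar>w t x - w 0 x\<bar>) \<longlongrightarrow> 0) (at_right 0)"
  shows "((\<lambda>t. LINT x|lborel. w t x * \<phi> x) \<longlongrightarrow> (LINT x|lborel. w 0 x * \<phi> x)) (at_right 0)"
proof (rule tendstoI)
  fix e :: real assume e: "e > 0"
  have M: "M \<ge> 0" using b[of 0 0] by linarith
  have [measurable]: "\<phi> \<in> borel_measurable borel" using \<phi> by auto
  let ?tail = "\<lambda>n x. \<bar>\<phi> x\<bar> * indicator {x. real n < \<bar>\<phi> x\<bar>} x"
  have "(\<lambda>n. LINT x|lborel. ?tail n x) \<longlonglongrightarrow> (LINT x|(lborel :: 'a measure). 0)"
  proof (rule integral_dominated_convergence[where w="\<lambda>x. \<bar>\<phi> x\<bar>"])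
    have "(\<lambda>n. ?tail n x) \<longlonglongrightarrow> 0" for x
    proof (rule tendsto_eventually)
      obtain n where n: "\<bar>\<phi> x\<bar> \<le> real n" using real_arch_simple by blast
      show "\<forall>\<^sub>F n in sequentially. ?tail n x = 0"
        using eventually_ge_at_top[of n] by eventually_elim (use n in \<open>auto simp: indicator_def\<close>)
    qed
    then show "AE x in lborel. (\<lambda>n. ?tail n x) \<longlonglongrightarrow> 0" by simp
  qed (use \<phi> in \<open>auto simp: indicator_def\<close>)
  then have "(\<lambda>n. (2 * M) * (LINT x|lborel. ?tail n x)) \<longlonglongrightarrow> 0"
    by (intro tendsto_mult_right_zero) simp
  then have "\<forall>\<^sub>F n in sequentially. (2 * M) * (LINT x|lborel. ?tail n x) < e / 2"
    by (rule order_tendstoD(2)) (use e in simp)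
  then obtain n where n: "(2 * M) * (LINT x|lborel. ?tail n x) < e / 2"
    by (auto simp: eventually_sequentially)
  have "((\<lambda>t. real n * (LINT x|lborel. \<bar>w t x - w 0 x\<bar>)) \<longlongrightarrow> 0) (at_right 0)"
    by (intro tendsto_mult_right_zero L1)
  then have "\<forall>\<^sub>F t in at_right 0. real n * (LINT x|lborel. \<bar>w t x - w 0 x\<bar>) < e / 2"
    by (rule order_tendstoD(2)) (use e in simp)
  moreover have "\<forall>\<^sub>F t in at_right (0::real). 0 < t" by (simp add: eventually_at_filter)
  ultimately show "\<forall>\<^sub>F t in at_right 0. dist (LINT x|lborel. w t x * \<phi> x) (LINT x|lborel. w 0 x * \<phi> x) < e"
  proof eventually_elim
    case (elim t)
    then have t: "t \<ge> 0" by simp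
    have it: "integrable lborel (?tail n)"
      by (rule integrable_mult_bounded(1)[OF integrable_abs[OF \<phi>], of _ 1]) (auto simp: indicator_def)
    have ip: "integrable lborel (\<lambda>x. w s x * \<phi> x)" if "s \<ge> 0" for s
      using integrable_mult_bounded(1)[OF \<phi>, of "w s" M] i[OF that] b[OF that] by (simp add: mult.commute)
    have "dist (LINT x|lborel. w t x * \<phi> x) (LINT x|lborel. w 0 x * \<phi> x) = \<bar>LINT x|lborel. w t x * \<phi> x - w 0 x * \<phi> x\<bar>"
      using ip[OF t] ip[of 0] by (simp add: dist_real_def)
    also have "\<dots> \<le> (LINT x|lborel. \<bar>w t x * \<phi> x - w 0 x * \<phi> x\<bar>)" by (rule integral_abs_bound)
    also have "\<dots> \<le> (LINT x|lborel. real n * \<bar>w t x - w 0 x\<bar> + (2 * M) * ?tail n x)"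
    proof (rule integral_mono)
      fix x
      have eq: "\<bar>w t x * \<phi> x - w 0 x * \<phi> x\<bar> = \<bar>w t x - w 0 x\<bar> * \<bar>\<phi> x\<bar>"
        by (simp add: left_diff_distrib[symmetric] abs_mult)
      have le: "\<bar>w t x - w 0 x\<bar> \<le> 2 * M" using b[OF t, of x] b[of 0 x] by linarith
      show "\<bar>w t x * \<phi> x - w 0 x * \<phi> x\<bar> \<le> real n * \<bar>w t x - w 0 x\<bar> + (2 * M) * ?tail n x"
      proof (cases "real n < \<bar>\<phi> x\<bar>")
        case True
        have "\<bar>w t x - w 0 x\<bar> * \<bar>\<phi> x\<bar> \<le> (2 * M) * \<bar>\<phi> x\<bar>" using le by (rule mult_right_mono) simp
        moreover have "0 \<le> real n * \<bar>w t x - w 0 x\<bar>" by simp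
        ultimately show ?thesis unfolding eq using True by (simp add: add_increasing)
      next
        case False
        then have "\<bar>w t x - w 0 x\<bar> * \<bar>\<phi> x\<bar> \<le> \<bar>w t x - w 0 x\<bar> * real n" by (intro mult_left_mono) auto
        then show ?thesis unfolding eq using False by (simp add: mult.commute)
      qed
    qed (use ip[OF t] ip[of 0] i[OF t] i[of 0] it in auto)
    also have "\<dots> = real n * (LINT x|lborel. \<bar>w t x - w 0 x\<bar>) + (2 * M) * (LINT x|lborel. ?tail n x)"
      using i[OF t] i[of 0] it by simp
    also have "\<dots> < e" using n elim by linarith
    finally show ?case .
  qed
qed

lemma Lp_continuous_on_infI:
  fixes w :: "real \<Rightarrow> 'a::euclidean_space \<Rightarrow> real"
  assumes m: "\<And>t. t \<in> I \<Longrightarrow> w t \<in> borel_measurable borel" and b: "\<And>t x. t \<in> I \<Longrightarrow> \<bar>w t x\<bar> \<le> M" and "M \<ge> 0"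
    and c: "\<And>t e. t \<in> I \<Longrightarrow> e > 0 \<Longrightarrow> \<forall>\<^sub>F a in at t within I. AE x in lborel. \<bar>w a x - w t x\<bar> \<le> e"
  shows "Lp_continuous_on \<infinity> I w"
  unfolding Lp_continuous_on_def
proof (intro conjI ballI)
  fix t assume t: "t \<in> I"
  show "w t \<in> Lp_space \<infinity>" using m[OF t] b[OF t] \<open>M \<ge> 0\<close> by (intro Lp_infI(1)) auto
  show "((\<lambda>s. Lp_norm \<infinity> (\<lambda>x. w s x - w t x)) \<longlongrightarrow> 0) (at t within I)"
  proof (rule tendstoI)
    fix e :: real assume e: "e > 0"
    then have "\<forall>\<^sub>F a in at t within I. AE x in lborel. \<bar>w a x - w t x\<bar> \<le> e / 2" by (intro c t) simp
    moreover have "\<forall>\<^sub>F a in at t within I. a \<in> I" by (simp add: eventually_at_filter)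
    ultimately show "\<forall>\<^sub>F s in at t within I. dist (Lp_norm \<infinity> (\<lambda>x. w s x - w t x)) 0 < e"
    proof eventually_elim
      case (elim a)
      have "Lp_norm \<infinity> (\<lambda>x. w a x - w t x) \<le> e / 2"
        using elim e m[OF t] m[of a] by (intro Lp_infI(2)) auto
      then show ?case using e Lp_norm_nonneg[of \<infinity> "\<lambda>x. w a x - w t x"] by simp
    qed
  qed
qed

lemma Lp_curveI:
  fixes w :: "real \<Rightarrow> 'a::euclidean_space \<Rightarrow> real"
  assumes b: "\<And>t x. t \<ge> 0 \<Longrightarrow> \<bar>w t x\<bar> \<le> M" and i: "\<And>t. t \<ge> 0 \<Longrightarrow> integrable lborel (w t)"
    and L1: "\<And>t. t \<ge> 0 \<Longrightarrow> ((\<lambda>a. LINT x|lborel. \<bar>w a x - w t x\<bar>) \<longlongrightarrow> 0) (at t within {0..})"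
    and sup: "\<And>t e. t > 0 \<Longrightarrow> e > 0 \<Longrightarrow> \<forall>\<^sub>F a in at t. \<forall>x. \<bar>w a x - w t x\<bar> \<le> e"
    and m: "m \<ge> 1"
  shows "Lp_curve m w"
proof -
  have M: "M \<ge> 0" using b[of 0 0] by linarith
  have meas: "w t \<in> borel_measurable borel" if "t \<ge> 0" for t using i[OF that] by auto
  show ?thesis
  proof (cases "m = \<infinity>")
    case True
    have "Lp_continuous_on \<infinity> {0<..} w"
    proof (rule Lp_continuous_on_infI[of _ _ M])
      fix t e :: real assume "t \<in> {0<..}" "e > 0"
      then have "\<forall>\<^sub>F a in at t. \<forall>x. \<bar>w a x - w t x\<bar> \<le> e" by (intro sup) auto
      then have "\<forall>\<^sub>F a in at t within {0<..}. \<forall>x. \<bar>w a x - w t x\<bar> \<le> e"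
        using filter_leD[OF at_le[of "{0<..}" UNIV t]] by simp
      then show "\<forall>\<^sub>F a in at t within {0<..}. AE x in lborel. \<bar>w a x - w t x\<bar> \<le> e"
        by eventually_elim simp
    qed (use b meas M in auto)
    moreover have "w 0 \<in> Lp_space \<infinity>" using meas[of 0] b[of 0] M by (intro Lp_infI(1)) auto
    moreover have "\<forall>t\<in>{0..1}. Lp_norm \<infinity> (w t) \<le> M"
      using meas b M by (intro ballI Lp_infI(2)) auto
    moreover have "((\<lambda>t. LINT x|lborel. w t x * \<phi> x) \<longlongrightarrow> (LINT x|lborel. w 0 x * \<phi> x)) (at_right 0)"
      if "\<phi> \<in> Lp_space 1" for \<phi>
    proof (rule weak_star_limit[of _ _ M])
      show "integrable lborel \<phi>" using that by (simp add: Lp_1_iff)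
      show "((\<lambda>t. LINT x|lborel. \<bar>w t x - w 0 x\<bar>) \<longlongrightarrow> 0) (at_right 0)"
        by (rule tendsto_within_subset[OF L1[of 0]]) auto
    qed (use b i in auto)
    ultimately show ?thesis using True by (auto simp: Lp_curve_def)
  next
    case False
    define k where "k = enn2real m"
    have k: "k \<ge> 1" unfolding k_def by (rule exponent_ge_1[OF m False])
    have "Lp_continuous_on m {0..} w"
      unfolding Lp_continuous_on_def
    proof (intro conjI ballI)
      fix t :: real assume "t \<in> {0..}"
      then have t: "t \<ge> 0" by simp
      show "w t \<in> Lp_space m" by (rule Lp_finiteI(1)[OF i[OF t] b[OF t] m False])
      have lim: "((\<lambda>a. ((2 * M) powr (k - 1) * (LINT x|lborel. \<bar>w a x - w t x\<bar>)) powr (1 / k)) \<longlongrightarrow> 0) (at t within {0..})"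
        using k by (intro tendsto_zero_powrI[OF tendsto_mult_right_zero[OF L1[OF t]] tendsto_const])
          (auto intro!: always_eventually mult_nonneg_nonneg integral_nonneg_AE)
      show "((\<lambda>s. Lp_norm m (\<lambda>x. w s x - w t x)) \<longlongrightarrow> 0) (at t within {0..})"
      proof (rule tendsto_sandwich[OF _ _ tendsto_const lim])
        have "\<forall>\<^sub>F a in at t within {0..}. a \<in> {0..}" by (simp add: eventually_at_filter)
        then show "\<forall>\<^sub>F a in at t within {0..}. Lp_norm m (\<lambda>x. w a x - w t x) \<le>
            ((2 * M) powr (k - 1) * (LINT x|lborel. \<bar>w a x - w t x\<bar>)) powr (1 / k)"
        proof eventually_elim
          case (elim a)
          have "\<bar>w a x - w t x\<bar> \<le> 2 * M" for x using b[OF t, of x] b[of a x] elim by force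
          then show ?case
            unfolding k_def using i[OF t] i[of a] elim by (intro Lp_finiteI(2) m False) auto
        qed
      qed (simp add: Lp_norm_nonneg)
    qed
    then show ?thesis using False by (simp add: Lp_curve_def)
  qed
qed

text \<open>
  On \<open>[0, 1]\<close> a bound is part of the definition of a curve in \<open>L\<^sup>\<infinity>\<close>; on \<open>[1, T]\<close> the norm is a continuous
  function of time.
\<close>

lemma Lp_curve_inf_locally_bounded:
  assumes w: "Lp_curve \<infinity> w"
  shows "\<exists>R. \<forall>t\<in>{0..T}. AE x in lborel. \<bar>w t x\<bar> \<le> R"
proof -
  have Linf: "w t \<in> Lp_space \<infinity>" if "t \<ge> 0" for t
    using w that by (cases "t = 0") (auto simp: Lp_curve_def Lp_continuous_on_def)
  have "\<exists>B. \<forall>t\<in>{0..1}. Lp_norm \<infinity> (w t) \<le> B" using w by (simp add: Lp_curve_def)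
  then obtain B where B: "\<And>t. t \<in> {0..1} \<Longrightarrow> Lp_norm \<infinity> (w t) \<le> B" by blast
  have tri: "Lp_norm \<infinity> (w a) \<le> Lp_norm \<infinity> (w t) + Lp_norm \<infinity> (\<lambda>x. w b x - w c x)"
    if "a \<ge> 0" "t \<ge> 0" "(b, c) \<in> {(a, t), (t, a)}" for a t b c
  proof (rule Lp_infI(2))
    note ae = Lp_infD[OF Linf[OF that(1)]] Lp_infD[OF Linf[OF that(2)]]
    have m: "w a \<in> borel_measurable borel" "w t \<in> borel_measurable borel"
      using Linf[OF that(1)] Linf[OF that(2)] by (auto simp: Lp_space_def)
    show "w a \<in> borel_measurable borel" by (rule m)
    have "(\<lambda>x. w b x - w c x) \<in> Lp_space \<infinity>"
    proof (rule Lp_infI(1))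
      show "(\<lambda>x. w b x - w c x) \<in> borel_measurable borel" using that m by auto
      show "AE x in lborel. \<bar>w b x - w c x\<bar> \<le> Lp_norm \<infinity> (w a) + Lp_norm \<infinity> (w t)"
        using ae by eventually_elim (use that(3) in auto)
    qed (simp add: Lp_norm_nonneg)
    from Lp_infD[OF this] ae(2)
    show "AE x in lborel. \<bar>w a x\<bar> \<le> Lp_norm \<infinity> (w t) + Lp_norm \<infinity> (\<lambda>x. w b x - w c x)"
      by eventually_elim (use that(3) in auto)
  qed (simp add: Lp_norm_nonneg)
  have "continuous_on {1..T} (\<lambda>t. Lp_norm \<infinity> (w t))"
    unfolding continuous_on_def
  proof (intro ballI)
    fix t assume t: "t \<in> {1..T}"
    have lim: "((\<lambda>s. Lp_norm \<infinity> (\<lambda>x. w s x - w t x)) \<longlongrightarrow> 0) (at t within {0<..})"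
      using w t by (auto simp: Lp_curve_def Lp_continuous_on_def)
    have lim': "((\<lambda>s. Lp_norm \<infinity> (\<lambda>x. w s x - w t x)) \<longlongrightarrow> 0) (at t within {1..T})"
      by (rule tendsto_within_subset[OF lim]) auto
    have "((\<lambda>s. Lp_norm \<infinity> (w s) - Lp_norm \<infinity> (w t)) \<longlongrightarrow> 0) (at t within {1..T})"
    proof (rule Lim_null_comparison[OF _ lim'])
      have "\<forall>\<^sub>F s in at t within {1..T}. s \<in> {1..T}" by (simp add: eventually_at_filter)
      then show "\<forall>\<^sub>F s in at t within {1..T}. norm (Lp_norm \<infinity> (w s) - Lp_norm \<infinity> (w t)) \<le> Lp_norm \<infinity> (\<lambda>x. w s x - w t x)"
      proof eventually_elim
        case (elim s)
        then show ?case using tri[of s t s t] tri[of t s s t] t by auto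
      qed
    qed
    then show "((\<lambda>t. Lp_norm \<infinity> (w t)) \<longlongrightarrow> Lp_norm \<infinity> (w t)) (at t within {1..T})" by (rule LIM_zero_cancel)
  qed
  then have "bounded ((\<lambda>t. Lp_norm \<infinity> (w t)) ` {1..T})"
    by (intro compact_imp_bounded compact_continuous_image) auto
  then obtain B' where "\<forall>x\<in>(\<lambda>t. Lp_norm \<infinity> (w t)) ` {1..T}. norm x \<le> B'"
    unfolding bounded_iff by blast
  then have B': "Lp_norm \<infinity> (w t) \<le> B'" if "t \<in> {1..T}" for t using that by force
  show ?thesis
  proof (intro exI[of _ "max B B'"] ballI)
    fix t assume t: "t \<in> {0..T}"
    then have "Lp_norm \<infinity> (w t) \<le> max B B'" using B[of t] B'[of t] by (cases "t \<le> 1") auto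
    then show "AE x in lborel. \<bar>w t x\<bar> \<le> max B B'"
      using Lp_infD[OF Linf[of t]] t by (auto elim: eventually_mono)
  qed
qed

section \<open>The nonlinearity\<close>

lemma powr_diff_le:
  fixes x y :: real
  assumes "0 \<le> x" "x \<le> y" "p > 1"
  shows "y powr p - x powr p \<le> p * y powr (p - 1) * (y - x)"
proof -
  consider "x = y" | "x = 0" "0 < y" | "0 < x" "x < y" using assms by linarith
  then show ?thesis
  proof cases
    case 2
    have "y powr p = 1 * (y powr (p - 1) * y)" using 2 by (simp add: powr_diff)
    also have "\<dots> \<le> p * (y powr (p - 1) * y)" using assms 2 by (intro mult_right_mono) auto
    finally show ?thesis using 2 by simp
  next
    case 3
    have "\<exists>z>x. z < y \<and> y powr p - x powr p = (y - x) * (p * z powr (p - 1))"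
      by (rule MVT2[OF 3(2)]) (use 3 in \<open>auto intro!: derivative_eq_intros\<close>)
    then obtain z where z: "x < z" "z < y" "y powr p - x powr p = (y - x) * (p * z powr (p - 1))" by blast
    have "z powr (p - 1) \<le> y powr (p - 1)" using z 3 assms by (intro powr_mono2) auto
    then have "(y - x) * (p * z powr (p - 1)) \<le> (y - x) * (p * y powr (p - 1))"
      using 3 assms by (intro mult_left_mono) auto
    then show ?thesis using z by (simp add: mult_ac)
  qed simp
qed

text \<open>
  For the odd reading and arguments of opposite sign there is no cancellation to control:
  both sides are then sums of absolute values.
\<close>

lemma power_reading_diff:
  assumes F: "F \<in> power_readings p" and p: "p > 1"
  shows "\<bar>F a - F b\<bar> \<le> p * max \<bar>a\<bar> \<bar>b\<bar> powr (p - 1) * \<bar>a - b\<bar>"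
proof -
  have abs: "\<bar>\<bar>a\<bar> powr p - \<bar>b\<bar> powr p\<bar> \<le> p * max \<bar>a\<bar> \<bar>b\<bar> powr (p - 1) * \<bar>\<bar>a\<bar> - \<bar>b\<bar>\<bar>" for a b :: real
  proof (cases "\<bar>a\<bar> \<le> \<bar>b\<bar>")
    case True
    then have "\<bar>a\<bar> powr p \<le> \<bar>b\<bar> powr p" using p by (intro powr_mono2) auto
    then show ?thesis using powr_diff_le[of "\<bar>a\<bar>" "\<bar>b\<bar>" p] True p by (simp add: max_def)
  next
    case False
    then have "\<bar>b\<bar> powr p \<le> \<bar>a\<bar> powr p" using p by (intro powr_mono2) auto
    then show ?thesis using powr_diff_le[of "\<bar>b\<bar>" "\<bar>a\<bar>" p] False p by (simp add: max_def)
  qed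
  have pw: "\<bar>s\<bar> powr (p - 1) * \<bar>s\<bar> = \<bar>s\<bar> powr p" for s :: real by (cases "s = 0") (auto simp: powr_diff)
  consider "F = (\<lambda>s. \<bar>s\<bar> powr p)" | "F = (\<lambda>s. \<bar>s\<bar> powr (p - 1) * s)" using F by (auto simp: power_readings_def)
  then show ?thesis
  proof cases
    case 1
    have "p * max \<bar>a\<bar> \<bar>b\<bar> powr (p - 1) * \<bar>\<bar>a\<bar> - \<bar>b\<bar>\<bar> \<le> p * max \<bar>a\<bar> \<bar>b\<bar> powr (p - 1) * \<bar>a - b\<bar>"
      using p by (intro mult_left_mono) auto
    then show ?thesis using abs[of a b] 1 by simp
  next
    case 2
    show ?thesis
    proof (cases "a * b \<ge> 0")
      case True
      then consider "a \<ge> 0" "b \<ge> 0" | "a \<le> 0" "b \<le> 0" by (auto simp: zero_le_mult_iff)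
      then have "\<bar>F a - F b\<bar> = \<bar>\<bar>a\<bar> powr p - \<bar>b\<bar> powr p\<bar> \<and> \<bar>\<bar>a\<bar> - \<bar>b\<bar>\<bar> = \<bar>a - b\<bar>"
        unfolding 2 pw[of a, symmetric] pw[of b, symmetric] by cases (auto simp: abs_if)
      then show ?thesis using abs[of a b] by simp
    next
      case False
      have ab: "\<bar>a - b\<bar> = \<bar>a\<bar> + \<bar>b\<bar>" using False by (auto simp: zero_le_mult_iff not_le)
      let ?m = "max \<bar>a\<bar> \<bar>b\<bar> powr (p - 1)"
      have m: "\<bar>a\<bar> powr (p - 1) \<le> ?m" "\<bar>b\<bar> powr (p - 1) \<le> ?m" using p by (auto intro!: powr_mono2)
      have "\<bar>F a - F b\<bar> \<le> \<bar>a\<bar> powr (p - 1) * \<bar>a\<bar> + \<bar>b\<bar> powr (p - 1) * \<bar>b\<bar>"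
        unfolding 2 by (rule order_trans[OF abs_triangle_ineq4]) (simp add: abs_mult)
      also have "\<dots> \<le> ?m * \<bar>a\<bar> + ?m * \<bar>b\<bar>" using m by (intro add_mono mult_right_mono) auto
      also have "\<dots> = 1 * (?m * \<bar>a - b\<bar>)" by (simp add: ab distrib_left)
      also have "\<dots> \<le> p * (?m * \<bar>a - b\<bar>)" using p by (intro mult_right_mono) auto
      finally show ?thesis by simp
    qed
  qed
qed

lemma power_reading_0: "F \<in> power_readings p \<Longrightarrow> F 0 = 0"
  by (auto simp: power_readings_def)

lemma power_reading_measurable: "F \<in> power_readings p \<Longrightarrow> F \<in> borel_measurable borel"
  by (auto simp: power_readings_def)

lemma power_reading_small:
  assumes "F \<in> power_readings p" "1 < r" "r \<le> p" "p \<le> \<Lambda>" "\<bar>a\<bar> \<le> 1" "\<bar>b\<bar> \<le> 1"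
  shows "\<bar>F a - F b\<bar> \<le> \<Lambda> * max \<bar>a\<bar> \<bar>b\<bar> powr (r - 1) * \<bar>a - b\<bar>"
proof -
  have "max \<bar>a\<bar> \<bar>b\<bar> powr (p - 1) \<le> max \<bar>a\<bar> \<bar>b\<bar> powr (r - 1)"
    using assms by (intro powr_mono') auto
  then have "p * max \<bar>a\<bar> \<bar>b\<bar> powr (p - 1) * \<bar>a - b\<bar> \<le> \<Lambda> * max \<bar>a\<bar> \<bar>b\<bar> powr (r - 1) * \<bar>a - b\<bar>"
    using assms by (intro mult_right_mono mult_mono) auto
  then show ?thesis using power_reading_diff[OF assms(1), of a b] assms by linarith
qed

lemma power_reading_lipschitz:
  assumes "F \<in> power_readings p" "p > 1" "\<bar>a\<bar> \<le> R" "\<bar>b\<bar> \<le> R"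
  shows "\<bar>F a - F b\<bar> \<le> p * R powr (p - 1) * \<bar>a - b\<bar>"
proof -
  have "max \<bar>a\<bar> \<bar>b\<bar> powr (p - 1) \<le> R powr (p - 1)" using assms by (intro powr_mono2) auto
  then have "p * max \<bar>a\<bar> \<bar>b\<bar> powr (p - 1) * \<bar>a - b\<bar> \<le> p * R powr (p - 1) * \<bar>a - b\<bar>"
    using assms by (intro mult_right_mono mult_left_mono) auto
  then show ?thesis using power_reading_diff[OF assms(1,2), of a b] by linarith
qed

section \<open>The weakly coupled system\<close>

text \<open>The entries of \<open>exp (- t A)\<close> for the coupling matrix \<open>A\<close>; \<open>True\<close> stands for \<open>u\<close>.\<close>

definition coupling :: "real \<Rightarrow> real \<Rightarrow> bool \<Rightarrow> bool \<Rightarrow> real \<Rightarrow> real" where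
  "coupling \<mu> \<nu> i j t =
     (if i then (if j then \<nu> + \<mu> * exp (- (\<mu> + \<nu>) * t) else \<nu> - \<nu> * exp (- (\<mu> + \<nu>) * t))
      else (if j then \<mu> - \<mu> * exp (- (\<mu> + \<nu>) * t) else \<mu> + \<nu> * exp (- (\<mu> + \<nu>) * t))) / (\<mu> + \<nu>)"

lemma frac_kernel_system:
  fixes \<sigma> \<mu> \<nu> p q :: real
  assumes \<sigma>: "\<sigma> > 0" and \<mu>: "\<mu> > 0" and \<nu>: "\<nu> > 0" and p: "p > 1" and q: "q > 1"
    and pq: "min p q > 1 + 2 * \<sigma> / real CARD('n::finite)"
    and F: "F \<in> power_readings p" and G: "G \<in> power_readings q"
  obtains B where "kernel_system (frac_profile \<sigma> :: real^'n \<Rightarrow> real) (2 * \<sigma>) B (2 * \<sigma>)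
    (coupling \<mu> \<nu>) (\<lambda>j. if j then F else G) (min p q) (p + q)"
proof -
  obtain B where B: "B > 0" "\<And>x :: real^'n. \<bar>frac_profile \<sigma> x\<bar> \<le> B * (1 + norm x) powr (- (real DIM(real^'n) + 2 * \<sigma>))"
    using frac_profile_decay[OF \<sigma>] by blast
  interpret selfsimilar_kernel "frac_profile \<sigma> :: real^'n \<Rightarrow> real" "2 * \<sigma>" B "2 * \<sigma>"
    by unfold_locales (use \<sigma> B continuous_frac_profile[OF \<sigma>] integral_frac_profile[OF \<sigma>] in auto)
  have "coeff (coupling \<mu> \<nu> i j)" for i j
    unfolding coeff_def
  proof (intro conjI allI impI)
    show "continuous_on {0..} (coupling \<mu> \<nu> i j)"
      unfolding coupling_def using \<mu> \<nu> by (cases i; cases j) (auto intro!: continuous_intros)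
    then show "coupling \<mu> \<nu> i j \<in> borel_measurable borel"
      unfolding coupling_def by (cases i; cases j) auto
    fix t :: real assume t: "t \<ge> 0"
    define E where "E = exp (- (\<mu> + \<nu>) * t)"
    have "0 \<le> (\<mu> + \<nu>) * t" using \<mu> \<nu> t by simp
    then have E: "0 < E" "E \<le> 1"
      unfolding E_def by (simp_all only: exp_gt_zero exp_le_one_iff mult_minus_left neg_le_0_iff_le)
    have "\<mu> * E \<le> \<mu>" "\<nu> * E \<le> \<nu>" "0 \<le> \<mu> * E" "0 \<le> \<nu> * E" using E \<mu> \<nu> by auto
    then show "\<bar>coupling \<mu> \<nu> i j t\<bar> \<le> 1"
      unfolding coupling_def E_def[symmetric] using \<mu> \<nu> by (auto simp: abs_le_iff field_simps)
  qed
  moreover have "coupling \<mu> \<nu> i j 0 = (if i = j then 1 else 0)" for i j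
    using \<mu> \<nu> by (cases i; cases j) (auto simp: coupling_def add.commute)
  moreover have "\<gamma> * (min p q - 1) > 1"
  proof -
    have \<gamma>_eq: "\<gamma> = real CARD('n) / (2 * \<sigma>)" unfolding \<gamma>_def by simp
    have "2 * \<sigma> / real CARD('n) < min p q - 1" using pq by linarith
    then have "real CARD('n) / (2 * \<sigma>) * (2 * \<sigma> / real CARD('n)) < real CARD('n) / (2 * \<sigma>) * (min p q - 1)"
      using \<sigma> by (intro mult_strict_left_mono) auto
    then show ?thesis unfolding \<gamma>_eq using \<sigma> by simp
  qed
  ultimately have "kernel_system (frac_profile \<sigma> :: real^'n \<Rightarrow> real) (2 * \<sigma>) B (2 * \<sigma>)
    (coupling \<mu> \<nu>) (\<lambda>j. if j then F else G) (min p q) (p + q)"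
    using p q F G
    by unfold_locales
      (auto simp: power_reading_0 power_reading_measurable intro: power_reading_small)
  then show thesis by (rule that)
qed

text \<open>A representative of the datum that satisfies its essential bound everywhere.\<close>

definition truncation :: "('a::euclidean_space \<Rightarrow> real) \<Rightarrow> 'a \<Rightarrow> real" where
  "truncation f x = (if \<bar>f x\<bar> \<le> Lp_norm \<infinity> f then f x else 0)"

lemma truncation:
  assumes f: "f \<in> Lp_space \<infinity> \<inter> Lp_space 1"
  shows "AE x in lborel. truncation f x = f x" "\<bar>truncation f x\<bar> \<le> Lp_norm \<infinity> f"
    "integrable lborel (truncation f)" "(LINT x|lborel. \<bar>truncation f x\<bar>) \<le> Lp_norm 1 f"
proof -
  have [measurable]: "f \<in> borel_measurable borel" and i: "integrable lborel f"
    using f by (simp_all add: Lp_1_iff) (simp add: Lp_space_def)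
  have m: "truncation f \<in> borel_measurable borel" unfolding truncation_def by measurable
  show "AE x in lborel. truncation f x = f x"
    using Lp_infD[of f] f by (auto simp: truncation_def elim: eventually_mono)
  show "\<bar>truncation f x\<bar> \<le> Lp_norm \<infinity> f" by (simp add: truncation_def Lp_norm_nonneg)
  show it: "integrable lborel (truncation f)"
    by (rule Bochner_Integration.integrable_bound[OF i]) (use m in \<open>auto simp: truncation_def\<close>)
  show "(LINT x|lborel. \<bar>truncation f x\<bar>) \<le> Lp_norm 1 f"
    unfolding Lp_norm_1
  proof (rule integral_mono)
    show "\<bar>truncation f x\<bar> \<le> \<bar>f x\<bar>" for x by (simp add: truncation_def)
  qed (use it i in auto)
qed

text \<open>
  The name \<open>s\<close> for \<open>2 \<sigma>\<close> keeps simplification from rewriting the parameters of the locale instance;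
  \<open>dim\<close> fixes the dimension.
\<close>

locale frac_system =
  fixes \<sigma> \<mu> \<nu> p q :: real and F G :: "real \<Rightarrow> real" and s B :: real and dim :: "'n::finite itself"
  assumes \<sigma>: "\<sigma> > 0" and s: "s = 2 * \<sigma>" and p: "p > 1" and q: "q > 1"
    and F: "F \<in> power_readings p" and G: "G \<in> power_readings q"
    and ksys: "kernel_system (frac_profile \<sigma> :: real^'n \<Rightarrow> real) s B s
    (coupling \<mu> \<nu>) (\<lambda>j. if j then F else G) (min p q) (p + q)"
begin

sublocale ks: kernel_system "frac_profile \<sigma> :: real^'n \<Rightarrow> real" s B s
    "coupling \<mu> \<nu>" "\<lambda>j. if j then F else G" "min p q" "p + q"
  by (rule ksys)

lemma decay_rate: "ks.\<gamma> = real CARD('n) / (2 * \<sigma>)"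
  unfolding ks.\<gamma>_def by (simp add: s)

lemma frac_heat_op_eq:
  fixes f :: "real^'n \<Rightarrow> real"
  assumes "t \<ge> 0"
  shows "frac_heat_op \<sigma> t f x = ks.S t f x"
proof (cases "t = 0")
  case False
  then show ?thesis
    using assms by (simp add: frac_heat_op_def ks.S_def conv_def ks.K_def decay_rate frac_heat_kernel_eq[OF \<sigma>] s[symmetric])
qed (simp add: frac_heat_op_def ks.S_def)

lemma solution_operator_eq:
  fixes f :: "real^'n \<Rightarrow> real"
  assumes "t \<ge> 0"
  shows "K0u \<sigma> \<mu> \<nu> t f x = coupling \<mu> \<nu> True True t * ks.S t f x"
    and "K1u \<sigma> \<mu> \<nu> t f x = coupling \<mu> \<nu> True False t * ks.S t f x"
    and "K0v \<sigma> \<mu> \<nu> t f x = coupling \<mu> \<nu> False True t * ks.S t f x"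
    and "K1v \<sigma> \<mu> \<nu> t f x = coupling \<mu> \<nu> False False t * ks.S t f x"
  by (simp_all add: K0u_def K1u_def K0v_def K1v_def coupling_def frac_heat_op_eq[OF assms])

definition data :: "real \<Rightarrow> (real^'n \<Rightarrow> real) \<Rightarrow> (real^'n \<Rightarrow> real) \<Rightarrow> bool \<Rightarrow> real^'n \<Rightarrow> real" where
  "data \<epsilon> u0 v0 j x = \<epsilon> * truncation (if j then u0 else v0) x"

lemma S_data:
  assumes f: "f \<in> Lp_space \<infinity> \<inter> Lp_space 1" and t: "t \<ge> 0"
  shows "AE x in lborel. ks.S t (\<lambda>x. \<epsilon> * truncation f x) x = \<epsilon> * ks.S t f x"
proof (cases "t = 0")
  case True
  then show ?thesis using truncation(1)[OF f] by (auto simp: ks.S_def elim: eventually_mono)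
next
  case False
  have [measurable]: "f \<in> borel_measurable borel" "truncation f \<in> borel_measurable borel"
    using f truncation(3)[OF f] by (auto simp: Lp_space_def)
  have "conv (ks.K t) (\<lambda>x. \<epsilon> * truncation f x) x = \<epsilon> * conv (ks.K t) f x" for x
  proof -
    have "conv (ks.K t) (truncation f) x = conv (ks.K t) f x"
      by (rule conv_cong_AE[OF truncation(1)[OF f]]) measurable
    moreover have "conv (ks.K t) (\<lambda>x. \<epsilon> * truncation f x) x = \<epsilon> * conv (ks.K t) (truncation f) x"
      by (simp add: conv_def mult.left_commute)
    ultimately show ?thesis by simp
  qed
  then show ?thesis using False by (simp add: ks.S_def)
qed

lemma mild_solution_iff:
  assumes u0: "u0 \<in> Lp_space \<infinity> \<inter> Lp_space 1" and v0: "v0 \<in> Lp_space \<infinity> \<inter> Lp_space 1"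
  shows "mild_solution \<sigma> \<mu> \<nu> F G \<epsilon> u0 v0 u v \<longleftrightarrow> ks.mild (data \<epsilon> u0 v0) (\<lambda>j. if j then u else v)"
proof -
  let ?w = "\<lambda>j. if j then u else v"
  let ?I = "\<lambda>i t x \<tau>. \<Sum>j\<in>UNIV. coupling \<mu> \<nu> i j (t - \<tau>) * ks.S (t - \<tau>) (\<lambda>y. (if j then F else G) (?w j \<tau> y)) x"
  define Q where "Q i \<longleftrightarrow> (\<forall>t\<ge>0. AE x in lborel. set_integrable lborel {0..t} (?I i t x) \<and>
        ?w i t x = ks.lin (data \<epsilon> u0 v0) i t x + (LINT \<tau>:{0..t}|lborel. ?I i t x \<tau>))" for i
  have comp: "duhamel_eq K0 K1 F G \<epsilon> u0 v0 u v (?w i) \<longleftrightarrow> Q i"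
    if K: "\<And>t f x. t \<ge> 0 \<Longrightarrow> K0 t f x = coupling \<mu> \<nu> i True t * ks.S t f x"
      "\<And>t f x. t \<ge> 0 \<Longrightarrow> K1 t f x = coupling \<mu> \<nu> i False t * ks.S t f x" for K0 K1 i
    unfolding duhamel_eq_def Q_def
  proof (intro all_cong1 imp_cong refl)
    fix t :: real assume t: "t \<ge> 0"
    let ?J = "\<lambda>x \<tau>. K0 (t - \<tau>) (\<lambda>y. F (u \<tau> y)) x + K1 (t - \<tau>) (\<lambda>y. G (v \<tau> y)) x"
    have IJ: "?J x \<tau> = ?I i t x \<tau>" if "\<tau> \<in> {0..t}" for x \<tau>
      using that by (simp add: K UNIV_bool)
    have 1: "set_integrable lborel {0..t} (?J x) = set_integrable lborel {0..t} (?I i t x)" for x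
      by (rule set_integrable_cong[OF refl refl IJ]) simp_all
    have 2: "(LINT \<tau>:{0..t}|lborel. ?J x \<tau>) = (LINT \<tau>:{0..t}|lborel. ?I i t x \<tau>)" for x
      by (rule set_lebesgue_integral_cong) (use IJ in auto)
    have "AE x in lborel. ks.lin (data \<epsilon> u0 v0) i t x = \<epsilon> * K0 t u0 x + \<epsilon> * K1 t v0 x"
      using S_data[OF u0 t, of \<epsilon>] S_data[OF v0 t, of \<epsilon>]
    proof eventually_elim
      case (elim x)
      then show ?case
        using t by (simp add: ks.lin_def UNIV_bool data_def[abs_def] K algebra_simps)
    qed
    then have "AE x in lborel. (set_integrable lborel {0..t} (?J x) \<and>
        ?w i t x = \<epsilon> * K0 t u0 x + \<epsilon> * K1 t v0 x + (LINT \<tau>:{0..t}|lborel. ?J x \<tau>)) \<longleftrightarrow>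
      (set_integrable lborel {0..t} (?I i t x) \<and>
        ?w i t x = ks.lin (data \<epsilon> u0 v0) i t x + (LINT \<tau>:{0..t}|lborel. ?I i t x \<tau>))"
      by eventually_elim (simp only: 1 2)
    then show "(AE x in lborel. set_integrable lborel {0..t} (?J x) \<and>
        ?w i t x = \<epsilon> * K0 t u0 x + \<epsilon> * K1 t v0 x + (LINT \<tau>:{0..t}|lborel. ?J x \<tau>)) =
      (AE x in lborel. set_integrable lborel {0..t} (?I i t x) \<and>
        ?w i t x = ks.lin (data \<epsilon> u0 v0) i t x + (LINT \<tau>:{0..t}|lborel. ?I i t x \<tau>))"
      by (rule eventually_cong)
  qed
  have "mild_solution \<sigma> \<mu> \<nu> F G \<epsilon> u0 v0 u v \<longleftrightarrow>
      duhamel_eq (K0u \<sigma> \<mu> \<nu>) (K1u \<sigma> \<mu> \<nu>) F G \<epsilon> u0 v0 u v (?w True) \<and>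
      duhamel_eq (K0v \<sigma> \<mu> \<nu>) (K1v \<sigma> \<mu> \<nu>) F G \<epsilon> u0 v0 u v (?w False)"
    by (simp add: mild_solution_def)
  also have "\<dots> \<longleftrightarrow> Q True \<and> Q False"
    using comp[of "K0u \<sigma> \<mu> \<nu>" True "K1u \<sigma> \<mu> \<nu>", OF solution_operator_eq(1,2)]
      comp[of "K0v \<sigma> \<mu> \<nu>" False "K1v \<sigma> \<mu> \<nu>", OF solution_operator_eq(3,4)]
    by simp
  also have "\<dots> \<longleftrightarrow> (\<forall>i. Q i)" by (auto simp: all_bool_eq)
  also have "\<dots> \<longleftrightarrow> ks.mild (data \<epsilon> u0 v0) ?w" by (simp only: Q_def ks.mild_def)
  finally show ?thesis .
qed

lemma bounded_data:
  assumes u0: "u0 \<in> Lp_space \<infinity> \<inter> Lp_space 1" and v0: "v0 \<in> Lp_space \<infinity> \<inter> Lp_space 1" and \<epsilon>: "\<epsilon> > 0"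
  shows "ks.bounded_data (\<epsilon> * data_norm u0 v0) (data \<epsilon> u0 v0)"
  unfolding ks.bounded_data_def
proof (intro allI conjI)
  fix j :: bool
  let ?f = "if j then u0 else v0"
  have f: "?f \<in> Lp_space \<infinity> \<inter> Lp_space 1" using u0 v0 by simp
  have le: "Lp_norm \<infinity> ?f \<le> data_norm u0 v0" "Lp_norm 1 ?f \<le> data_norm u0 v0"
    using Lp_norm_nonneg[of \<infinity> u0] Lp_norm_nonneg[of 1 u0] Lp_norm_nonneg[of \<infinity> v0] Lp_norm_nonneg[of 1 v0]
    by (auto simp: data_norm_def)
  show "integrable lborel (data \<epsilon> u0 v0 j)" unfolding data_def[abs_def] using truncation(3)[OF f] by simp
  show "\<bar>data \<epsilon> u0 v0 j y\<bar> \<le> \<epsilon> * data_norm u0 v0" for y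
    using truncation(2)[OF f, of y] le(1) \<epsilon> by (simp add: data_def abs_mult)
  show "(LINT y|lborel. \<bar>data \<epsilon> u0 v0 j y\<bar>) \<le> \<epsilon> * data_norm u0 v0"
    using truncation(4)[OF f] le(2) \<epsilon> by (simp add: data_def abs_mult)
qed

lemma lipschitz:
  "\<exists>\<Lambda>'. \<forall>j a b. \<bar>a\<bar> \<le> R \<longrightarrow> \<bar>b\<bar> \<le> R \<longrightarrow>
     \<bar>(if j then F else G) a - (if j then F else G) b\<bar> \<le> \<Lambda>' * \<bar>a - b\<bar>"
proof (intro exI allI impI)
  fix j and a b :: real assume ab: "\<bar>a\<bar> \<le> R" "\<bar>b\<bar> \<le> R"
  let ?l = "p * R powr (p - 1) + q * R powr (q - 1)"
  have "p * R powr (p - 1) * \<bar>a - b\<bar> \<le> ?l * \<bar>a - b\<bar>" "q * R powr (q - 1) * \<bar>a - b\<bar> \<le> ?l * \<bar>a - b\<bar>"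
    using p q by (auto intro!: mult_right_mono)
  then show "\<bar>(if j then F else G) a - (if j then F else G) b\<bar> \<le> ?l * \<bar>a - b\<bar>"
    using power_reading_lipschitz[OF F p ab] power_reading_lipschitz[OF G q ab] by (cases j) auto
qed

lemma ex_small_radius: "\<exists>M>0. M \<le> 1 \<and> (\<forall>M'. 0 \<le> M' \<longrightarrow> M' \<le> M \<longrightarrow> ks.contraction M' \<le> 1 / 2)"
proof -
  define e where "e = min p q - 1"
  have e: "e > 0" using p q by (auto simp: e_def)
  define c where "c = ks.contraction 1"
  have q_eq: "ks.contraction M = c * M powr e" for M by (simp add: c_def ks.contraction_def e_def)
  have c: "c \<ge> 0" by (simp add: c_def ks.contraction_nonneg)
  define M where "M = min 1 ((1 / (2 * (c + 1))) powr (1 / e))"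
  have M: "M > 0" "M \<le> 1" using c by (auto simp: M_def)
  have "ks.contraction M' \<le> 1 / 2" if M': "0 \<le> M'" "M' \<le> M" for M'
  proof -
    have "M' powr e \<le> ((1 / (2 * (c + 1))) powr (1 / e)) powr e"
      using M' e by (intro powr_mono2) (auto simp: M_def)
    also have "\<dots> = 1 / (2 * (c + 1))" using e c by (simp add: powr_powr)
    finally have "c * M' powr e \<le> c * (1 / (2 * (c + 1)))" using c by (rule mult_left_mono)
    also have "\<dots> \<le> 1 / 2" using c by (simp add: field_simps)
    finally show ?thesis by (simp add: q_eq)
  qed
  then show ?thesis using M by blast
qed

lemma solution_at_0:
  assumes "ks.solves f M w"
  shows "w i 0 x = f i x"
proof -
  have "ks.duh w i 0 x = 0" by (simp add: ks.duh_def ks.D_at_0)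
  moreover have "ks.lin f i 0 x = f i x"
    by (cases i) (simp_all add: ks.lin_def UNIV_bool ks.\<kappa>_0 ks.S_def)
  ultimately show ?thesis using assms by (simp add: ks.solves_def)
qed

text \<open>
  The value at time \<open>0\<close> is the truncated datum, which agrees with the uniformly continuous
  function almost everywhere only; this is why the convergence is stated for the essential supremum.
\<close>

lemma solution_Lp_continuous_at_0:
  assumes f: "ks.bounded_data m f" and w: "ks.solves f M w" and M: "M \<le> 1"
    and g: "uniformly_continuous_on UNIV g" and fg: "AE y in lborel. f i y = g y"
  shows "Lp_continuous_on \<infinity> {0..} (w i)"
proof (rule Lp_continuous_on_infI[of _ _ M])
  have wd: "ks.decaying M (w i)" using w by (simp add: ks.solves_def)
  show "M \<ge> 0" by (rule ks.decaying_nonneg[OF wd])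
  show "w i t \<in> borel_measurable borel" if "t \<in> {0..}" for t
    using wd that by (auto simp: ks.decaying_def)
  show "\<bar>w i t x\<bar> \<le> M" if "t \<in> {0..}" for t x
    using ks.decaying_bounded[OF wd] that by simp
  fix t e :: real assume t: "t \<in> {0..}" and e: "e > 0"
  show "\<forall>\<^sub>F a in at t within {0..}. AE x in lborel. \<bar>w i a x - w i t x\<bar> \<le> e"
  proof (cases "t = 0")
    case False
    then have "\<forall>\<^sub>F a in at t. \<forall>x. \<bar>w i a x - w i t x\<bar> \<le> e"
      using t e by (intro ks.solution_sup_continuous[OF f w M]) auto
    then have "\<forall>\<^sub>F a in at t within {0..}. \<forall>x. \<bar>w i a x - w i t x\<bar> \<le> e"
      using filter_leD[OF at_le[of "{0..}" UNIV t]] by simp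
    then show ?thesis by eventually_elim simp
  next
    case True
    \<comment> \<open>cutting \<open>g\<close> off at the bound of the datum makes it bounded everywhere\<close>
    define h where "h = (\<lambda>y. max (- m) (min m (g y)))"
    have fm: "\<bar>f i y\<bar> \<le> m" for y using f by (simp add: ks.bounded_data_def)
    have m: "m \<ge> 0" using fm[of 0] by linarith
    have "\<bar>h y - h z\<bar> \<le> \<bar>g y - g z\<bar>" for y z by (auto simp: h_def)
    then have "uniformly_continuous_on UNIV h"
      using g unfolding uniformly_continuous_on_def dist_real_def by (meson le_less_trans)
    moreover have "\<bar>h y\<bar> \<le> m" for y using m by (auto simp: h_def)
    moreover have fh: "AE y in lborel. f i y = h y"
      using fg
    proof eventually_elim
      case (elim y)
      then show ?case using fm[of y] by (auto simp: h_def)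
    qed
    ultimately have "\<forall>\<^sub>F a in at_right 0. \<forall>x. \<bar>w i a x - h x\<bar> \<le> e"
      using e by (intro ks.solution_sup_at_0[OF f w M])
    then have "\<forall>\<^sub>F a in at 0 within {0..}. \<forall>x. \<bar>w i a x - h x\<bar> \<le> e"
      by (auto simp: eventually_at_filter elim: eventually_mono)
    then show ?thesis
      unfolding True
    proof eventually_elim
      case (elim a)
      from fh show ?case
        by eventually_elim (use elim in \<open>simp add: solution_at_0[OF w]\<close>)
    qed
  qed
qed

lemma solution_Lp_curve:
  assumes f: "ks.bounded_data m f" and w: "ks.solves f M w" and M: "M \<le> 1" and l: "l \<ge> 1"
  shows "Lp_curve l (w i)"
proof (rule Lp_curveI[of _ M])
  have wd: "ks.decaying M (w i)" using w by (simp add: ks.solves_def)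
  show "\<bar>w i t x\<bar> \<le> M" if "t \<ge> 0" for t x
    by (rule ks.decaying_bounded[OF wd that])
  show "integrable lborel (w i t)" if "t \<ge> 0" for t using wd that by (simp add: ks.decaying_def)
qed (use ks.solution_L1_continuous[OF f w M] ks.solution_sup_continuous[OF f w M] l in auto)

lemma Lp_curves_L1_bounded:
  fixes w :: "real \<Rightarrow> real^'n \<Rightarrow> real"
  assumes "\<And>m. m \<ge> 1 \<Longrightarrow> Lp_curve m w"
  shows "ks.L1_curve w" "ks.locally_bounded w"
proof -
  have "Lp_continuous_on 1 {0..} w" using assms[of 1] by (simp add: Lp_curve_def)
  then show "ks.L1_curve w"
    by (auto simp: ks.L1_curve_def Lp_continuous_on_def Lp_1_iff Lp_norm_1)
  show "ks.locally_bounded w"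
    unfolding ks.locally_bounded_def using Lp_curve_inf_locally_bounded[OF assms[of \<infinity>]] by simp
qed

text \<open>
  The radius \<open>2 (lin_const m)\<close>, twice the size of the linear part, is the one for which the iteration
  starting from data of size \<open>m\<close> stays in the ball; it also makes the final bound linear in the
  data.
\<close>

definition small_data :: "(real^'n \<Rightarrow> real) \<Rightarrow> (real^'n \<Rightarrow> real) \<Rightarrow> real \<Rightarrow> bool" where
  "small_data u0 v0 \<epsilon> \<longleftrightarrow> 2 * (ks.lin_const * (\<epsilon> * data_norm u0 v0)) \<le> 1 \<and> ks.contraction (2 * (ks.lin_const * (\<epsilon> * data_norm u0 v0))) \<le> 1 / 2"

lemma ex_small_data: "\<exists>\<epsilon>0>0. \<forall>\<epsilon>\<in>{0<..\<epsilon>0}. small_data u0 v0 \<epsilon>"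
proof -
  let ?D = "data_norm u0 v0"
  have D: "?D \<ge> 0" by (simp add: data_norm_def Lp_norm_nonneg)
  obtain M0 where M0: "M0 > 0" "M0 \<le> 1" "\<And>M. 0 \<le> M \<Longrightarrow> M \<le> M0 \<Longrightarrow> ks.contraction M \<le> 1 / 2"
    using ex_small_radius by blast
  define \<epsilon>0 where "\<epsilon>0 = M0 / (2 * ks.lin_const * (?D + 1))"
  have \<epsilon>0: "\<epsilon>0 > 0" using M0 ks.lin_const_pos D by (simp add: \<epsilon>0_def)
  show ?thesis
  proof (intro exI[of _ \<epsilon>0] conjI \<epsilon>0 ballI)
    fix \<epsilon> assume \<epsilon>: "\<epsilon> \<in> {0<..\<epsilon>0}"
    have "0 \<le> 2 * (ks.lin_const * (\<epsilon> * ?D))" using ks.lin_const_pos \<epsilon> D by simp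
    moreover have "2 * (ks.lin_const * (\<epsilon> * ?D)) \<le> 2 * (ks.lin_const * (\<epsilon>0 * (?D + 1)))"
      using ks.lin_const_pos \<epsilon> D by (intro mult_left_mono mult_mono) auto
    moreover have "2 * (ks.lin_const * (\<epsilon>0 * (?D + 1))) = M0" using ks.lin_const_pos D by (simp add: \<epsilon>0_def)
    ultimately show "small_data u0 v0 \<epsilon>" using M0 by (simp add: small_data_def)
  qed
qed

theorem small_data_solution:
  fixes u0 v0 :: "real^'n \<Rightarrow> real"
  assumes u0: "u0 \<in> Lp_space \<infinity> \<inter> Lp_space 1" and v0: "v0 \<in> Lp_space \<infinity> \<inter> Lp_space 1"
    and \<epsilon>: "\<epsilon> > 0" and small: "small_data u0 v0 \<epsilon>"
  shows "\<exists>u v.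
         (\<forall>m1\<ge>1. \<forall>m2\<ge>1. Lp_curve m1 u \<and> Lp_curve m2 v) \<and>
         mild_solution \<sigma> \<mu> \<nu> F G \<epsilon> u0 v0 u v \<and>
         (\<forall>u' v'. (\<forall>m1\<ge>1. \<forall>m2\<ge>1. Lp_curve m1 u' \<and> Lp_curve m2 v') \<longrightarrow>
            mild_solution \<sigma> \<mu> \<nu> F G \<epsilon> u0 v0 u' v' \<longrightarrow>
            (\<forall>t\<ge>0. AE x in lborel. u' t x = u t x \<and> v' t x = v t x)) \<and>
         (\<forall>m1\<ge>1. \<forall>m2\<ge>1. \<forall>t\<ge>0.
            Lp_norm m1 (u t) \<le> 2 * ks.lin_const * \<epsilon> *
              (1 + t) powr (- (real CARD('n) / (2 * \<sigma>)) * (1 - enn2real (1 / m1))) * data_norm u0 v0 \<and>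
            Lp_norm m2 (v t) \<le> 2 * ks.lin_const * \<epsilon> *
              (1 + t) powr (- (real CARD('n) / (2 * \<sigma>)) * (1 - enn2real (1 / m2))) * data_norm u0 v0) \<and>
         (has_ucont_version u0 \<longrightarrow> Lp_continuous_on \<infinity> {0..} u) \<and>
         (has_ucont_version v0 \<longrightarrow> Lp_continuous_on \<infinity> {0..} v)"
proof -
  let ?D = "data_norm u0 v0"
  define M where "M = 2 * (ks.lin_const * (\<epsilon> * ?D))"
  have M1: "M \<le> 1" and qM: "ks.contraction M \<le> 1 / 2" using small by (simp_all add: small_data_def M_def)
  note f = bounded_data[OF u0 v0 \<epsilon>]
  obtain w where w: "ks.solves (data \<epsilon> u0 v0) M w"
    using ks.ex_solution[OF f _ M1 qM] by (auto simp: M_def)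
  have wd: "ks.decaying M (w i)" for i using w by (simp add: ks.solves_def)
  have weq: "(\<lambda>j. if j then w True else w False) = w" by (auto simp: fun_eq_iff)
  have mild: "ks.mild (data \<epsilon> u0 v0) w" by (rule ks.solution_mild[OF w M1])
  have curve: "Lp_curve m (w i)" if "m \<ge> 1" for m i by (rule solution_Lp_curve[OF f w M1 that])
  have norm: "Lp_norm m (w i t) \<le> 2 * ks.lin_const * \<epsilon> *
      (1 + t) powr (- (real CARD('n) / (2 * \<sigma>)) * (1 - enn2real (1 / m))) * ?D"
    if "m \<ge> 1" "t \<ge> 0" for m i t
    using ks.decaying_Lp_norm[OF wd that(2,1), of i] unfolding decay_rate M_def by (simp add: mult_ac)
  have ucont: "Lp_continuous_on \<infinity> {0..} (w i)" if f0: "has_ucont_version (if i then u0 else v0)" for i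
  proof -
    obtain g where g: "uniformly_continuous_on UNIV g" "AE x in lborel. (if i then u0 else v0) x = g x"
      using f0 by (auto simp: has_ucont_version_def)
    have "(if i then u0 else v0) \<in> Lp_space \<infinity> \<inter> Lp_space 1" using u0 v0 by simp
    from truncation(1)[OF this] g(2) have "AE x in lborel. data \<epsilon> u0 v0 i x = \<epsilon> * g x"
      by eventually_elim (simp add: data_def)
    moreover have "uniformly_continuous_on UNIV (\<lambda>x. \<epsilon> * g x)"
      using g(1) by (rule uniformly_continuous_on_cmul_left)
    ultimately show ?thesis by (intro solution_Lp_continuous_at_0[OF f w M1])
  qed
  show ?thesis
  proof (rule exI[of _ "w True"], rule exI[of _ "w False"], intro conjI)
    show "\<forall>m1\<ge>1. \<forall>m2\<ge>1. Lp_curve m1 (w True) \<and> Lp_curve m2 (w False)" using curve by blast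
    show "mild_solution \<sigma> \<mu> \<nu> F G \<epsilon> u0 v0 (w True) (w False)"
      unfolding mild_solution_iff[OF u0 v0] weq by (rule mild)
    show "\<forall>u' v'. (\<forall>m1\<ge>1. \<forall>m2\<ge>1. Lp_curve m1 u' \<and> Lp_curve m2 v') \<longrightarrow>
          mild_solution \<sigma> \<mu> \<nu> F G \<epsilon> u0 v0 u' v' \<longrightarrow>
          (\<forall>t\<ge>0. AE x in lborel. u' t x = w True t x \<and> v' t x = w False t x)"
    proof (intro allI impI)
      fix u' v' :: "real \<Rightarrow> real^'n \<Rightarrow> real" and t :: real
      assume c: "\<forall>m1\<ge>1. \<forall>m2\<ge>1. Lp_curve m1 u' \<and> Lp_curve m2 v'"
        and s: "mild_solution \<sigma> \<mu> \<nu> F G \<epsilon> u0 v0 u' v'" and t: "t \<ge> 0"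
      let ?w' = "\<lambda>j. if j then u' else v'"
      have c': "Lp_curve m (?w' j)" if "m \<ge> 1" for m j using c that by (cases j) auto
      have "AE x in lborel. ?w' i t x = w i t x" for i
      proof (rule ks.mild_unique[OF lipschitz _ _ _ _ _ mild t])
        show "ks.mild (data \<epsilon> u0 v0) ?w'" using s unfolding mild_solution_iff[OF u0 v0] .
        show "ks.L1_curve (?w' j)" "ks.locally_bounded (?w' j)" for j
          by (rule Lp_curves_L1_bounded, rule c', assumption)+
        show "ks.L1_curve (w j)" "ks.locally_bounded (w j)" for j
          by (rule Lp_curves_L1_bounded, rule curve, assumption)+
      qed
      from this[of True] this[of False]
      show "AE x in lborel. u' t x = w True t x \<and> v' t x = w False t x"
        by (simp add: eventually_conj_iff)
    qed
    show "\<forall>m1\<ge>1. \<forall>m2\<ge>1. \<forall>t\<ge>0.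
          Lp_norm m1 (w True t) \<le> 2 * ks.lin_const * \<epsilon> *
            (1 + t) powr (- (real CARD('n) / (2 * \<sigma>)) * (1 - enn2real (1 / m1))) * ?D \<and>
          Lp_norm m2 (w False t) \<le> 2 * ks.lin_const * \<epsilon> *
            (1 + t) powr (- (real CARD('n) / (2 * \<sigma>)) * (1 - enn2real (1 / m2))) * ?D"
      using norm by blast
    show "has_ucont_version u0 \<longrightarrow> Lp_continuous_on \<infinity> {0..} (w True)" using ucont[of True] by simp
    show "has_ucont_version v0 \<longrightarrow> Lp_continuous_on \<infinity> {0..} (w False)" using ucont[of False] by simp
  qed
qed

end

theorem theorem2p1:
  fixes \<sigma> \<mu> \<nu> p q :: real and F G :: "real \<Rightarrow> real"
  assumes "\<sigma> > 0" and "\<mu> > 0" and "\<nu> > 0" and "p > 1" and "q > 1"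
    and "min p q > 1 + 2 * \<sigma> / real CARD('n::finite)"
    and "F \<in> power_readings p" and "G \<in> power_readings q"
  shows "\<exists>C :: ennreal \<Rightarrow> real. (\<forall>m\<ge>1. C m > 0) \<and>
    (\<forall>u0 v0 :: real^'n \<Rightarrow> real.
      u0 \<in> Lp_space \<infinity> \<inter> Lp_space 1 \<longrightarrow> v0 \<in> Lp_space \<infinity> \<inter> Lp_space 1 \<longrightarrow>
      (\<exists>\<epsilon>0>0. \<forall>\<epsilon>\<in>{0<..\<epsilon>0}. \<exists>u v.
         (\<forall>m1\<ge>1. \<forall>m2\<ge>1. Lp_curve m1 u \<and> Lp_curve m2 v) \<and>
         mild_solution \<sigma> \<mu> \<nu> F G \<epsilon> u0 v0 u v \<and>
         (\<forall>u' v'. (\<forall>m1\<ge>1. \<forall>m2\<ge>1. Lp_curve m1 u' \<and> Lp_curve m2 v') \<longrightarrow>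
            mild_solution \<sigma> \<mu> \<nu> F G \<epsilon> u0 v0 u' v' \<longrightarrow>
            (\<forall>t\<ge>0. AE x in lborel. u' t x = u t x \<and> v' t x = v t x)) \<and>
         (\<forall>m1\<ge>1. \<forall>m2\<ge>1. \<forall>t\<ge>0.
            Lp_norm m1 (u t) \<le> C m1 * \<epsilon> *
              (1 + t) powr (- (real CARD('n) / (2 * \<sigma>)) * (1 - enn2real (1 / m1))) * data_norm u0 v0 \<and>
            Lp_norm m2 (v t) \<le> C m2 * \<epsilon> *
              (1 + t) powr (- (real CARD('n) / (2 * \<sigma>)) * (1 - enn2real (1 / m2))) * data_norm u0 v0) \<and>
         (has_ucont_version u0 \<longrightarrow> Lp_continuous_on \<infinity> {0..} u) \<and>
         (has_ucont_version v0 \<longrightarrow> Lp_continuous_on \<infinity> {0..} v)))"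
proof -
  obtain B where B: "kernel_system (frac_profile \<sigma> :: real^'n \<Rightarrow> real) (2 * \<sigma>) B (2 * \<sigma>)
    (coupling \<mu> \<nu>) (\<lambda>j. if j then F else G) (min p q) (p + q)"
    using frac_kernel_system[OF assms] by blast
  interpret frac_system \<sigma> \<mu> \<nu> p q F G "2 * \<sigma>" B "TYPE('n)"
    by (intro frac_system.intro assms B refl)
  show ?thesis
  proof (rule exI[of _ "\<lambda>_. 2 * ks.lin_const"], intro conjI allI impI, goal_cases)
    case (1 m)
    show ?case using ks.lin_const_pos by simp
  next
    case (2 u0 v0)
    obtain \<epsilon>0 where \<epsilon>0: "\<epsilon>0 > 0" "\<forall>\<epsilon>\<in>{0<..\<epsilon>0}. small_data u0 v0 \<epsilon>"
      using ex_small_data by blast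
    show ?case
    proof (intro exI[of _ \<epsilon>0] conjI \<epsilon>0 ballI, goal_cases)
      case (1 \<epsilon>)
      show ?case
        by (rule small_data_solution[OF 2]) (use 1 \<epsilon>0 in auto)
    qed
  qed
qed

end
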